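(* Let $k\in\mathbb{N}$, $k \ge 1$, be fixed. Given a nice product measure $\mu$ on $[0,1]^n$ and $c\in\mathbb{Q}^n_{\ge 0}$ (that is, given an instance of the Pareto cover problem with cover size $k$), the problem of computing an (approximately) optimal Pareto cover of size $k$ with respect to $\mu$ and $c$ admits an FPTAS: there is an algorithm that, given an instance $I$ of the Pareto cover problem with cover size $k$ and $\gamma\in(0,1)\cap\mathbb{Q}$, computes a $(1+\gamma)$-approximate solution to $I$ in time polynomial in $\gamma^{-1}$ and the encoding length of $I$.
   Context: For $x,b\in[0,1]^n$ write $x\le b$ if $x_i\le b_i$ for all $i$ ("$b$ covers $x$"). For a finite set $B\subseteq[0,1]^n$ and $c\in\mathbb{R}^n$, $c_B(x)=\min\{c^\top b : b\in B,\ x\le b\}$, with $c_B(x)=\infty$ if no $b\in B$ covers $x$. A finite $B\subseteq[0,1]^n$ is a Pareto cover of a (Borel) probability measure $\mu$ on $[0,1]^n$ if $\mu(\{x\in[0,1]^n : x\le b\text{ for some }b\in B\})=1$. A probability measure $\nu$ on $[0,1]$ is nice if there is an oracle $\sigma:\{(a,b)\in\mathbb{Q}^2:-1\le a<b\le 1\}\times(0,1)\to\mathbb{Q}_{\ge0}$ that, given rational inputs $a<b\le 1$ and $\delta\in(0,1)$, computes a rational number $\sigma(a,b,\delta)$ with $(1+\delta)^{-1}\nu((a,b]\cap[0,1])\le\sigma(a,b,\delta)\le(1+\delta)\nu((a,b]\cap[0,1])$ in time polynomial in the encoding lengths of $a,b,\delta$. Pareto cover problem: an instance $I$ consists of oracles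 $\sigma_1,\dots,\sigma_n$ for nice probability measures $\mu_1,\dots,\mu_n$ on $[0,1]$, $c\in\mathbb{Q}^n_{\ge0}$, $k\in\mathbb{Z}_{\ge1}$, and $\alpha\in(0,1)\cap\mathbb{Q}$ with $\alpha\le\min_{i=1}^n\mathrm{E}_{X_i\sim\mu_i}[X_i]$; the task is to find a Pareto cover $B$ of the product measure $\mu=\prod_{i=1}^n\mu_i$ with $|B|=k$ minimizing $\mathrm{E}_\mu[c_B]$. An algorithm accesses $\mu_1,\dots,\mu_n$ only by querying the oracles $\sigma_i$; the encoding length of the oracles is defined to be $0$, and all other data are encoded in binary. A $(1+\gamma)$-approximate solution is a Pareto cover $B$ of $\mu$ of size $k$ with $\mathrm{E}_\mu[c_B]$ at most $(1+\gamma)$ times the optimum value.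
   Formalization: The running time is bounded by a polynomial in 1/γ and the encoding length of I plus a constant times the encoding length of γ; the extra term is needed because merely reading γ (e.g. γ = 1/2 + 2^-N) takes time not bounded in terms of 1/γ and I. *)

theory Defs
  imports "HOL-Probability.Probability" "HOL-Library.Log_Nat"
    "HOL-Computational_Algebra.Polynomial"
begin

section \<open>Values and binary encoding length\<close>

datatype val = Num rat | List "val list"

text \<open>Sign plus binary digits.\<close>
definition int_len :: "int \<Rightarrow> nat" where
  "int_len z = 1 + nat (bitlen \<bar>z\<bar>)"

definition rat_len :: "rat \<Rightarrow> nat" where
  "rat_len r = int_len (fst (quotient_of r)) + int_len (snd (quotient_of r))"

fun val_len :: "val \<Rightarrow> nat" where
  "val_len (Num r) = 1 + rat_len r"
| "val_len (List vs) = 1 + sum_list (map val_len vs)"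


section \<open>Programs with oracle access\<close>

text \<open>The machine model is a while language whose variables hold rationals and nested lists.
  Every operation is charged the encoding lengths of its operands and of its result (logarithmic
  cost). All primitive operations are polynomial-time computable in these lengths, so running
  times agree with those of Turing machines up to a polynomial.\<close>

type_synonym state = "nat \<Rightarrow> val"

datatype unop = Floor | Head | Tail
datatype binop = Add | Sub | Mul | Div | Less | Equal | Push

datatype expr = Var nat | Const val | Unary unop expr | Binary binop expr expr

text \<open>Ill-typed operands are read as \<open>0\<close> and as the empty list, respectively.\<close>
fun rat_of :: "val \<Rightarrow> rat" where
  "rat_of (Num r) = r"
| "rat_of (List vs) = 0"

fun items :: "val \<Rightarrow> val list" where
  "items (Num r) = []"
| "items (List vs) = vs"

fun eval_un :: "unop \<Rightarrow> val \<Rightarrow> val" where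
  "eval_un Floor v = Num (of_int \<lfloor>rat_of v\<rfloor>)"
| "eval_un Head v = (case items v of [] \<Rightarrow> List [] | w # ws \<Rightarrow> w)"
| "eval_un Tail v = List (tl (items v))"

fun eval_bin :: "binop \<Rightarrow> val \<Rightarrow> val \<Rightarrow> val" where
  "eval_bin Add v w = Num (rat_of v + rat_of w)"
| "eval_bin Sub v w = Num (rat_of v - rat_of w)"
| "eval_bin Mul v w = Num (rat_of v * rat_of w)"
| "eval_bin Div v w = Num (rat_of v / rat_of w)"
| "eval_bin Less v w = Num (if rat_of v < rat_of w then 1 else 0)"
| "eval_bin Equal v w = Num (if v = w then 1 else 0)"
| "eval_bin Push v w = List (v # items w)"

fun eval :: "expr \<Rightarrow> state \<Rightarrow> val" where
  "eval (Var x) s = s x"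
| "eval (Const v) s = v"
| "eval (Unary f e) s = eval_un f (eval e s)"
| "eval (Binary f d e) s = eval_bin f (eval d s) (eval e s)"

text \<open>The cost of a subexpression includes the length of its value, so the operands of an
  operation are paid for as well.\<close>
fun eval_cost :: "expr \<Rightarrow> state \<Rightarrow> nat" where
  "eval_cost (Var x) s = 1 + val_len (s x)"
| "eval_cost (Const v) s = 1 + val_len v"
| "eval_cost (Unary f e) s = 1 + eval_cost e s + val_len (eval (Unary f e) s)"
| "eval_cost (Binary f d e) s =
     1 + eval_cost d s + eval_cost e s + val_len (eval (Binary f d e) s)"

text \<open>An oracle is a black box: an answer together with the time taken to produce it.\<close>
record measure_oracle =
  answer :: "rat \<Rightarrow> rat \<Rightarrow> rat \<Rightarrow> rat"
  latency :: "rat \<Rightarrow> rat \<Rightarrow> rat \<Rightarrow> nat"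

definition valid_query :: "rat \<Rightarrow> rat \<Rightarrow> rat \<Rightarrow> bool" where
  "valid_query a b \<delta> \<longleftrightarrow> -1 \<le> a \<and> a < b \<and> b \<le> 1 \<and> 0 < \<delta> \<and> \<delta> < 1"

text \<open>\<open>Query x i a b d\<close> stores in variable \<open>x\<close> the answer of the \<open>i\<close>-th oracle
  to the query given by the values of \<open>a\<close>, \<open>b\<close> and \<open>d\<close>.\<close>
datatype prog =
    Skip
  | Assign nat expr
  | Seq prog prog
  | Cond expr prog prog
  | While expr prog
  | Query nat expr expr expr expr

text \<open>Big-step semantics; \<open>t\<close> is the running time, including the time used by the oracles.
  An invalid query has no rule, so a program issuing one produces no result.\<close>
inductive exec :: "measure_oracle list \<Rightarrow> prog \<Rightarrow> state \<Rightarrow> nat \<Rightarrow> state \<Rightarrow> bool"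
  for \<Omega> :: "measure_oracle list" where
  exec_Skip: "exec \<Omega> Skip s 1 s"
| exec_Assign: "exec \<Omega> (Assign x e) s (1 + eval_cost e s) (s(x := eval e s))"
| exec_Seq: "exec \<Omega> P s t s' \<Longrightarrow> exec \<Omega> Q s' u s'' \<Longrightarrow> exec \<Omega> (Seq P Q) s (t + u) s''"
| exec_Cond_True: "eval e s \<noteq> Num 0 \<Longrightarrow> exec \<Omega> P s t s' \<Longrightarrow>
    exec \<Omega> (Cond e P Q) s (1 + eval_cost e s + t) s'"
| exec_Cond_False: "eval e s = Num 0 \<Longrightarrow> exec \<Omega> Q s t s' \<Longrightarrow>
    exec \<Omega> (Cond e P Q) s (1 + eval_cost e s + t) s'"
| exec_While_True: "eval e s \<noteq> Num 0 \<Longrightarrow> exec \<Omega> P s t s' \<Longrightarrow> exec \<Omega> (While e P) s' u s'' \<Longrightarrow>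
    exec \<Omega> (While e P) s (1 + eval_cost e s + t + u) s''"
| exec_While_False: "eval e s = Num 0 \<Longrightarrow> exec \<Omega> (While e P) s (1 + eval_cost e s) s"
| exec_Query: "eval ei s = Num (of_nat i) \<Longrightarrow> i < length \<Omega> \<Longrightarrow>
    eval ea s = Num a \<Longrightarrow> eval eb s = Num b \<Longrightarrow> eval ed s = Num \<delta> \<Longrightarrow> valid_query a b \<delta> \<Longrightarrow>
    r = answer (\<Omega> ! i) a b \<delta> \<Longrightarrow>
    exec \<Omega> (Query x ei ea eb ed) s
      (1 + eval_cost ei s + eval_cost ea s + eval_cost eb s + eval_cost ed s
         + latency (\<Omega> ! i) a b \<delta> + val_len (Num r))
      (s(x := Num r))"

text \<open>Input and output are passed in variable \<open>0\<close>.\<close>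
definition runs :: "measure_oracle list \<Rightarrow> prog \<Rightarrow> val \<Rightarrow> nat \<Rightarrow> val \<Rightarrow> bool" where
  "runs \<Omega> P v t w \<longleftrightarrow> (\<exists>s. exec \<Omega> P ((\<lambda>_. List [])(0 := v)) t s \<and> s 0 = w)"


section \<open>Nice measures\<close>

text \<open>Borel probability measures on the unit interval.\<close>
definition unit_prob :: "real measure \<Rightarrow> bool" where
  "unit_prob \<nu> \<longleftrightarrow> prob_space \<nu> \<and> sets \<nu> = sets (restrict_space borel {0..1})"

text \<open>\<open>\<sigma>\<close> is implemented by an (oracle-free) program whose running time is bounded by the
  polynomial \<open>p\<close> and approximates the measures of half-open intervals.\<close>
definition nice_oracle :: "real poly \<Rightarrow> real measure \<Rightarrow> measure_oracle \<Rightarrow> bool" where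
  "nice_oracle p \<nu> \<sigma> \<longleftrightarrow>
     (\<exists>P. \<forall>a b \<delta>. valid_query a b \<delta> \<longrightarrow>
        runs [] P (List [Num a, Num b, Num \<delta>]) (latency \<sigma> a b \<delta>) (Num (answer \<sigma> a b \<delta>))) \<and>
     (\<forall>a b \<delta>. valid_query a b \<delta> \<longrightarrow>
        real (latency \<sigma> a b \<delta>) \<le> poly p (real (rat_len a + rat_len b + rat_len \<delta>)) \<and>
        0 \<le> answer \<sigma> a b \<delta> \<and>
        inverse (1 + of_rat \<delta>) * measure \<nu> ({of_rat a<..of_rat b} \<inter> {0..1})
          \<le> of_rat (answer \<sigma> a b \<delta>) \<and>
        of_rat (answer \<sigma> a b \<delta>)
          \<le> (1 + of_rat \<delta>) * measure \<nu> ({of_rat a<..of_rat b} \<inter> {0..1}))"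

definition nice :: "real measure \<Rightarrow> bool" where
  "nice \<nu> \<longleftrightarrow> unit_prob \<nu> \<and> (\<exists>p \<sigma>. nice_oracle p \<nu> \<sigma>)"


section \<open>Pareto covers\<close>

definition cube :: "nat \<Rightarrow> (nat \<Rightarrow> real) set" where
  "cube n = (\<Pi>\<^sub>E i\<in>{..<n}. {0..1})"

definition covers :: "nat \<Rightarrow> (nat \<Rightarrow> real) \<Rightarrow> (nat \<Rightarrow> real) \<Rightarrow> bool" where
  "covers n b x \<longleftrightarrow> (\<forall>i<n. x i \<le> b i)"

text \<open>For finite \<open>B\<close> the infimum is a minimum, and it is \<open>\<infinity>\<close> if no element of \<open>B\<close> covers \<open>x\<close>.\<close>
definition cover_cost ::
  "nat \<Rightarrow> (nat \<Rightarrow> real) \<Rightarrow> (nat \<Rightarrow> real) set \<Rightarrow> (nat \<Rightarrow> real) \<Rightarrow> ereal" where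
  "cover_cost n c B x = (INF b\<in>{b \<in> B. covers n b x}. ereal (\<Sum>i<n. c i * b i))"

definition pareto_cover :: "nat \<Rightarrow> (nat \<Rightarrow> real) measure \<Rightarrow> (nat \<Rightarrow> real) set \<Rightarrow> bool" where
  "pareto_cover n M B \<longleftrightarrow>
     finite B \<and> B \<subseteq> cube n \<and> emeasure M {x \<in> cube n. \<exists>b\<in>B. covers n b x} = 1"

record pareto_instance =
  measures :: "real measure list"
  oracles :: "measure_oracle list"
  costs :: "rat list"
  cover_size :: nat
  alpha :: rat

definition dim :: "pareto_instance \<Rightarrow> nat" where
  "dim I = length (costs I)"

text \<open>The parameter \<open>p\<close> is a common polynomial bound on the running times of the oracles.\<close>
definition valid_instance :: "real poly \<Rightarrow> pareto_instance \<Rightarrow> bool" where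
  "valid_instance p I \<longleftrightarrow>
     dim I \<ge> 1 \<and> length (measures I) = dim I \<and> length (oracles I) = dim I \<and>
     (\<forall>i<dim I. nice (measures I ! i) \<and> nice_oracle p (measures I ! i) (oracles I ! i)) \<and>
     (\<forall>i<dim I. 0 \<le> costs I ! i) \<and>
     cover_size I \<ge> 1 \<and>
     0 < alpha I \<and> alpha I < 1 \<and>
     (\<forall>i<dim I. of_rat (alpha I) \<le> (\<integral>x. x \<partial>(measures I ! i)))"

text \<open>Measures and oracles do not contribute to the encoding.\<close>
definition encode_instance :: "pareto_instance \<Rightarrow> val" where
  "encode_instance I =
     List [List (map Num (costs I)), Num (of_nat (cover_size I)), Num (alpha I)]"

definition product_measure :: "pareto_instance \<Rightarrow> (nat \<Rightarrow> real) measure" where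
  "product_measure I = (\<Pi>\<^sub>M i\<in>{..<dim I}. measures I ! i)"

text \<open>Costs are nonnegative in valid instances, so \<open>e2ennreal\<close> loses nothing.\<close>
definition expected_cost :: "pareto_instance \<Rightarrow> (nat \<Rightarrow> real) set \<Rightarrow> ennreal" where
  "expected_cost I B =
     (\<integral>\<^sup>+ x. e2ennreal (cover_cost (dim I) (\<lambda>i. of_rat (costs I ! i)) B x) \<partial>product_measure I)"

definition feasible :: "pareto_instance \<Rightarrow> (nat \<Rightarrow> real) set \<Rightarrow> bool" where
  "feasible I B \<longleftrightarrow> pareto_cover (dim I) (product_measure I) B \<and> card B = cover_size I"

definition optimum :: "pareto_instance \<Rightarrow> ennreal" where
  "optimum I = (INF B\<in>{B. feasible I B}. expected_cost I B)"

definition approx_solution :: "rat \<Rightarrow> pareto_instance \<Rightarrow> (nat \<Rightarrow> real) set \<Rightarrow> bool" where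
  "approx_solution \<gamma> I B \<longleftrightarrow>
     feasible I B \<and> expected_cost I B \<le> ennreal (1 + of_rat \<gamma>) * optimum I"

definition vec_of :: "rat list \<Rightarrow> nat \<Rightarrow> real" where
  "vec_of bs = (\<lambda>i\<in>{..<length bs}. of_rat (bs ! i))"

definition encode_vectors :: "rat list list \<Rightarrow> val" where
  "encode_vectors bss = List (map (\<lambda>bs. List (map Num bs)) bss)"

text \<open>\<open>A\<close> is an FPTAS on the Pareto cover instances with cover size \<open>k\<close>. The time bound depends on
  the polynomial \<open>p\<close> bounding the oracles, since the time spent in them is counted, but \<open>A\<close> does not.
  The encoding length of \<open>\<gamma>\<close> cannot be bounded in terms of \<open>1 / \<gamma>\<close>, so merely reading \<open>\<gamma>\<close> calls for
  the additional linear term.\<close>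
definition pareto_fptas :: "nat \<Rightarrow> prog \<Rightarrow> bool" where
  "pareto_fptas k A \<longleftrightarrow>
     (\<forall>p :: real poly. \<exists>(q :: real poly) (C :: real). \<forall>I \<gamma>.
        valid_instance p I \<and> cover_size I = k \<and> 0 < \<gamma> \<and> \<gamma> < 1 \<longrightarrow>
        (\<exists>t bss.
           runs (oracles I) A (List [encode_instance I, Num \<gamma>]) t (encode_vectors bss) \<and>
           approx_solution \<gamma> I (vec_of ` set bss) \<and>
           real t \<le> poly q (1 / of_rat \<gamma> + real (val_len (encode_instance I)))
                     + C * real (rat_len \<gamma>)))"

end

theory Submission
  imports Defs
begin

text \<open>Rounding all entries of a cover up to a geometric grid costs a factor close to one and an absolute
  error, and absolute errors of order \<open>\<alpha>\<close> are harmless because every Pareto cover has mean cost at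
  least \<open>\<alpha> \<Sum>c\<^sub>i\<close>. So it suffices to search among covers with entries in the grid. The mean cost of
  such a cover depends only on the \<open>k\<close> costs and on the distribution of the set of vectors that cover
  a random point. This distribution has \<open>2\<^sup>k\<close> atoms and is updated coordinate by coordinate, since the
  measure is a product, and the update needs only the measures of the intervals between consecutive
  entries. A dynamic program over the coordinates therefore keeps \<open>k + 2\<^sup>k\<close> numbers, rounded down to
  the grid after every step, which leaves polynomially many states. The atoms are used instead of
  inclusion and exclusion over the vectors because their update involves no cancellation, so that
  every step loses only a factor close to one and a tiny absolute amount.\<close>

section \<open>Encoding lengths\<close>

lemma val_len_pos: "1 \<le> val_len v"
  by (cases v) auto

lemma int_len_le_iff: "int_len z \<le> Suc w \<longleftrightarrow> \<bar>z\<bar> < 2 ^ w"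
  unfolding int_len_def using bitlen_nonneg[of "\<bar>z\<bar>"] bitlen_le_iff_power[of "\<bar>z\<bar>" "int w"]
  by (auto simp: nat_le_iff)

lemma int_len_bound: "\<bar>z\<bar> < 2 ^ (int_len z - 1)"
  using int_len_le_iff[of z "int_len z - 1"] by (simp add: int_len_def)

lemma int_len_pos: "1 \<le> int_len z"
  by (simp add: int_len_def)

lemma int_len_leI: "\<bar>z\<bar> < 2 ^ w \<Longrightarrow> int_len z \<le> w + 1"
  using int_len_le_iff[of z w] by simp

lemma int_len_mono: "\<bar>a\<bar> \<le> \<bar>b\<bar> \<Longrightarrow> int_len a \<le> int_len b"
  using int_len_leI[of a "int_len b - 1"] int_len_bound[of b] int_len_pos[of b] by simp

lemma int_len_mult: "int_len (a * b) \<le> int_len a + int_len b"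
proof -
  have "\<bar>a * b\<bar> < 2 ^ (int_len a - 1) * 2 ^ (int_len b - 1)"
    unfolding abs_mult using int_len_bound by (intro mult_strict_mono') auto
  then have "\<bar>a * b\<bar> < 2 ^ ((int_len a - 1) + (int_len b - 1))"
    by (simp add: power_add)
  from int_len_leI[OF this] show ?thesis using int_len_pos[of a] int_len_pos[of b] by linarith
qed

lemma int_len_add: "int_len (a + b) \<le> int_len a + int_len b"
proof -
  let ?m = "max (int_len a - 1) (int_len b - 1)"
  have "\<bar>a\<bar> < 2 ^ ?m" "\<bar>b\<bar> < 2 ^ ?m"
    using int_len_bound[of a] int_len_bound[of b]
    by (meson less_le_trans max.cobounded1 max.cobounded2 one_le_numeral power_increasing)+
  then have "\<bar>a + b\<bar> < 2 ^ (?m + 1)" unfolding power_add power_one_right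
    using abs_triangle_ineq[of a b] by linarith
  from int_len_leI[OF this] show ?thesis using int_len_pos[of a] int_len_pos[of b] by simp
qed

lemma rat_len_le:
  assumes "r = of_int a / of_int b" "b \<noteq> 0"
  shows "rat_len r \<le> int_len a + int_len b"
proof -
  obtain n d where q: "quotient_of r = (n, d)" by force
  have r: "r = of_int n / of_int d" and d: "d > 0" and cop: "coprime n d"
    using q quotient_of_div quotient_of_denom_pos quotient_of_coprime by auto
  have "(of_int (n * b) :: rat) = of_int (a * d)"
    using r assms d by (simp add: field_simps)
  then have eq: "n * b = a * d" by (simp only: of_int_eq_iff)
  have db: "d dvd b"
    using eq cop by (metis coprime_commute coprime_dvd_mult_right_iff dvd_triv_right)
  have "int_len d \<le> int_len b"
    using db assms(2) by (intro int_len_mono) (simp add: dvd_imp_le_int)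
  moreover have "int_len n \<le> int_len a"
  proof (cases "a = 0")
    case True
    then show ?thesis using eq assms(2) by simp
  next
    case False
    have "n dvd a" using eq cop by (metis coprime_dvd_mult_left_iff dvd_triv_left)
    then show ?thesis using False by (intro int_len_mono) (simp add: dvd_imp_le_int)
  qed
  ultimately show ?thesis by (simp add: rat_len_def q)
qed

lemma rat_cases_len:
  obtains n d where "r = of_int n / of_int d" "d > 0" "rat_len r = int_len n + int_len d"
proof -
  obtain n d where q: "quotient_of r = (n, d)" by force
  then show ?thesis
    using that[of n d] quotient_of_div quotient_of_denom_pos by (auto simp: rat_len_def)
qed

lemma int_len_0 [simp]: "int_len 0 = 1" and int_len_1 [simp]: "int_len 1 = 2"
  using bitlen_pow2[of 1 0] by (simp_all add: int_len_def bitlen_alt_def)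

lemma rat_len_of_int: "rat_len (of_int z) \<le> int_len z + 2"
  using rat_len_le[of "of_int z" z 1] by simp

lemma rat_len_0 [simp]: "rat_len 0 = 3" and rat_len_1 [simp]: "rat_len 1 = 4"
  by (simp_all add: rat_len_def)

lemma rat_len_pos: "1 \<le> rat_len r"
  using int_len_pos unfolding rat_len_def by (simp add: trans_le_add1)

lemma rat_len_mult: "rat_len (x * y) \<le> rat_len x + rat_len y"
proof -
  obtain a b c d where x: "x = of_int a / of_int b" "b > 0" "rat_len x = int_len a + int_len b"
    and y: "y = of_int c / of_int d" "d > 0" "rat_len y = int_len c + int_len d"
    using rat_cases_len by metis
  have "rat_len (x * y) \<le> int_len (a * c) + int_len (b * d)"
    using x y by (intro rat_len_le) auto
  then show ?thesis using int_len_mult[of a c] int_len_mult[of b d] x(3) y(3) int_len_pos[of a] int_len_pos[of c]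
    by (simp add: algebra_simps)
qed

lemma rat_len_add: "rat_len (x + y) \<le> 2 * (rat_len x + rat_len y)"
proof -
  obtain a b c d where x: "x = of_int a / of_int b" "b > 0" "rat_len x = int_len a + int_len b"
    and y: "y = of_int c / of_int d" "d > 0" "rat_len y = int_len c + int_len d"
    using rat_cases_len by metis
  have "rat_len (x + y) \<le> int_len (a * d + c * b) + int_len (b * d)"
    using x y by (intro rat_len_le) (auto simp: field_simps)
  then show ?thesis
    using int_len_mult[of a d] int_len_mult[of c b] int_len_add[of "a * d" "c * b"]
      int_len_mult[of b d] x(3) y(3) int_len_pos[of a] int_len_pos[of c]
    by (simp add: algebra_simps)
qed

lemma rat_len_minus: "rat_len (- x) \<le> rat_len x"
proof -
  obtain a b where x: "x = of_int a / of_int b" "b > 0" "rat_len x = int_len a + int_len b"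
    using rat_cases_len by metis
  have "rat_len (- x) \<le> int_len (- a) + int_len b"
    using x by (intro rat_len_le) auto
  then show ?thesis using x by (simp add: int_len_def)
qed

lemma rat_len_diff: "rat_len (x - y) \<le> 2 * (rat_len x + rat_len y)"
  using rat_len_add[of x "- y"] rat_len_minus[of y] by simp

lemma rat_len_inverse: "rat_len (inverse x) \<le> rat_len x"
proof (cases "x = 0")
  case False
  obtain a b where x: "x = of_int a / of_int b" "b > 0" "rat_len x = int_len a + int_len b"
    using rat_cases_len by metis
  have "rat_len (inverse x) \<le> int_len b + int_len a"
    using x False by (intro rat_len_le) auto
  then show ?thesis using x by simp
qed simp

lemma rat_len_divide: "rat_len (x / y) \<le> rat_len x + rat_len y"
  using rat_len_mult[of x "inverse y"] rat_len_inverse[of y] by (simp add: divide_inverse)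

lemma rat_len_power: "rat_len (x ^ m) \<le> m * rat_len x + 4"
proof (induction m)
  case (Suc m)
  then show ?case using rat_len_mult[of x "x ^ m"] by simp
qed simp

lemma rat_len_floor: "rat_len (of_int \<lfloor>x\<rfloor>) \<le> rat_len x + 2"
proof -
  obtain a b where x: "x = of_int a / of_int b" "b > 0" "rat_len x = int_len a + int_len b"
    using rat_cases_len by metis
  have "\<lfloor>x\<rfloor> = a div b" using x by (simp add: floor_divide_of_int_eq)
  moreover have "\<bar>a div b\<bar> \<le> \<bar>a\<bar>"
  proof (cases "a \<ge> 0")
    case True
    moreover have "a div b \<le> a div 1" using True x(2) by (intro zdiv_mono2) auto
    ultimately show ?thesis using x(2) by (simp add: pos_imp_zdiv_nonneg_iff)
  next
    case False
    have "a \<le> a div b"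
      using False x(2) by (smt (verit, best) int_div_less_self mult_minus_left zdiv_mono2_neg div_by_1)
    moreover have "a div b < 0" using False x(2) by (simp add: pos_imp_zdiv_neg_iff)
    ultimately show ?thesis by simp
  qed
  ultimately have "int_len \<lfloor>x\<rfloor> \<le> int_len a" by (simp add: int_len_mono)
  then show ?thesis using rat_len_of_int[of "\<lfloor>x\<rfloor>"] x(3) by linarith
qed

lemma int_len_of_nat: "int_len (int m) \<le> m + 1"
  by (rule int_len_leI) (simp add: of_nat_less_two_power)

lemma rat_len_of_nat: "rat_len (of_nat m) \<le> m + 3"
  using rat_len_of_int[of "int m"] int_len_of_nat[of m] by simp

lemma rat_len_rat_of: "rat_len (rat_of v) \<le> val_len v + 2"
  by (cases v) auto

lemma val_len_List: 
  assumes "\<And>v. v \<in> set vs \<Longrightarrow> val_len v \<le> b"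
  shows "val_len (List vs) \<le> 1 + length vs * b"
  using assms by (induction vs) (auto, fastforce)

lemma val_len_items: "val_len (List (items v)) \<le> val_len v"
  by (cases v) auto

lemma length_le_val_len: "length vs < val_len (List vs)"
proof (induction vs)
  case (Cons v vs)
  then show ?case using val_len_pos[of v] by simp
qed simp

lemma val_len_mem: "v \<in> set vs \<Longrightarrow> val_len v < val_len (List vs)"
  by (induction vs) auto

lemma val_len_eval_un: "val_len (eval_un f v) \<le> val_len v + 5"
proof (cases f)
  case Floor
  then show ?thesis using rat_len_floor[of "rat_of v"] rat_len_rat_of[of v] by simp
next
  case Head
  then show ?thesis by (cases v) (auto split: list.split)
next
  case Tail
  then show ?thesis by (cases v; cases "items v") auto
qed

lemma val_len_eval_bin: "val_len (eval_bin f v w) \<le> 2 * (val_len v + val_len w) + 9"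
proof (cases f)
  case Push
  then show ?thesis using val_len_items[of w] by simp
qed (use rat_len_rat_of[of v] rat_len_rat_of[of w] rat_len_add[of "rat_of v" "rat_of w"]
    rat_len_mult[of "rat_of v" "rat_of w"] rat_len_diff[of "rat_of v" "rat_of w"]
    rat_len_divide[of "rat_of v" "rat_of w"] in auto)

fun vars :: "expr \<Rightarrow> nat set" where
  "vars (Var x) = {x}"
| "vars (Const v) = {}"
| "vars (Unary f e) = vars e"
| "vars (Binary f d e) = vars d \<union> vars e"

fun growth :: "expr \<Rightarrow> nat" where
  "growth (Var x) = 1"
| "growth (Const v) = val_len v"
| "growth (Unary f e) = growth e + 5"
| "growth (Binary f d e) = 2 * (growth d + growth e) + 9"

fun cost_growth :: "expr \<Rightarrow> nat" where
  "cost_growth (Var x) = 2"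
| "cost_growth (Const v) = 1 + val_len v"
| "cost_growth (Unary f e) = 1 + cost_growth e + growth (Unary f e)"
| "cost_growth (Binary f d e) = 1 + cost_growth d + cost_growth e + growth (Binary f d e)"

lemma val_len_eval:
  assumes "\<And>x. x \<in> vars e \<Longrightarrow> val_len (s x) \<le> m" "1 \<le> m"
  shows "val_len (eval e s) \<le> growth e * m"
  using assms(1)
proof (induction e)
  case (Const v)
  then show ?case using assms(2) by simp
next
  case (Unary f e)
  have "val_len (eval e s) \<le> growth e * m" using Unary by auto
  moreover have "5 \<le> 5 * m" using assms(2) by simp
  ultimately show ?case using val_len_eval_un[of f "eval e s"]
    by (simp add: algebra_simps)
next
  case (Binary f d e)
  have "val_len (eval d s) \<le> growth d * m" "val_len (eval e s) \<le> growth e * m"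
    using Binary by auto
  moreover have "9 \<le> 9 * m" using assms(2) by simp
  ultimately show ?case using val_len_eval_bin[of f "eval d s" "eval e s"]
    by (simp add: algebra_simps)
qed simp

lemma eval_cost_le:
  assumes "\<And>x. x \<in> vars e \<Longrightarrow> val_len (s x) \<le> m" "1 \<le> m"
  shows "eval_cost e s \<le> cost_growth e * m"
  using assms(1)
proof (induction e)
  case (Const v)
  have "(1 + val_len v) * 1 \<le> (1 + val_len v) * m" using assms(2) by (intro mult_le_mono) auto
  then show ?case by simp
next
  case (Unary f e)
  then show ?case using val_len_eval[of "Unary f e" s m] assms(2)
    by (simp add: algebra_simps)
next
  case (Binary f d e)
  have "eval_cost d s \<le> cost_growth d * m" "eval_cost e s \<le> cost_growth e * m"
    using Binary by auto
  then show ?case using val_len_eval[of "Binary f d e" s m] assms(2) Binary.prems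
    by (simp add: algebra_simps)
qed (use assms(2) in simp)

lemma val_len_eval_le_cost: "val_len (eval e s) \<le> eval_cost e s"
  by (cases e) auto

text \<open>A computed value has been paid for by the assignment that produced it.\<close>
lemma exec_val_len: "exec \<Omega> P s t s' \<Longrightarrow> s' x = s x \<or> val_len (s' x) \<le> t"
proof (induction rule: exec.induct)
  case (exec_Assign y e s)
  then show ?case using val_len_eval_le_cost[of e s] by simp
qed auto

section \<open>Polynomially bounded functions\<close>

definition poly_bounded :: "(nat \<Rightarrow> nat) \<Rightarrow> bool" where
  "poly_bounded f \<longleftrightarrow> (\<exists>a m. \<forall>x\<ge>1. f x \<le> a * x ^ m)"

lemma poly_bounded_const: "poly_bounded (\<lambda>_. c)"
  unfolding poly_bounded_def by (intro exI[of _ c] exI[of _ 0]) simp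

lemma poly_bounded_id: "poly_bounded (\<lambda>x. x)"
  unfolding poly_bounded_def by (intro exI[of _ 1]) simp

lemma poly_bounded_add:
  assumes "poly_bounded f" "poly_bounded g"
  shows "poly_bounded (\<lambda>x. f x + g x)"
proof -
  obtain a m b n where ab: "\<And>x. 1 \<le> x \<Longrightarrow> f x \<le> a * x ^ m" "\<And>x. 1 \<le> x \<Longrightarrow> g x \<le> b * x ^ n"
    using assms unfolding poly_bounded_def by blast
  have "f x + g x \<le> (a + b) * x ^ (m + n)" if x: "1 \<le> x" for x
  proof -
    have "a * x ^ m \<le> a * x ^ (m + n)" "b * x ^ n \<le> b * x ^ (m + n)"
      using x by (intro mult_le_mono power_increasing le_refl; simp)+
    then show ?thesis using ab[OF x] by (simp only: add_mult_distrib)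
  qed
  then show ?thesis unfolding poly_bounded_def by blast
qed

lemma poly_bounded_mult:
  assumes "poly_bounded f" "poly_bounded g"
  shows "poly_bounded (\<lambda>x. f x * g x)"
proof -
  obtain a m b n where ab: "\<And>x. 1 \<le> x \<Longrightarrow> f x \<le> a * x ^ m" "\<And>x. 1 \<le> x \<Longrightarrow> g x \<le> b * x ^ n"
    using assms unfolding poly_bounded_def by blast
  have "f x * g x \<le> (a * b) * x ^ (m + n)" if x: "1 \<le> x" for x
    using mult_le_mono[OF ab(1)[OF x] ab(2)[OF x]] by (simp add: power_add mult_ac)
  then show ?thesis unfolding poly_bounded_def by blast
qed

lemma poly_bounded_power: "poly_bounded f \<Longrightarrow> poly_bounded (\<lambda>x. f x ^ m)"
  by (induction m) (simp_all add: poly_bounded_const poly_bounded_mult)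

lemma poly_bounded_Suc: "poly_bounded f \<Longrightarrow> poly_bounded (\<lambda>x. Suc (f x))"
  using poly_bounded_add[OF poly_bounded_const[of 1]] by simp

lemmas poly_bounded_intros =
  poly_bounded_const poly_bounded_id poly_bounded_add poly_bounded_mult poly_bounded_power poly_bounded_Suc

section \<open>Verification conditions with syntactic time bounds\<close>

text \<open>If every variable has length at most \<open>Z\<close> throughout, and every loop runs at most \<open>Z\<close> times, then
  the running time is at most \<open>time_bound Z P\<close>, which is a polynomial in \<open>Z\<close> for fixed \<open>P\<close>.\<close>
fun time_bound :: "nat \<Rightarrow> prog \<Rightarrow> nat" where
  "time_bound Z Skip = 1"
| "time_bound Z (Assign x e) = 1 + cost_growth e * Z"
| "time_bound Z (Seq P Q) = time_bound Z P + time_bound Z Q"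
| "time_bound Z (Cond e P Q) = 1 + cost_growth e * Z + time_bound Z P + time_bound Z Q"
| "time_bound Z (While e P) = Suc Z * (1 + cost_growth e * Z + time_bound Z P)"
| "time_bound Z (Query x ei ea eb ed) =
     1 + (cost_growth ei + cost_growth ea + cost_growth eb + cost_growth ed) * Z + Z + Z"

lemma poly_bounded_time_bound: "poly_bounded (\<lambda>Z. time_bound Z P)"
  by (induction P) (simp_all only: time_bound.simps, (intro poly_bounded_intros; assumption?)+)

definition small :: "nat \<Rightarrow> state \<Rightarrow> bool" where
  "small Z s \<longleftrightarrow> (\<forall>x. val_len (s x) \<le> Z)"

definition wp :: "nat \<Rightarrow> measure_oracle list \<Rightarrow> prog \<Rightarrow> (state \<Rightarrow> bool) \<Rightarrow> state \<Rightarrow> bool" where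
  "wp Z \<Omega> P Q s \<longleftrightarrow> (small Z s \<longrightarrow>
     (\<exists>t s'. exec \<Omega> P s t s' \<and> t \<le> time_bound Z P \<and> small Z s' \<and> Q s'))"

lemma small_ge_1: "small Z s \<Longrightarrow> 1 \<le> Z"
  using val_len_pos order_trans unfolding small_def by blast

lemma small_eval_cost: "small Z s \<Longrightarrow> eval_cost e s \<le> cost_growth e * Z"
  by (rule eval_cost_le) (use small_ge_1 in \<open>auto simp: small_def\<close>)

lemma wp_small: "(small Z s \<Longrightarrow> wp Z \<Omega> P Q s) \<Longrightarrow> wp Z \<Omega> P Q s"
  by (auto simp: wp_def)

lemma wp_Skip: "Q s \<Longrightarrow> wp Z \<Omega> Skip Q s"
  unfolding wp_def using exec_Skip by fastforce

lemma wp_Assign: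
  assumes "val_len (eval e s) \<le> Z" "Q (s(x := eval e s))"
  shows "wp Z \<Omega> (Assign x e) Q s"
  unfolding wp_def
proof
  assume "small Z s"
  then show "\<exists>t s'. exec \<Omega> (Assign x e) s t s' \<and> t \<le> time_bound Z (Assign x e) \<and> small Z s' \<and> Q s'"
    using assms small_eval_cost[of Z s e] exec_Assign[of \<Omega> x e s]
    by (intro exI[of _ "1 + eval_cost e s"] exI[of _ "s(x := eval e s)"]) (auto simp: small_def)
qed

lemma wp_Seq: "wp Z \<Omega> P (wp Z \<Omega> P' Q) s \<Longrightarrow> wp Z \<Omega> (Seq P P') Q s"
  unfolding wp_def by (fastforce intro: exec_Seq add_mono)

lemma wp_Cond:
  assumes "eval e s \<noteq> Num 0 \<Longrightarrow> wp Z \<Omega> P Q s" "eval e s = Num 0 \<Longrightarrow> wp Z \<Omega> P' Q s"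
  shows "wp Z \<Omega> (Cond e P P') Q s"
  unfolding wp_def
proof
  assume sm: "small Z s"
  show "\<exists>t s'. exec \<Omega> (Cond e P P') s t s' \<and> t \<le> time_bound Z (Cond e P P') \<and> small Z s' \<and> Q s'"
  proof (cases "eval e s = Num 0")
    case True
    then obtain t s' where "exec \<Omega> P' s t s'" "t \<le> time_bound Z P'" "small Z s'" "Q s'"
      using assms(2) sm unfolding wp_def by blast
    then show ?thesis using exec_Cond_False[OF True, of \<Omega> P' t s' P] small_eval_cost[OF sm, of e]
      by fastforce
  next
    case False
    then obtain t s' where "exec \<Omega> P s t s'" "t \<le> time_bound Z P" "small Z s'" "Q s'"
      using assms(1) sm unfolding wp_def by blast
    then show ?thesis using exec_Cond_True[OF False, of \<Omega> P t s' P'] small_eval_cost[OF sm, of e]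
      by fastforce
  qed
qed

lemma wp_conseq: "wp Z \<Omega> P Q s \<Longrightarrow> (\<And>s'. Q s' \<Longrightarrow> R s') \<Longrightarrow> wp Z \<Omega> P R s"
  unfolding wp_def by blast

lemma wp_While:
  assumes "Inv m s" "m \<le> Z"
    and step: "\<And>m s. Inv m s \<Longrightarrow> eval e s \<noteq> Num 0 \<Longrightarrow> \<exists>m'<m. wp Z \<Omega> P (Inv m') s"
    and fin: "\<And>m s. Inv m s \<Longrightarrow> eval e s = Num 0 \<Longrightarrow> Q s"
  shows "wp Z \<Omega> (While e P) Q s"
  unfolding wp_def
proof
  assume sm: "small Z s"
  let ?c = "1 + cost_growth e * Z + time_bound Z P"
  have "\<exists>t s'. exec \<Omega> (While e P) s t s' \<and> t \<le> Suc m * ?c \<and> small Z s' \<and> Q s'"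
    using assms(1) sm
  proof (induction m arbitrary: s rule: less_induct)
    case (less m)
    show ?case
    proof (cases "eval e s = Num 0")
      case True
      then show ?thesis
        using exec_While_False[OF True, of \<Omega> P] fin[OF less.prems(1) True] less.prems(2)
          small_eval_cost[OF less.prems(2), of e]
        by (intro exI[of _ "1 + eval_cost e s"] exI[of _ s]) simp
    next
      case False
      obtain m' where m': "m' < m" "wp Z \<Omega> P (Inv m') s"
        using step[OF less.prems(1) False] by blast
      then obtain t s' where 1: "exec \<Omega> P s t s'" "t \<le> time_bound Z P" "small Z s'" "Inv m' s'"
        using less.prems(2) unfolding wp_def by blast
      obtain u s'' where 2: "exec \<Omega> (While e P) s' u s''" "u \<le> Suc m' * ?c" "small Z s''" "Q s''"
        using less.IH[OF m'(1) 1(4) 1(3)] by blast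
      have "1 + eval_cost e s + t + u \<le> ?c + Suc m' * ?c"
        using 1 2 small_eval_cost[OF less.prems(2), of e] by linarith
      also have "\<dots> = Suc (Suc m') * ?c" by simp
      also have "\<dots> \<le> Suc m * ?c" using m'(1) by (intro mult_le_mono) auto
      finally show ?thesis using exec_While_True[OF False 1(1) 2(1)] 2 by blast
    qed
  qed
  moreover have "Suc m * ?c \<le> Suc Z * ?c" using assms(2) by (intro mult_le_mono) auto
  ultimately show "\<exists>t s'. exec \<Omega> (While e P) s t s' \<and> t \<le> time_bound Z (While e P) \<and> small Z s' \<and> Q s'"
    using order_trans unfolding time_bound.simps by blast
qed

lemma wp_Query:
  assumes "eval ei s = Num (of_nat i)" "i < length \<Omega>"
    "eval ea s = Num a" "eval eb s = Num b" "eval ed s = Num \<delta>" "valid_query a b \<delta>"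
    "latency (\<Omega> ! i) a b \<delta> \<le> Z" "val_len (Num (answer (\<Omega> ! i) a b \<delta>)) \<le> Z"
    "Q (s(x := Num (answer (\<Omega> ! i) a b \<delta>)))"
  shows "wp Z \<Omega> (Query x ei ea eb ed) Q s"
  unfolding wp_def
proof
  assume sm: "small Z s"
  let ?r = "answer (\<Omega> ! i) a b \<delta>"
  have "small Z (s(x := Num ?r))" using sm assms(8) by (auto simp: small_def)
  moreover have "1 + eval_cost ei s + eval_cost ea s + eval_cost eb s + eval_cost ed s
         + latency (\<Omega> ! i) a b \<delta> + val_len (Num ?r) \<le> time_bound Z (Query x ei ea eb ed)"
    using small_eval_cost[OF sm, of ei] small_eval_cost[OF sm, of ea] small_eval_cost[OF sm, of eb]
      small_eval_cost[OF sm, of ed] assms(7,8) by (simp add: algebra_simps)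
  ultimately show "\<exists>t s'. exec \<Omega> (Query x ei ea eb ed) s t s' \<and> t \<le> time_bound Z (Query x ei ea eb ed)
      \<and> small Z s' \<and> Q s'"
    using exec_Query[OF assms(1-6) refl] assms(9) by blast
qed

fun writes :: "prog \<Rightarrow> nat set" where
  "writes Skip = {}"
| "writes (Assign x e) = {x}"
| "writes (Seq P Q) = writes P \<union> writes Q"
| "writes (Cond e P Q) = writes P \<union> writes Q"
| "writes (While e P) = writes P"
| "writes (Query x ei ea eb ed) = {x}"

lemma exec_frame: "exec \<Omega> P s t s' \<Longrightarrow> x \<notin> writes P \<Longrightarrow> s' x = s x"
  by (induction rule: exec.induct) auto

lemma wp_frame:
  assumes "wp Z \<Omega> P (\<lambda>s'. (\<forall>x. x \<notin> writes P \<longrightarrow> s' x = s x) \<longrightarrow> Q s') s"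
  shows "wp Z \<Omega> P Q s"
  using assms exec_frame unfolding wp_def by blast

definition seqs :: "prog list \<Rightarrow> prog" where
  "seqs Ps = foldr Seq Ps Skip"

lemma seqs_simps [simp]: "seqs [] = Skip" "seqs (P # Ps) = Seq P (seqs Ps)"
  by (simp_all add: seqs_def)

lemma writes_seqs [simp]: "writes (seqs Ps) = (\<Union>P\<in>set Ps. writes P)"
  by (induction Ps) auto

lemma wp_seqs_upt:
  assumes "J 0 s"
    and "\<And>a s'. a < m \<Longrightarrow> J a s' \<Longrightarrow> wp Z \<Omega> (F a) (J (Suc a)) s'"
    and "\<And>s'. J m s' \<Longrightarrow> Q s'"
  shows "wp Z \<Omega> (seqs (map F [0..<m])) Q s"
proof -
  have "wp Z \<Omega> (seqs (map F [a..<m])) Q s" if "J a s" "a \<le> m" for a s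
    using that(2,1)
  proof (induction a arbitrary: s rule: inc_induct)
    case base
    then show ?case by (auto intro: wp_Skip assms(3))
  next
    case (step a)
    have "wp Z \<Omega> (F a) (wp Z \<Omega> (seqs (map F [Suc a..<m])) Q) s"
      using step assms(2) by (blast intro: wp_conseq)
    then show ?case using step(2) by (simp add: upt_conv_Cons wp_Seq)
  qed
  then show ?thesis using assms(1) by blast
qed

definition nonempty :: "nat \<Rightarrow> expr" where
  "nonempty l = Binary Equal (Binary Equal (Var l) (Const (List []))) (Const (Num 0))"

lemma eval_nonempty: "eval (nonempty l) s = Num 0 \<longleftrightarrow> s l = List []"
  by (simp add: nonempty_def)

definition foreach :: "nat \<Rightarrow> nat \<Rightarrow> expr \<Rightarrow> prog \<Rightarrow> prog" where
  "foreach x l e P = Seq (Assign l e) (While (nonempty l)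
     (Seq (Assign x (Unary Head (Var l))) (Seq (Assign l (Unary Tail (Var l))) P)))"

lemma writes_foreach [simp]: "writes (foreach x l e P) = {x, l} \<union> writes P"
  by (auto simp: foreach_def)

lemma wp_foreach:
  assumes e: "eval e s = List vs" "val_len (List vs) \<le> Z"
    and l: "l \<notin> writes P" "l \<noteq> x"
    and init: "J [] (s(l := List vs))"
    and step: "\<And>d v r s'. vs = d @ v # r \<Longrightarrow> J d s' \<Longrightarrow> s' l = List (v # r) \<Longrightarrow>
        (\<And>y. y \<notin> {x, l} \<union> writes P \<Longrightarrow> s' y = s y) \<Longrightarrow>
        wp Z \<Omega> P (J (d @ [v])) (s'(x := v, l := List r))"
    and fin: "\<And>s'. J vs s' \<Longrightarrow> s' l = List [] \<Longrightarrow>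
        (\<And>y. y \<notin> {x, l} \<union> writes P \<Longrightarrow> s' y = s y) \<Longrightarrow> Q s'"
  shows "wp Z \<Omega> (foreach x l e P) Q s"
proof -
  define Inv where "Inv m s' \<longleftrightarrow> (\<exists>d r. vs = d @ r \<and> m = length r \<and> s' l = List r \<and> J d s' \<and>
    (\<forall>y. y \<notin> {x, l} \<union> writes P \<longrightarrow> s' y = s y))" for m s'
  have "wp Z \<Omega> (While (nonempty l)
     (Seq (Assign x (Unary Head (Var l))) (Seq (Assign l (Unary Tail (Var l))) P))) Q (s(l := List vs))"
  proof (rule wp_While[where Inv = Inv and m = "length vs"])
    show "Inv (length vs) (s(l := List vs))"
      unfolding Inv_def using init by (intro exI[of _ "[]"] exI[of _ vs]) auto
    show "length vs \<le> Z" using length_le_val_len[of vs] e(2) by simp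
    show "Q s'" if "Inv m s'" "eval (nonempty l) s' = Num 0" for m s'
      using that fin unfolding Inv_def eval_nonempty by auto
    show "\<exists>m'<m. wp Z \<Omega> (Seq (Assign x (Unary Head (Var l))) (Seq (Assign l (Unary Tail (Var l))) P)) (Inv m') s'"
      if inv: "Inv m s'" and ne: "eval (nonempty l) s' \<noteq> Num 0" for m s'
    proof -
      obtain d v r where dr: "vs = d @ v # r" "m = Suc (length r)" "s' l = List (v # r)" "J d s'"
        and fr: "\<And>y. y \<notin> {x, l} \<union> writes P \<Longrightarrow> s' y = s y"
        using inv ne unfolding Inv_def eval_nonempty by (auto simp: neq_Nil_conv)
      have vl: "val_len v \<le> Z" "val_len (List r) \<le> Z"
        using e(2) dr(1) by auto
      have "wp Z \<Omega> P (Inv (length r)) (s'(x := v, l := List r))"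
      proof (rule wp_frame, rule wp_conseq[OF step[OF dr(1,4,3) fr]])
        fix s'' assume J: "J (d @ [v]) s''"
        show "(\<forall>y. y \<notin> writes P \<longrightarrow> s'' y = (s'(x := v, l := List r)) y) \<longrightarrow> Inv (length r) s''"
        proof
          assume "\<forall>y. y \<notin> writes P \<longrightarrow> s'' y = (s'(x := v, l := List r)) y"
          then show "Inv (length r) s''" unfolding Inv_def
            using J dr(1) l fr by (intro exI[of _ "d @ [v]"] exI[of _ r]) auto
        qed
      qed
      then show ?thesis using vl dr(2,3) l
        by (intro exI[of _ "length r"] conjI) (auto intro!: wp_Seq wp_Assign simp: fun_upd_def)
    qed
  qed
  then show ?thesis unfolding foreach_def using e by (auto intro!: wp_Seq wp_Assign)
qed

lemma wp_foreach_Var: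
  assumes e: "s src = List vs"
    and l: "l \<notin> writes P" "l \<noteq> x"
    and init: "J [] (s(l := List vs))"
    and step: "\<And>d v r s'. vs = d @ v # r \<Longrightarrow> J d s' \<Longrightarrow> s' l = List (v # r) \<Longrightarrow>
        (\<And>y. y \<notin> {x, l} \<union> writes P \<Longrightarrow> s' y = s y) \<Longrightarrow>
        wp Z \<Omega> P (J (d @ [v])) (s'(x := v, l := List r))"
    and fin: "\<And>s'. J vs s' \<Longrightarrow> s' l = List [] \<Longrightarrow>
        (\<And>y. y \<notin> {x, l} \<union> writes P \<Longrightarrow> s' y = s y) \<Longrightarrow> Q s'"
  shows "wp Z \<Omega> (foreach x l (Var src) P) Q s"
proof (rule wp_small)
  assume "small Z s"
  then have "val_len (List vs) \<le> Z" using e unfolding small_def by metis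
  then show ?thesis using assms by (intro wp_foreach[where J = J and vs = vs]) auto
qed

section \<open>Expressions\<close>

definition sum_expr :: "expr list \<Rightarrow> expr" where
  "sum_expr es = foldr (Binary Add) es (Const (Num 0))"

lemma eval_sum_expr: "eval (sum_expr es) s = Num (\<Sum>e\<leftarrow>es. rat_of (eval e s))"
  by (induction es) (auto simp: sum_expr_def)

lemma eval_sum_expr_upt: 
  "eval (sum_expr (map F [0..<m])) s = Num (\<Sum>i<m. rat_of (eval (F i) s))"
  by (simp add: eval_sum_expr o_def interv_sum_list_conv_sum_set_nat lessThan_atLeast0)

lemma vars_sum_expr: "vars (sum_expr es) = (\<Union>e\<in>set es. vars e)"
  by (induction es) (auto simp: sum_expr_def)

definition list_expr :: "expr list \<Rightarrow> expr" where
  "list_expr es = foldr (Binary Push) es (Const (List []))"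

lemma eval_list_expr: "eval (list_expr es) s = List (map (\<lambda>e. eval e s) es)"
  by (induction es) (auto simp: list_expr_def)

definition nth_expr :: "nat \<Rightarrow> expr \<Rightarrow> expr" where
  "nth_expr j e = Unary Head ((Unary Tail ^^ j) e)"

lemma items_eval_nth_expr:
  "j < length (items (eval e s)) \<Longrightarrow> eval (nth_expr j e) s = items (eval e s) ! j"
proof -
  assume "j < length (items (eval e s))"
  moreover have "items (eval ((Unary Tail ^^ j) e) s) = drop j (items (eval e s))"
    by (induction j) (auto simp: drop_Suc drop_tl)
  ultimately show ?thesis by (simp add: nth_expr_def Cons_nth_drop_Suc[symmetric])
qed

lemma vars_nth_expr: "vars (nth_expr j e) = vars e"
  by (induction j) (auto simp: nth_expr_def)

definition min_expr :: "expr \<Rightarrow> expr \<Rightarrow> expr" where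
  "min_expr d e = Binary Add e (Binary Mul (Binary Less d e) (Binary Sub d e))"

definition max_expr :: "expr \<Rightarrow> expr \<Rightarrow> expr" where
  "max_expr d e = Binary Add e (Binary Mul (Binary Less e d) (Binary Sub d e))"

lemma eval_min_expr: "eval (min_expr d e) s = Num (min (rat_of (eval d s)) (rat_of (eval e s)))"
  and eval_max_expr: "eval (max_expr d e) s = Num (max (rat_of (eval d s)) (rat_of (eval e s)))"
  by (auto simp: min_expr_def max_expr_def)

definition min_exprs :: "expr list \<Rightarrow> expr" where
  "min_exprs es = foldr min_expr es (Const (Num 1))"

definition max_exprs :: "expr list \<Rightarrow> expr" where
  "max_exprs es = foldr max_expr es (Const (Num (- 1)))"

lemma eval_min_exprs: "eval (min_exprs es) s = Num (foldr (\<lambda>e. min (rat_of (eval e s))) es 1)"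
  and eval_max_exprs: "eval (max_exprs es) s = Num (foldr (\<lambda>e. max (rat_of (eval e s))) es (- 1))"
  by (induction es) (auto simp: min_exprs_def max_exprs_def eval_min_expr eval_max_expr)

section \<open>The program\<close>

abbreviation (input) "v_io \<equiv> (0 :: nat)"
abbreviation (input) "v_G \<equiv> (1 :: nat)"
abbreviation (input) "v_cs \<equiv> (2 :: nat)"
abbreviation (input) "v_c \<equiv> (3 :: nat)"
abbreviation (input) "v_revcs \<equiv> (4 :: nat)"
abbreviation (input) "v_C \<equiv> (5 :: nat)"
abbreviation (input) "v_i \<equiv> (6 :: nat)"
abbreviation (input) "v_N \<equiv> (7 :: nat)"
abbreviation (input) "v_delta \<equiv> (8 :: nat)"
abbreviation (input) "v_q \<equiv> (9 :: nat)"
abbreviation (input) "v_tau \<equiv> (10 :: nat)"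
abbreviation (input) "v_y \<equiv> (11 :: nat)"
abbreviation (input) "v_grid \<equiv> (12 :: nat)"
abbreviation (input) "v_tuples \<equiv> (13 :: nat)"
abbreviation (input) "v_states \<equiv> (14 :: nat)"
abbreviation (input) "v_new \<equiv> (16 :: nat)"
abbreviation (input) "v_keys \<equiv> (17 :: nat)"
abbreviation (input) "v_w \<equiv> (18 :: nat)"
abbreviation (input) "v_pair \<equiv> (19 :: nat)"
abbreviation (input) "v_pairs \<equiv> (20 :: nat)"
abbreviation (input) "v_found \<equiv> (21 :: nat)"
abbreviation (input) "v_members \<equiv> (22 :: nat)"
abbreviation (input) "v_member \<equiv> (23 :: nat)"
abbreviation (input) "v_round \<equiv> (24 :: nat)"
abbreviation (input) "v_rest \<equiv> (25 :: nat)"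
abbreviation (input) "v_gridpoint \<equiv> (26 :: nat)"
abbreviation (input) "v_arg \<equiv> (27 :: nat)"
abbreviation (input) "v_key \<equiv> (28 :: nat)"
abbreviation (input) "v_prod \<equiv> (29 :: nat)"
abbreviation (input) "v_lefts \<equiv> (30 :: nat)"
abbreviation (input) "v_left \<equiv> (31 :: nat)"
abbreviation (input) "v_rights \<equiv> (32 :: nat)"
abbreviation (input) "v_right \<equiv> (33 :: nat)"
abbreviation (input) "v_cs' \<equiv> (34 :: nat)"
abbreviation (input) "v_c' \<equiv> (35 :: nat)"
abbreviation (input) "v_best \<equiv> (36 :: nat)"
abbreviation (input) "v_sol \<equiv> (37 :: nat)"
abbreviation (input) "v_finals \<equiv> (38 :: nat)"
abbreviation (input) "v_final \<equiv> (39 :: nat)"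
abbreviation (input) "v_value \<equiv> (40 :: nat)"
abbreviation (input) "v_out \<equiv> (41 :: nat)"
abbreviation (input) "v_count \<equiv> (42 :: nat)"
abbreviation (input) "v_pool \<equiv> (43 :: nat)"
abbreviation (input) "v_vector \<equiv> (44 :: nat)"
abbreviation (input) v_weight :: "nat \<Rightarrow> nat" where "v_weight a \<equiv> 50 + 2 * a"
abbreviation (input) v_comp :: "nat \<Rightarrow> nat" where "v_comp d \<equiv> 51 + 2 * d"

abbreviation (input) rat_const :: "rat \<Rightarrow> expr" where "rat_const r \<equiv> Const (Num r)"
abbreviation (input) "nil_const \<equiv> Const (List [])"

definition member_prog :: "nat \<Rightarrow> nat \<Rightarrow> prog" where
  "member_prog y l = Seq (Assign v_found (rat_const 0))
     (foreach v_member v_members (Var l)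
       (Cond (Binary Equal (Var v_member) (Var y)) (Assign v_found (rat_const 1)) Skip))"

definition round_prog :: prog where
  "round_prog = Seq (Assign v_round (rat_const 0))
     (foreach v_gridpoint v_rest (Var v_grid)
       (Cond (Binary Less (Var v_arg) (Var v_gridpoint)) Skip (Assign v_round (Var v_gridpoint))))"

definition product_prog :: "nat \<Rightarrow> nat \<Rightarrow> prog" where
  "product_prog X Y = Seq (Assign v_prod nil_const)
     (foreach v_left v_lefts (Var X) (foreach v_right v_rights (Var Y)
       (Assign v_prod (Binary Push (Binary Push (Var v_left) (Var v_right)) (Var v_prod)))))"

definition setup_prog :: "nat \<Rightarrow> prog" where
  "setup_prog k = seqs
    [Assign v_revcs nil_const, Assign v_C (rat_const 0), Assign v_i (rat_const 0),
     foreach v_c v_cs (nth_expr 0 (Var v_io)) (seqs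
       [Assign v_revcs (Binary Push (Var v_c) (Var v_revcs)),
        Assign v_C (max_expr (Var v_C) (Var v_c)),
        Assign v_i (Binary Add (Var v_i) (rat_const 1))]),
     Assign v_C (Binary Mul (Var v_i) (Var v_C)),
     Assign v_N (Binary Mul (rat_const 28) (Binary Mul (Var v_i) (Var v_G))),
     Assign v_delta (Binary Div (rat_const 1) (Var v_N)),
     Assign v_q (Binary Div (Var v_N) (Binary Add (Var v_N) (rat_const 1))),
     Assign v_tau (Binary Div (nth_expr 2 (Var v_io)) (Binary Mul (rat_const (16 * 2 ^ k))
       (Binary Mul (Binary Mul (Var v_i) (Var v_i)) (Var v_G))))]"

definition grid_prog :: prog where
  "grid_prog = seqs
    [Assign v_y (rat_const 1), Assign v_grid nil_const,
     While (Binary Less (Var v_tau) (Var v_y)) (seqs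
       [Assign v_grid (Binary Push (Var v_y) (Var v_grid)),
        Assign v_y (Binary Mul (Var v_y) (Var v_q))]),
     Assign v_grid (Binary Push (Var v_y) (Var v_grid))]"

definition tuples_prog :: "nat \<Rightarrow> prog" where
  "tuples_prog k = Seq (Assign v_tuples (Const (List [List []])))
     (seqs (map (\<lambda>_. Seq (product_prog v_grid v_tuples) (Assign v_tuples (Var v_prod))) [0..<k]))"

definition comp_expr :: "nat \<Rightarrow> nat \<Rightarrow> expr" where
  "comp_expr x d = nth_expr d (nth_expr 0 (Var x))"

definition choice_expr :: "nat \<Rightarrow> expr" where
  "choice_expr j = nth_expr (Suc j) (Var v_pair)"

definition lo_expr :: "nat \<Rightarrow> nat \<Rightarrow> expr" where
  "lo_expr k a = max_exprs (map choice_expr (filter (\<lambda>j. \<not> bit a j) [0..<k]))"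

definition hi_expr :: "nat \<Rightarrow> nat \<Rightarrow> expr" where
  "hi_expr k a = min_exprs (map choice_expr (filter (bit a) [0..<k]))"

definition weigh_prog :: "nat \<Rightarrow> prog" where
  "weigh_prog k = seqs (map (\<lambda>a. Cond (Binary Less (lo_expr k a) (hi_expr k a))
      (Seq (Query (v_weight a) (Var v_i) (lo_expr k a) (hi_expr k a) (Var v_delta))
           (Assign (v_weight a)
             (Binary Div (Var (v_weight a)) (Binary Add (rat_const 1) (Var v_delta)))))
      (Assign (v_weight a) (rat_const 0))) [0..<2 ^ k])"

definition excess_expr :: "nat \<Rightarrow> expr" where
  "excess_expr k = sum_expr (map (\<lambda>a. if bit a 0 then rat_const 0 else Var (v_weight a)) [0..<2 ^ k])"

definition update_expr :: "nat \<Rightarrow> nat \<Rightarrow> expr" where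
  "update_expr k d =
    (if d < k then Binary Add (nth_expr d (nth_expr 0 (nth_expr 0 (Var v_pair))))
                     (Binary Mul (Var v_w) (choice_expr d))
     else sum_expr (map (\<lambda>t. sum_expr (map (\<lambda>a. if and t a = d - k
            then Binary Mul (nth_expr (k + t) (nth_expr 0 (nth_expr 0 (Var v_pair)))) (Var (v_weight a))
            else rat_const 0) [0..<2 ^ k])) [0..<2 ^ k]))"

definition update_prog :: "nat \<Rightarrow> prog" where
  "update_prog k = Seq
    (seqs (map (\<lambda>d. seqs [Assign v_arg (update_expr k d), round_prog, Assign (v_comp d) (Var v_round)])
       [0..<k + 2 ^ k]))
    (Assign v_key (list_expr (map (\<lambda>d. Var (v_comp d)) [0..<k + 2 ^ k])))"

definition solution_expr :: "nat \<Rightarrow> expr" where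
  "solution_expr k = list_expr (map (\<lambda>j. Binary Push (choice_expr j)
     (nth_expr j (nth_expr 1 (nth_expr 0 (Var v_pair))))) [0..<k])"

definition insert_prog :: "nat \<Rightarrow> prog" where
  "insert_prog k = Seq (member_prog v_key v_keys)
     (Cond (Var v_found) Skip (Seq
       (Assign v_keys (Binary Push (Var v_key) (Var v_keys)))
       (Assign v_new (Binary Push (list_expr [Var v_key, solution_expr k]) (Var v_new)))))"

definition extend_prog :: "nat \<Rightarrow> prog" where
  "extend_prog k = Seq (weigh_prog k) (Cond (Binary Equal (excess_expr k) (rat_const 0))
     (Seq (update_prog k) (insert_prog k)) Skip)"

definition initial_key :: "nat \<Rightarrow> nat \<Rightarrow> rat" where
  "initial_key k d = (if d = k + (2 ^ k - 1) then 1 else 0)"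

definition encode_key :: "nat \<Rightarrow> (nat \<Rightarrow> rat) \<Rightarrow> val" where
  "encode_key k f = List (map (\<lambda>d. Num (f d)) [0..<k + 2 ^ k])"

definition encode_choices :: "nat \<Rightarrow> rat list list \<Rightarrow> val" where
  "encode_choices k ch = List (map (\<lambda>j. List (map (\<lambda>g. Num (g ! j)) ch)) [0..<k])"

definition dp_prog :: "nat \<Rightarrow> prog" where
  "dp_prog k = Seq (Assign v_states (Const (List [List [encode_key k (initial_key k), encode_choices k []]])))
    (foreach v_c' v_cs' (Var v_revcs) (seqs
      [Assign v_i (Binary Sub (Var v_i) (rat_const 1)),
       Assign v_w (Binary Div (Var v_c') (Var v_C)),
       product_prog v_states v_tuples,
       Assign v_new nil_const,
       Assign v_keys nil_const,
       foreach v_pair v_pairs (Var v_prod) (extend_prog k),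
       Assign v_states (Var v_new)]))"

definition value_expr :: "nat \<Rightarrow> expr" where
  "value_expr k = sum_expr (map (\<lambda>t. Binary Mul (comp_expr v_final (k + t))
     (min_exprs (map (comp_expr v_final) (filter (bit t) [0..<k])))) [0..<2 ^ k])"

definition select_prog :: "nat \<Rightarrow> prog" where
  "select_prog k = seqs
    [Assign v_final (nth_expr 0 (Var v_states)),
     Assign v_best (value_expr k),
     Assign v_sol (nth_expr 1 (Var v_final)),
     foreach v_final v_finals (Var v_states) (Seq (Assign v_value (value_expr k))
       (Cond (Binary Less (Var v_value) (Var v_best))
         (Seq (Assign v_best (Var v_value)) (Assign v_sol (nth_expr 1 (Var v_final)))) Skip))]"

definition collect_prog :: "nat \<Rightarrow> prog" where
  "collect_prog k = Seq (member_prog v_vector v_out) (Cond (Var v_found) Skip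
     (Cond (Binary Less (Var v_count) (rat_const (of_nat k)))
       (Seq (Assign v_out (Binary Push (Var v_vector) (Var v_out)))
            (Assign v_count (Binary Add (Var v_count) (rat_const 1)))) Skip))"

definition fillers_expr :: "nat \<Rightarrow> expr" where
  "fillers_expr k = list_expr (map (\<lambda>j. Binary Push (rat_const (1 / of_nat (Suc j)))
     (Unary Tail (nth_expr 0 (Var v_sol)))) [0..<k])"

definition output_prog :: "nat \<Rightarrow> prog" where
  "output_prog k = seqs
    [Assign v_out nil_const, Assign v_count (rat_const 0),
     foreach v_vector v_pool (Var v_sol) (collect_prog k),
     foreach v_vector v_pool (fillers_expr k) (collect_prog k),
     Assign v_io (Var v_out)]"

definition main_prog :: "nat \<Rightarrow> prog" where
  "main_prog k = seqs [setup_prog k, grid_prog, tuples_prog k, dp_prog k, select_prog k, output_prog k]"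

text \<open>The length of \<open>\<gamma>\<close> is not bounded in terms of \<open>1 / \<gamma>\<close>, so \<open>\<gamma>\<close> is replaced at once by an
  integer of size about \<open>1 / \<gamma>\<close>.\<close>
definition precision_expr :: expr where
  "precision_expr =
     Binary Add (Unary Floor (Binary Div (rat_const 1) (nth_expr 1 (Var v_io)))) (rat_const 1)"

definition reduce_prog :: prog where
  "reduce_prog = Seq (Assign v_G precision_expr) (Assign v_io (nth_expr 0 (Var v_io)))"

definition pareto_prog :: "nat \<Rightarrow> prog" where
  "pareto_prog k = Seq reduce_prog (main_prog k)"

lemma writes_member [simp]: "writes (member_prog y l) = {v_found, v_members, v_member}"
  by (auto simp: member_prog_def)

lemma writes_round [simp]: "writes round_prog = {v_round, v_rest, v_gridpoint}"
  by (auto simp: round_prog_def)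

lemma writes_product [simp]:
  "writes (product_prog X Y) = {v_prod, v_lefts, v_left, v_rights, v_right}"
  by (auto simp: product_prog_def)

lemma writes_extend:
  "writes (extend_prog k) \<subseteq> {v_new, v_keys, v_found, v_members, v_member, v_round, v_rest,
     v_gridpoint, v_arg, v_key} \<union> {50..}"
  by (auto simp: extend_prog_def weigh_prog_def update_prog_def insert_prog_def)

lemma writes_collect [simp]:
  "writes (collect_prog k) = {v_found, v_members, v_member, v_out, v_count}"
  by (auto simp: collect_prog_def)

lemma wp_member:
  assumes "s y = v" "s l = List vs" "{y, l} \<inter> {v_found, v_members, v_member} = {}" "5 \<le> Z"
    and Q: "\<And>s'. s' v_found = Num (if v \<in> set vs then 1 else 0) \<Longrightarrow>
      (\<And>x. x \<notin> {v_found, v_members, v_member} \<Longrightarrow> s' x = s x) \<Longrightarrow> Q s'"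
  shows "wp Z \<Omega> (member_prog y l) Q s"
  unfolding member_prog_def
  apply (intro wp_Seq wp_Assign)
  subgoal using assms by simp
  apply (rule wp_foreach_Var[where J = "\<lambda>d s'. s' v_found = Num (if v \<in> set d then 1 else 0)"])
  using assms by (auto intro!: wp_Cond wp_Assign wp_Skip Q)

lemma wp_round:
  assumes "s v_grid = List (map Num gs)" "s v_arg = Num x" "5 \<le> Z"
    and Q: "\<And>s'. s' v_round = Num (fold (\<lambda>g r. if x < g then r else g) gs 0) \<Longrightarrow>
      (\<And>x. x \<notin> {v_round, v_rest, v_gridpoint} \<Longrightarrow> s' x = s x) \<Longrightarrow> Q s'"
  shows "wp Z \<Omega> round_prog Q s"
  unfolding round_prog_def
proof (intro wp_Seq wp_Assign, goal_cases)
  case 2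
  show ?case
  proof (rule wp_small, rule wp_foreach_Var[where J = "\<lambda>d s'. s' v_round =
      Num (fold (\<lambda>v r. if x < rat_of v then r else rat_of v) d 0)" and vs = "map Num gs"], goal_cases)
    case (5 d v r s')
    have v: "v \<in> set (map Num gs)" using 5(2) by simp
    then have "val_len v < val_len (List (map Num gs))" by (rule val_len_mem)
    also have "\<dots> = val_len ((s(v_round := Num 0)) v_grid)" using assms(1) by simp
    also have "\<dots> \<le> Z" using 5(1) unfolding small_def eval.simps by blast
    finally have vZ: "val_len v \<le> Z" by simp
    obtain g where g: "v = Num g" using v by auto
    have fr: "s' v_arg = Num x" using 5(5)[of v_arg] assms(2) by simp
    show ?case using 5(3) vZ g fr by (auto intro!: wp_Cond wp_Assign wp_Skip)
  next
    case (6 s')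
    show ?case
    proof (rule Q)
      show "s' v_round = Num (fold (\<lambda>g r. if x < g then r else g) gs 0)"
        using 6(2) by (simp add: fold_map o_def cong: if_cong)
    qed (use 6(4) in auto)
  qed (use assms in auto)
qed (use assms in auto)

lemma wp_product:
  assumes "s X = List xs" "s Y = List ys"
    and XY: "{X, Y} \<inter> {v_prod, v_lefts, v_left, v_rights, v_right} = {}"
    and B: "\<And>x y. x \<in> set xs \<Longrightarrow> y \<in> set ys \<Longrightarrow> val_len (List (x # items y)) \<le> B"
    and Z: "1 + length xs * length ys * B \<le> Z"
    and Q: "\<And>s' zs. s' v_prod = List zs \<Longrightarrow> set zs = {List (x # items y) |x y. x \<in> set xs \<and> y \<in> set ys} \<Longrightarrow>
      length zs = length xs * length ys \<Longrightarrow>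
      (\<And>x. x \<notin> {v_prod, v_lefts, v_left, v_rights, v_right} \<Longrightarrow> s' x = s x) \<Longrightarrow> Q s'"
  shows "wp Z \<Omega> (product_prog X Y) Q s"
proof -
  define P where "P d zs \<longleftrightarrow> set zs = {List (x # items y) |x y. x \<in> set d \<and> y \<in> set ys} \<and>
      length zs = length d * length ys" for d zs
  have step: "wp Z \<Omega> (foreach v_right v_rights (Var Y)
       (Assign v_prod (Binary Push (Binary Push (Var v_left) (Var v_right)) (Var v_prod))))
       (\<lambda>s''. \<exists>zs. s'' v_prod = List zs \<and> P (d @ [x]) zs) (s'(v_left := x, v_lefts := List r))"
    if xs: "xs = d @ x # r" and s': "s' v_prod = List zs" "P d zs"
      and fr: "\<And>y. y \<notin> {v_prod, v_lefts, v_left, v_rights, v_right} \<Longrightarrow> s' y = s y" for d x r s' zs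
  proof (rule wp_foreach_Var[where J = "\<lambda>e s''. \<exists>zs'. s'' v_prod = List (zs' @ zs) \<and>
      set zs' = {List (x # items y) |y. y \<in> set e} \<and> length zs' = length e" and vs = ys], goal_cases)
    case (5 e y r' s'')
    then obtain zs' where zs': "s'' v_prod = List (zs' @ zs)"
      "set zs' = {List (x # items y) |y. y \<in> set e}" "length zs' = length e" by blast
    let ?new = "List (x # items y) # zs' @ zs"
    have "val_len (List ?new) \<le> 1 + length ?new * B"
    proof (rule val_len_List)
      fix v assume "v \<in> set ?new"
      then show "val_len v \<le> B" using zs'(2) s'(2) B xs 5(1) unfolding P_def by auto
    qed
    also have "length ?new \<le> length xs * length ys"
    proof -
      have "length ?new \<le> length d * length ys + length ys"
        using zs'(3) s'(2) 5(1) unfolding P_def by simp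
      then show ?thesis using xs by (simp add: algebra_simps)
    qed
    finally have le: "val_len (List ?new) \<le> Z" using Z by (simp add: mult_le_mono1)
    have fr2: "s'' v_left = x" using 5(4)[of v_left] by simp
    show ?case
    proof (rule wp_Assign, goal_cases)
      case 1
      then show ?case using le zs'(1) fr2 by simp
    next
      case 2
      show ?case using zs' fr2
        by (intro exI[of _ "List (x # items y) # zs'"]) auto
    qed
  next
    case (6 s'')
    then obtain zs' where zs': "s'' v_prod = List (zs' @ zs)"
      "set zs' = {List (x # items y) |y. y \<in> set ys}" "length zs' = length ys" by blast
    then show ?case using s'(2) unfolding P_def
      by (intro exI[of _ "zs' @ zs"]) auto
  qed (use assms s' fr in auto)
  show ?thesis
    unfolding product_prog_def
  proof (intro wp_Seq wp_Assign, goal_cases)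
    case 2
    show ?case
    proof (rule wp_foreach_Var[where J = "\<lambda>d s'. \<exists>zs. s' v_prod = List zs \<and> P d zs" and vs = xs], goal_cases)
      case (5 d x r s')
      then obtain zs where "s' v_prod = List zs" "P d zs" by blast
      then show ?case using 5 by (intro step) auto
    next
      case (6 s')
      then show ?case using Q unfolding P_def by auto
    qed (use assms in \<open>auto simp: P_def\<close>)
  qed (use Z in auto)
qed

section \<open>The dynamic program\<close>

lemma ex_map_image:
  assumes "set zs = f ` A" "inj f"
  obtains xs where "zs = map f xs" "set xs = A"
proof
  show "zs = map f (map (inv f) zs)"
    using assms by (auto simp: map_idI f_inv_into_f image_iff intro!: map_idI[symmetric])
  show "set (map (inv f) zs) = A" using assms by (auto simp: image_image)
qed

lemma fold_max_mem: "fold (\<lambda>c m. max m c) xs (r :: rat) \<in> insert r (set xs)"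
  by (induction xs arbitrary: r) (auto simp: max_def)

lemma le_fold_max: "r \<le> fold (\<lambda>c m. max m c) xs (r :: rat)"
  "c \<in> set xs \<Longrightarrow> c \<le> fold (\<lambda>c m. max m c) xs (r :: rat)"
  by (induction xs arbitrary: r)
    (auto, meson max.cobounded1 order_trans, meson max.cobounded2 order_trans)

locale pareto_dp =
  fixes k :: nat and cs :: "rat list" and al :: rat and G :: nat and \<Omega> :: "measure_oracle list"
  assumes k: "1 \<le> k" and cs: "cs \<noteq> []" and al: "0 < al" "al < 1" and G: "1 \<le> G"
    and \<Omega>: "length \<Omega> = length cs"
    and costs: "\<And>c. c \<in> set cs \<Longrightarrow> 0 \<le> c"
    and answers: "\<And>i a b \<delta>. i < length cs \<Longrightarrow> valid_query a b \<delta> \<Longrightarrow> 0 \<le> answer (\<Omega> ! i) a b \<delta>"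
begin

abbreviation (input) n :: nat where "n \<equiv> length cs"

definition max_cost :: rat where "max_cost = fold (\<lambda>c m. max m c) cs 0"
definition scale :: rat where "scale = of_nat n * max_cost"
text \<open>\<open>G\<close> stands for \<open>1 / \<gamma>\<close>. The constants make the relative errors add up to a factor of
  at most \<open>1 + 1 / (2 * G)\<close> and the absolute ones to at most \<open>1 / (2 * G)\<close> of the optimum.\<close>
definition prec :: nat where "prec = 28 * (n * G)"
definition dlt :: rat where "dlt = 1 / of_nat prec"
definition ratio :: rat where "ratio = of_nat prec / (of_nat prec + 1)"
definition thr :: rat where
  "thr = al / (16 * 2 ^ k * (of_nat n * of_nat n * of_nat G))"
definition depth :: nat where "depth = (LEAST l. ratio ^ l \<le> thr)"
definition grid :: "rat list" where "grid = map (\<lambda>l. ratio ^ l) (rev [0..<Suc depth])"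
definition rd :: "rat \<Rightarrow> rat" where "rd x = fold (\<lambda>g r. if x < g then r else g) grid 0"

definition lo :: "rat list \<Rightarrow> nat \<Rightarrow> rat" where
  "lo g a = foldr (\<lambda>j. max (g ! j)) (filter (\<lambda>j. \<not> bit a j) [0..<k]) (- 1)"
definition hi :: "rat list \<Rightarrow> nat \<Rightarrow> rat" where
  "hi g a = foldr (\<lambda>j. min (g ! j)) (filter (bit a) [0..<k]) 1"
definition weight :: "nat \<Rightarrow> rat list \<Rightarrow> nat \<Rightarrow> rat" where
  "weight i g a =
    (if lo g a < hi g a then answer (\<Omega> ! i) (lo g a) (hi g a) dlt / (1 + dlt) else 0)"
text \<open>Some vector of a Pareto cover of a product measure covers almost every point. By convention it
  is vector \<open>0\<close>, and \<open>excess\<close> is the mass that it misses in one coordinate.\<close>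
definition excess :: "nat \<Rightarrow> rat list \<Rightarrow> rat" where
  "excess i g = (\<Sum>a<2 ^ k. if bit a 0 then 0 else weight i g a)"

text \<open>Entry \<open>j < k\<close> of a key is the rounded normalised cost of the \<open>j\<close>-th vector, entry \<open>k + t\<close> the
  rounded probability that exactly the vectors in the bit mask \<open>t\<close> cover a random point.\<close>
definition next_key :: "nat \<Rightarrow> rat list \<Rightarrow> (nat \<Rightarrow> rat) \<Rightarrow> nat \<Rightarrow> rat" where
  "next_key i g f d = rd (if d < k then f d + cs ! i / scale * g ! d
     else (\<Sum>t<2 ^ k. \<Sum>a<2 ^ k. if and t a = d - k then f (k + t) * weight i g a else 0))"

text \<open>Coordinates are treated from the last to the first, so a list of length \<open>m\<close> holds the
  choices for the last \<open>m\<close> coordinates.\<close>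
primrec key_of :: "rat list list \<Rightarrow> nat \<Rightarrow> rat" where
  "key_of [] = initial_key k"
| "key_of (g # ch) = next_key (n - Suc (length ch)) g (key_of ch)"

definition tuples :: "rat list set" where
  "tuples = {g. length g = k \<and> set g \<subseteq> set grid}"

primrec admissible :: "rat list list \<Rightarrow> bool" where
  "admissible [] = True"
| "admissible (g # ch) = (g \<in> tuples \<and> excess (n - Suc (length ch)) g = 0 \<and> admissible ch)"

definition chains :: "nat \<Rightarrow> rat list list set" where
  "chains m = {ch. length ch = m \<and> admissible ch}"

definition value_of :: "(nat \<Rightarrow> rat) \<Rightarrow> rat" where
  "value_of f = (\<Sum>t<2 ^ k. f (k + t) * foldr (\<lambda>j. min (f j)) (filter (bit t) [0..<k]) 1)"

definition keyval :: "rat list list \<Rightarrow> val" where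
  "keyval ch = encode_key k (key_of ch)"

definition entry :: "rat list list \<Rightarrow> val" where
  "entry ch = List [keyval ch, encode_choices k ch]"

lemma max_cost_mem: "max_cost \<in> insert 0 (set cs)"
  and max_cost_nonneg: "0 \<le> max_cost"
  and le_max_cost: "c \<in> set cs \<Longrightarrow> c \<le> max_cost"
  unfolding max_cost_def by (rule fold_max_mem, rule le_fold_max, rule le_fold_max)

lemma scale_nonneg: "0 \<le> scale"
  using max_cost_nonneg by (simp add: scale_def)

lemma prec_ge: "28 \<le> prec"
proof -
  have "1 * 1 \<le> n * G" using cs G by (intro mult_le_mono) (auto simp: Suc_le_eq)
  then show ?thesis by (simp add: prec_def)
qed

lemma dlt: "0 < dlt" "dlt < 1"
  using prec_ge by (auto simp: dlt_def)

lemma ratio: "0 < ratio" "ratio < 1"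
  using prec_ge by (auto simp: ratio_def)

lemma thr_pos: "0 < thr"
  unfolding thr_def using al cs G by (intro divide_pos_pos mult_pos_pos) auto

lemma depth_le: "ratio ^ depth \<le> thr" and depth_least: "ratio ^ l \<le> thr \<Longrightarrow> depth \<le> l"
proof -
  obtain l where "ratio ^ l < thr"
    using real_arch_pow_inv[of "of_rat thr" "of_rat ratio"] thr_pos ratio
    by (auto simp: of_rat_less of_rat_power[symmetric])
  then have "ratio ^ l \<le> thr" by simp
  then show "ratio ^ depth \<le> thr" unfolding depth_def by (rule LeastI)
  show "ratio ^ l \<le> thr \<Longrightarrow> depth \<le> l" for l unfolding depth_def by (rule Least_le)
qed

lemma set_grid: "set grid = (\<lambda>l. ratio ^ l) ` {..depth}"
  unfolding grid_def set_map set_rev set_upt atLeast0LessThan lessThan_Suc_atMost ..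

lemma length_grid: "length grid = Suc depth"
  by (simp add: grid_def)

lemma grid_bounds: "g \<in> set grid \<Longrightarrow> 0 < g \<and> g \<le> 1"
  using ratio by (auto simp: set_grid power_le_one)

lemma one_in_grid: "1 \<in> set grid"
  unfolding set_grid by (rule image_eqI[of _ _ 0]) auto

lemma rd_mem: "rd x \<in> insert 0 (set grid)"
proof -
  have "fold (\<lambda>g r. if x < g then r else g) gs r \<in> insert r (set gs)" for gs r
    by (induction gs arbitrary: r) auto
  then show ?thesis unfolding rd_def by blast
qed

lemma rd_cases:
  assumes "0 \<le> x" "x \<le> 1"
  shows "rd x \<le> x" "x \<le> rd x / ratio \<or> rd x = 0 \<and> x \<le> thr"
proof -
  have fold_eq: "fold (\<lambda>g r. if x < g then r else g) (map (\<lambda>l. ratio ^ l) (rev [0..<m])) r =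
     (if \<exists>l<m. ratio ^ l \<le> x then ratio ^ (LEAST l. ratio ^ l \<le> x) else r)" for m r
  proof (induction m arbitrary: r)
    case (Suc m)
    show ?case
    proof (cases "\<exists>l<m. ratio ^ l \<le> x")
      case True
      then have "\<exists>l<Suc m. ratio ^ l \<le> x" using less_SucI by blast
      then show ?thesis using True by (simp add: Suc.IH)
    next
      case False
      have "(LEAST l. ratio ^ l \<le> x) = m" if "ratio ^ m \<le> x"
        using that False by (intro Least_equality) (auto simp: not_less[symmetric])
      then show ?thesis using False by (auto simp: Suc.IH less_Suc_eq not_le)
    qed
  qed simp
  have eq: "rd x = (if \<exists>l<Suc depth. ratio ^ l \<le> x then ratio ^ (LEAST l. ratio ^ l \<le> x) else 0)"
    unfolding rd_def grid_def by (rule fold_eq)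
  have "rd x \<le> x \<and> (x \<le> rd x / ratio \<or> rd x = 0 \<and> x \<le> thr)"
  proof (cases "\<exists>l<Suc depth. ratio ^ l \<le> x")
    case True
    define l where "l = (LEAST l. ratio ^ l \<le> x)"
    have l: "ratio ^ l \<le> x" "\<And>j. j < l \<Longrightarrow> x < ratio ^ j"
      unfolding l_def using True LeastI[of "\<lambda>l. ratio ^ l \<le> x"] not_less_Least[of _ "\<lambda>l. ratio ^ l \<le> x"]
      by (blast, force simp: not_le)
    have "x \<le> ratio ^ l / ratio"
    proof (cases l)
      case 0
      then have "x * ratio \<le> 1 * 1" using assms ratio by (intro mult_mono) auto
      then show ?thesis using 0 ratio by (simp add: field_simps)
    next
      case (Suc j)
      then show ?thesis using l(2)[of j] ratio by simp
    qed
    then show ?thesis using True l unfolding eq l_def by simp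
  next
    case False
    then have "x < ratio ^ depth" by (auto simp: not_le)
    then show ?thesis using False assms depth_le unfolding eq by auto
  qed
  then show "rd x \<le> x" "x \<le> rd x / ratio \<or> rd x = 0 \<and> x \<le> thr" by auto
qed

lemma key_of_mem: "key_of ch d \<in> insert 0 (set grid)"
  using rd_mem one_in_grid by (cases ch) (auto simp: initial_key_def next_key_def)

lemma lo_mem: "g \<in> tuples \<Longrightarrow> lo g a \<in> insert (- 1) (set grid)"
  and hi_mem: "g \<in> tuples \<Longrightarrow> hi g a \<in> insert 1 (set grid)"
proof -
  assume g: "g \<in> tuples"
  have "foldr (\<lambda>j. max (g ! j)) js (- 1) \<in> insert (- 1) (set grid)"
    "foldr (\<lambda>j. min (g ! j)) js 1 \<in> insert 1 (set grid)" if "\<forall>j\<in>set js. j < k" for js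
  proof -
    have "g ! j \<in> set grid" if "j \<in> set js" for j
      using that \<open>\<forall>j\<in>set js. j < k\<close> g unfolding tuples_def by auto
    then show "foldr (\<lambda>j. max (g ! j)) js (- 1) \<in> insert (- 1) (set grid)"
      "foldr (\<lambda>j. min (g ! j)) js 1 \<in> insert 1 (set grid)"
      by (induction js) (simp_all add: max_def min_def)
  qed
  from this[of "filter (\<lambda>j. \<not> bit a j) [0..<k]"] this[of "filter (bit a) [0..<k]"]
  show "lo g a \<in> insert (- 1) (set grid)" "hi g a \<in> insert 1 (set grid)"
    by (auto simp: lo_def hi_def)
qed

lemma valid_query_lo_hi: "g \<in> tuples \<Longrightarrow> lo g a < hi g a \<Longrightarrow> valid_query (lo g a) (hi g a) dlt"
  using lo_mem[of g a] hi_mem[of g a] grid_bounds[of "lo g a"] grid_bounds[of "hi g a"] dlt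
  by (auto simp: valid_query_def)

lemma weight_nonneg: "g \<in> tuples \<Longrightarrow> i < n \<Longrightarrow> 0 \<le> weight i g a"
  using answers valid_query_lo_hi dlt by (auto simp: weight_def)

lemma next_key_cong:
  assumes "encode_key k f = encode_key k f'" "d < k + 2 ^ k"
  shows "next_key i g f d = next_key i g f' d"
proof -
  have "f d = f' d" if "d < k + 2 ^ k" for d
    using assms(1) that by (auto simp: encode_key_def)
  then show ?thesis using assms(2) unfolding next_key_def
    by (intro arg_cong[of _ _ rd] if_cong sum.cong) auto
qed

lemma keyval_Cons_cong: "keyval ch = keyval ch' \<Longrightarrow> length ch = length ch' \<Longrightarrow>
    keyval (g # ch) = keyval (g # ch')"
  using next_key_cong by (auto simp: keyval_def encode_key_def)

lemma length_le_states:
  assumes "distinct (map keyval chs)"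
  shows "length chs \<le> (depth + 2) ^ (k + 2 ^ k)"
proof -
  let ?S = "{xs. set xs \<subseteq> insert 0 (set grid) \<and> length xs = k + 2 ^ k}"
  have "set (map keyval chs) \<subseteq> (\<lambda>xs. List (map Num xs)) ` ?S"
  proof
    fix v assume "v \<in> set (map keyval chs)"
    then obtain ch where "v = keyval ch" by auto
    moreover have "map (key_of ch) [0..<k + 2 ^ k] \<in> ?S" using key_of_mem by auto
    ultimately show "v \<in> (\<lambda>xs. List (map Num xs)) ` ?S"
      by (intro image_eqI[of _ _ "map (key_of ch) [0..<k + 2 ^ k]"])
         (auto simp: keyval_def encode_key_def o_def)
  qed
  then have "card (set (map keyval chs)) \<le> card ?S"
    by (rule surj_card_le[OF finite_lists_length_eq, rotated]) simp
  also have "\<dots> = card (insert 0 (set grid)) ^ (k + 2 ^ k)"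
    by (rule card_lists_length_eq) simp
  also have "\<dots> \<le> (depth + 2) ^ (k + 2 ^ k)"
    using card_length[of grid] card_insert_le_m1[of "depth + 2" "set grid" 0] length_grid
    by (intro power_mono) auto
  finally show ?thesis using assms distinct_card by fastforce
qed

end

locale pareto_dp_bounds = pareto_dp +
  fixes b B Z :: nat
  assumes grid_len: "\<And>x. x \<in> insert 0 (set grid) \<Longrightarrow> val_len (Num x) \<le> b"
    and pair_len: "4 + (k + 2 ^ k) * b + k * (1 + n * b) + k * b \<le> B"
    and nat_len: "\<And>i. i \<le> max k n \<Longrightarrow> val_len (Num (of_nat i)) \<le> B"
    and cost_len: "\<And>c. c \<in> set cs \<Longrightarrow> val_len (Num c) \<le> B"
    and scale_len: "val_len (Num scale) \<le> B"
    and prec_len: "val_len (Num (of_nat prec)) \<le> B"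
    and dlt_len: "val_len (Num dlt) \<le> B"
    and ratio_len: "val_len (Num ratio) \<le> B"
    and thr_len: "val_len (Num thr) \<le> B"
    and share_len: "\<And>c. c \<in> set cs \<Longrightarrow> val_len (Num (c / scale)) \<le> B"
    and filler_len: "\<And>i. i < k \<Longrightarrow> val_len (Num (1 / of_nat (Suc i))) \<le> B"
    and answer_len: "\<And>i g a. g \<in> tuples \<Longrightarrow> i < n \<Longrightarrow> lo g a < hi g a \<Longrightarrow>
        val_len (Num (answer (\<Omega> ! i) (lo g a) (hi g a) dlt)) \<le> B"
    and weight_len: "\<And>i g a. g \<in> tuples \<Longrightarrow> i < n \<Longrightarrow> val_len (Num (weight i g a)) \<le> B"
    and latency_le: "\<And>i g a. g \<in> tuples \<Longrightarrow> i < n \<Longrightarrow> lo g a < hi g a \<Longrightarrow>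
        latency (\<Omega> ! i) (lo g a) (hi g a) dlt \<le> Z"
    and update_len: "\<And>d. d < k + 2 ^ k \<Longrightarrow> growth (update_expr k d) * B \<le> Z"
    and value_len: "growth (value_expr k) * B \<le> Z"
    and states_len: "1 + (depth + 2) ^ (k + 2 ^ k + k) * B \<le> Z"
    and costs_len: "1 + n * B \<le> Z"
    and output_len: "2 + 4 * k * B \<le> Z"
    and B_ge: "10 \<le> B"
begin

lemma B_le_Z: "B \<le> Z"
proof -
  have "1 * B \<le> (depth + 2) ^ (k + 2 ^ k + k) * B" by (intro mult_le_mono) auto
  then show ?thesis using states_len by linarith
qed

lemma b_le_B: "b \<le> B"
proof -
  have "1 * b \<le> (k + 2 ^ k) * b" using k by (intro mult_le_mono) auto
  then show ?thesis using pair_len by linarith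
qed

lemmas len_trans = order_trans[OF _ B_le_Z]

lemma wp_setup:
  assumes "s v_io = List [List (map Num cs), Num (of_nat k), Num al]" "s v_G = Num (of_nat G)"
    and Q: "\<And>s'. s' v_revcs = List (map Num (rev cs)) \<Longrightarrow> s' v_C = Num scale \<Longrightarrow>
      s' v_i = Num (of_nat n) \<Longrightarrow> s' v_delta = Num dlt \<Longrightarrow> s' v_q = Num ratio \<Longrightarrow>
      s' v_tau = Num thr \<Longrightarrow> Q s'"
  shows "wp Z \<Omega> (setup_prog k) Q s"
  unfolding setup_prog_def seqs_simps
proof (intro wp_Seq wp_Assign wp_Skip, goal_cases)
  case 4
  show ?case
  proof (rule wp_foreach[where vs = "map Num cs" and J = "\<lambda>d s'. s' v_revcs = List (rev d) \<and>
      s' v_C = Num (fold (\<lambda>v m. max m (rat_of v)) d 0) \<and> s' v_i = Num (of_nat (length d))"], goal_cases)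
    case 1
    show ?case using assms(1) by (simp add: items_eval_nth_expr)
  next
    case 2
    have "val_len (List (map Num cs)) \<le> 1 + length (map Num cs) * B"
      using cost_len by (intro val_len_List) auto
    then show ?case using costs_len by simp
  next
    case (6 d v r s')
    obtain c d' r' where c: "v = Num c" "cs = d' @ c # r'" "d = map Num d'"
      using 6(1) by (auto simp: map_eq_append_conv map_eq_Cons_conv)
    have "val_len (List (v # rev d)) \<le> 1 + length (v # rev d) * B"
      using cost_len c by (intro val_len_List) auto
    also have "\<dots> \<le> 1 + n * B" using c by (intro add_mono mult_le_mono) auto
    also have "\<dots> \<le> Z" by (rule costs_len)
    finally have 1: "val_len (List (v # rev d)) \<le> Z" .
    have "max (fold (\<lambda>c m. max m c) d' 0) c \<in> insert 0 (set cs)"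
      using fold_max_mem[of "d'" 0] c by (auto simp: max_def)
    then have 2: "val_len (Num (max (fold (\<lambda>c m. max m c) d' 0) c)) \<le> Z"
      using cost_len B_ge by (intro len_trans) auto
    have 3: "val_len (Num (of_nat (Suc (length d)))) \<le> Z"
      using nat_len[of "Suc (length d)"] c by (intro len_trans) auto
    show ?case unfolding seqs_simps
      by (intro wp_Seq wp_Assign wp_Skip)
        (use 6(2,4) 1 2 3 c in \<open>simp_all add: eval_max_expr fold_map o_def add.commute\<close>)
  next
    case (7 s')
    have vi: "s' v_i = Num (of_nat n)" and vC: "s' v_C = Num max_cost"
      and vG: "s' v_G = Num (of_nat G)"
      and io: "s' v_io = List [List (map Num cs), Num (of_nat k), Num al]"
      using 7(1) 7(3)[of v_G] 7(3)[of v_io] assms by (auto simp: max_cost_def fold_map o_def)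
    have prec: "28 * (of_nat n * of_nat G) = (of_nat prec :: rat)"
      by (simp add: prec_def)
    show ?case unfolding seqs_simps
      by (intro wp_Seq wp_Assign wp_Skip Q)
        (use vi vC vG io prec 7(1) len_trans[OF scale_len] len_trans[OF prec_len] len_trans[OF dlt_len]
           len_trans[OF ratio_len] len_trans[OF thr_len] in
         \<open>simp_all add: scale_def[symmetric] dlt_def[symmetric] ratio_def[symmetric]
           thr_def[symmetric] items_eval_nth_expr rev_map del: val_len.simps\<close>)
  qed (auto)
qed (use B_ge B_le_Z in auto)

lemma wp_grid:
  assumes "s v_q = Num ratio" "s v_tau = Num thr"
    and Q: "\<And>s'. s' v_grid = List (map Num grid) \<Longrightarrow>
      (\<And>x. x \<notin> {v_y, v_grid} \<Longrightarrow> s' x = s x) \<Longrightarrow> Q s'"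
  shows "wp Z \<Omega> grid_prog Q s"
proof -
  define pw where "pw j = map (\<lambda>l. Num (ratio ^ l)) (rev [0..<j])" for j
  have pow_len: "val_len (Num (ratio ^ l)) \<le> b" if "l \<le> depth" for l
    using that by (intro grid_len) (auto simp: set_grid)
  have pw_len: "val_len (List (pw j)) \<le> Z" if "j \<le> Suc depth" for j
  proof -
    have "val_len (List (pw j)) \<le> 1 + length (pw j) * b"
      using pow_len that by (intro val_len_List) (auto simp: pw_def)
    also have "\<dots> \<le> 1 + (depth + 2) ^ (k + 2 ^ k + k) * B"
    proof -
      have "length (pw j) \<le> (depth + 2) ^ 1" using that by (simp add: pw_def)
      also have "\<dots> \<le> (depth + 2) ^ (k + 2 ^ k + k)" using k by (intro power_increasing) auto
      finally show ?thesis using b_le_B by (intro add_mono mult_le_mono) auto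
    qed
    also have "\<dots> \<le> Z" by (rule states_len)
    finally show ?thesis .
  qed
  have pw_Suc: "pw (Suc j) = Num (ratio ^ j) # pw j" for j by (simp add: pw_def)
  have depth_Z: "depth \<le> Z" using pw_len[of "Suc depth"] length_le_val_len[of "pw (Suc depth)"]
    by (simp add: pw_def)
  show ?thesis unfolding grid_prog_def seqs_simps
  proof (intro wp_Seq wp_Assign wp_Skip, goal_cases)
    case 3
    show ?case
    proof (rule wp_While[where m = depth and Inv = "\<lambda>m s'. \<exists>j\<le>depth. m = depth - j \<and>
        s' v_y = Num (ratio ^ j) \<and> s' v_grid = List (pw j) \<and> (\<forall>x. x \<notin> {v_y, v_grid} \<longrightarrow> s' x = s x)"], goal_cases)
      case 1
      then show ?case by (intro exI[of _ 0]) (auto simp: pw_def)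
    next
      case 2
      then show ?case by (rule depth_Z)
    next
      case (3 m s')
      then obtain j where j: "j \<le> depth" "m = depth - j" "s' v_y = Num (ratio ^ j)"
        "s' v_grid = List (pw j)" "\<And>x. x \<notin> {v_y, v_grid} \<Longrightarrow> s' x = s x" by auto
      have tq: "s' v_tau = Num thr" "s' v_q = Num ratio" using j(5)[of v_tau] j(5)[of v_q] assms by auto
      have "thr < ratio ^ j" using 3(2) j(3) tq by (auto split: if_splits)
      then have "j \<noteq> depth" using depth_le by auto
      then have jl: "Suc j \<le> depth" using j(1) by simp
      show ?case
        by (intro exI[of _ "depth - Suc j"] conjI)
          (use jl j tq pw_len[of "Suc j"] order_trans[OF pow_len[of "Suc j"] order_trans[OF b_le_B B_le_Z]]
           in \<open>auto intro!: wp_Seq wp_Assign wp_Skip exI[of _ "Suc j"] simp: pw_Suc mult.commute simp del: val_len.simps\<close>)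
    next
      case (4 m s')
      then obtain j where j: "j \<le> depth" "s' v_y = Num (ratio ^ j)"
        "s' v_grid = List (pw j)" "\<And>x. x \<notin> {v_y, v_grid} \<Longrightarrow> s' x = s x" by auto
      have tq: "s' v_tau = Num thr" using j(4)[of v_tau] assms by auto
      have "ratio ^ j \<le> thr" using 4(2) j(2) tq by (auto split: if_splits)
      then have jd: "j = depth" using depth_least j(1) by (simp add: antisym)
      have "List (pw (Suc depth)) = List (map Num grid)" by (simp add: pw_def grid_def rev_map)
      then show ?case using j jd pw_len[of "Suc depth"] pw_Suc[of depth]
        by (intro wp_Seq wp_Assign wp_Skip Q) (auto simp del: val_len.simps)
    qed
  qed (use B_ge B_le_Z in auto)
qed

definition encode_tuple :: "rat list \<Rightarrow> val" where "encode_tuple g = List (map Num g)"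

lemma inj_encode_tuple: "inj encode_tuple"
  by (auto simp: inj_def encode_tuple_def inj_map_eq_map)

lemma encode_tuple_len:
  assumes "set g \<subseteq> set grid"
  shows "val_len (encode_tuple g) \<le> 1 + length g * b"
proof -
  have "val_len (List (map Num g)) \<le> 1 + length (map Num g) * b"
    using grid_len assms by (intro val_len_List) auto
  then show ?thesis by (simp add: encode_tuple_def)
qed

lemma wp_tuples:
  assumes "s v_grid = List (map Num grid)"
    and Q: "\<And>s' tps. s' v_tuples = List (map encode_tuple tps) \<Longrightarrow> set tps = tuples \<Longrightarrow>
      length tps \<le> (depth + 2) ^ k \<Longrightarrow>
      (\<And>x. x \<notin> {v_prod, v_lefts, v_left, v_rights, v_right, v_tuples} \<Longrightarrow> s' x = s x) \<Longrightarrow> Q s'"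
  shows "wp Z \<Omega> (tuples_prog k) Q s"
  unfolding tuples_prog_def
proof (intro wp_Seq wp_Assign, goal_cases)
  case 1
  then show ?case using B_ge B_le_Z by auto
next
  case 2
  let ?T = "\<lambda>j. {g. length g = j \<and> set g \<subseteq> set grid}"
  show ?case
  proof (rule wp_seqs_upt[where J = "\<lambda>j s'. \<exists>tps. s' v_tuples = List (map encode_tuple tps) \<and>
      set tps = ?T j \<and> length tps = Suc depth ^ j \<and>
      (\<forall>x. x \<notin> {v_prod, v_lefts, v_left, v_rights, v_right, v_tuples} \<longrightarrow> s' x = s x)"], goal_cases)
    case 1
    show ?case by (intro exI[of _ "[[]]"]) (auto simp: encode_tuple_def)
  next
    case (2 j s')
    then obtain tps where tps: "s' v_tuples = List (map encode_tuple tps)" "set tps = ?T j"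
      "length tps = Suc depth ^ j"
      "\<And>x. x \<notin> {v_prod, v_lefts, v_left, v_rights, v_right, v_tuples} \<Longrightarrow> s' x = s x" by auto
    show ?case
    proof (rule wp_Seq, rule wp_product[where xs = "map Num grid" and ys = "map encode_tuple tps" and B = B], goal_cases)
      case 1
      then show ?case using tps(4)[of v_grid] assms by simp
    next
      case (4 x y)
      then obtain g h where g: "x = Num g" "g \<in> set grid" "y = encode_tuple h" "set h \<subseteq> set grid" "length h = j"
        using tps(2) by auto
      have "List (x # items y) = encode_tuple (g # h)" using g by (simp add: encode_tuple_def)
      moreover have "val_len (encode_tuple (g # h)) \<le> 1 + length (g # h) * b"
        using g by (intro encode_tuple_len) auto
      moreover have "length (g # h) * b \<le> k * b" using g(5) 2(1) by (intro mult_le_mono) auto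
      ultimately show ?case using pair_len by simp
    next
      case 5
      have "length (map Num grid) * length (map encode_tuple tps) * B = Suc depth ^ Suc j * B"
        by (simp add: tps(3) length_grid)
      also have "\<dots> \<le> (depth + 2) ^ (k + 2 ^ k + k) * B"
      proof -
        have "Suc depth ^ Suc j \<le> (depth + 2) ^ Suc j" by (intro power_mono) auto
        also have "\<dots> \<le> (depth + 2) ^ (k + 2 ^ k + k)" using 2(1) by (intro power_increasing) auto
        finally show ?thesis by (rule mult_le_mono1)
      qed
      finally show ?case using states_len by linarith
    next
      case (6 s'' zs)
      have "set zs = encode_tuple ` ?T (Suc j)"
      proof -
        have "set zs = {encode_tuple (g # h) |g h. g \<in> set grid \<and> h \<in> ?T j}"
          unfolding 6(2) set_map tps(2) encode_tuple_def by (auto; force)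
        also have "\<dots> = encode_tuple ` ?T (Suc j)"
          unfolding length_Suc_conv by fastforce
        finally show ?thesis .
      qed
      from ex_map_image[OF this inj_encode_tuple]
      obtain tps' where tps': "zs = map encode_tuple tps'" "set tps' = ?T (Suc j)" .
      show ?case
      proof (rule wp_small, rule wp_Assign, goal_cases)
        case 1
        then show ?case using 6(1) unfolding small_def by (metis eval.simps(1))
      next
        case 2
        show ?case
        proof (intro exI[of _ tps'] conjI allI impI)
          show "length tps' = Suc depth ^ Suc j" 
            using 6(3) tps'(1) tps(3) length_grid by (metis length_map power_Suc)
        qed (use 6 tps' tps(4) in auto)
      qed
    qed (use tps in auto)
  next
    case (3 s')
    then obtain tps where "s' v_tuples = List (map encode_tuple tps)" "set tps = ?T k"
      "length tps = Suc depth ^ k"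
      "\<forall>x. x \<notin> {v_prod, v_lefts, v_left, v_rights, v_right, v_tuples} \<longrightarrow> s' x = s x" by blast
    moreover have "Suc depth ^ k \<le> (depth + 2) ^ k" by (intro power_mono) auto
    ultimately show ?case by (intro Q[of s' tps]) (auto simp: tuples_def)
  qed
qed

end

context pareto_dp
begin

definition vectors :: "rat list list \<Rightarrow> rat list list" where
  "vectors ch = map (\<lambda>j. map (\<lambda>g. g ! j) ch) [0..<k]"

text \<open>The \<open>k\<close> vectors found need not be distinct. Adding vectors never increases the cost, so any
  \<open>k\<close> distinct fillers may be used to reach \<open>k\<close> elements.\<close>
definition fillers :: "rat list list \<Rightarrow> rat list list" where
  "fillers ch = map (\<lambda>j. 1 / of_nat (Suc j) # tl (vectors ch ! 0)) [0..<k]"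

definition collect :: "rat list \<Rightarrow> rat list list \<Rightarrow> rat list list" where
  "collect v out = (if v \<in> set out \<or> k \<le> length out then out else v # out)"

definition output_of :: "rat list list \<Rightarrow> rat list list" where
  "output_of ch = fold collect (fillers ch) (fold collect (vectors ch) [])"

lemma length_vectors [simp]: "length (vectors ch) = k" "length (fillers ch) = k"
  by (simp_all add: vectors_def fillers_def)

lemma fold_collect:
  assumes "distinct out" "length out \<le> k"
  shows "distinct (fold collect vs out) \<and> length (fold collect vs out) \<le> k \<and>
    set out \<subseteq> set (fold collect vs out) \<and> set (fold collect vs out) \<subseteq> set out \<union> set vs \<and>
    length out \<le> length (fold collect vs out) \<and>
    length (fold collect vs out) \<le> length out + length vs \<and>
    (length (fold collect vs out) < k \<or> length out + length vs \<le> k \<longrightarrow>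
       set vs \<subseteq> set (fold collect vs out))"
  using assms
proof (induction vs arbitrary: out)
  case (Cons v vs)
  have "distinct (collect v out)" "length (collect v out) \<le> k" 
    using Cons.prems by (auto simp: collect_def)
  note IH = Cons.IH[OF this]
  have c: "set out \<subseteq> set (collect v out)" "set (collect v out) \<subseteq> insert v (set out)"
    "length out \<le> length (collect v out)" "length (collect v out) \<le> Suc (length out)"
    "length out < k \<longrightarrow> v \<in> set (collect v out)"
    by (auto simp: collect_def)
  have lt: "length out < k" if "length (fold collect (v # vs) out) < k \<or> length out + length (v # vs) \<le> k"
    using that IH c(3) by auto
  show ?case using IH c lt by (simp; blast)
qed simp

lemma output_of:
  assumes "ch \<noteq> []"
  shows "distinct (output_of ch)" "length (output_of ch) = k" "set (vectors ch) \<subseteq> set (output_of ch)"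
    "set (output_of ch) \<subseteq> set (vectors ch) \<union> set (fillers ch)"
proof -
  let ?o = "fold collect (vectors ch) []"
  have 1: "distinct ?o" "length ?o \<le> k" "set (vectors ch) \<subseteq> set ?o" "set ?o \<subseteq> set (vectors ch)"
    using fold_collect[of "[]" "vectors ch"] by auto
  note 2 = fold_collect[OF 1(1,2), of "fillers ch", folded output_of_def]
  show "distinct (output_of ch)" "set (vectors ch) \<subseteq> set (output_of ch)"
    "set (output_of ch) \<subseteq> set (vectors ch) \<union> set (fillers ch)" using 1 2 by auto
  have "distinct (fillers ch)"
    by (auto simp: fillers_def distinct_map inj_on_def)
  then have "k \<le> card (set (fillers ch))" by (simp add: distinct_card)
  moreover have "card (set (fillers ch)) \<le> length (output_of ch)" if "length (output_of ch) < k"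
    using 2 that card_length[of "output_of ch"] by (meson List.finite_set card_mono le_trans)
  ultimately show "length (output_of ch) = k" using 2 by linarith
qed

lemma admissible_tuples: "admissible ch \<Longrightarrow> g \<in> set ch \<Longrightarrow> g \<in> tuples"
  by (induction ch) auto

lemma tuples_nth: "g \<in> tuples \<Longrightarrow> j < k \<Longrightarrow> g ! j \<in> set grid"
  by (auto simp: tuples_def)

lemma encode_choices_vectors: "encode_choices k ch = encode_vectors (vectors ch)"
  by (simp add: encode_choices_def encode_vectors_def vectors_def o_def)

lemma value_of_cong: "keyval ch = keyval ch' \<Longrightarrow> value_of (key_of ch) = value_of (key_of ch')"
proof -
  assume "keyval ch = keyval ch'"
  then have eq: "key_of ch d = key_of ch' d" if "d < k + 2 ^ k" for d
    using that by (auto simp: keyval_def encode_key_def)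
  show ?thesis unfolding value_of_def
    by (intro sum.cong arg_cong2[of _ _ _ _ "(*)"] foldr_cong) (auto simp: eq)
qed

lemma eval_choice_expr:
  "s v_pair = List (e # map Num g) \<Longrightarrow> length g = k \<Longrightarrow> j < k \<Longrightarrow> eval (choice_expr j) s = Num (g ! j)"
  by (simp add: choice_expr_def items_eval_nth_expr)

lemma eval_lo_expr:
  assumes "s v_pair = List (e # map Num g)" "length g = k"
  shows "eval (lo_expr k a) s = Num (lo g a)"
  unfolding lo_expr_def lo_def eval_max_exprs foldr_map o_def
  by (auto intro!: foldr_cong simp: eval_choice_expr[of s, OF assms])

lemma eval_hi_expr:
  assumes "s v_pair = List (e # map Num g)" "length g = k"
  shows "eval (hi_expr k a) s = Num (hi g a)"
  unfolding hi_expr_def hi_def eval_min_exprs foldr_map o_def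
  by (auto intro!: foldr_cong simp: eval_choice_expr[of s, OF assms])

lemma eval_excess_expr:
  assumes "\<And>a. a < 2 ^ k \<Longrightarrow> s (v_weight a) = Num (weight i g a)"
  shows "eval (excess_expr k) s = Num (excess i g)"
  unfolding excess_expr_def excess_def eval_sum_expr_upt
  using assms by (auto intro!: sum.cong)

lemma eval_update_expr:
  assumes p: "s v_pair = List (entry ch # map Num g)" "length g = k"
    and w: "s v_w = Num (cs ! i / scale)"
    and a: "\<And>a. a < 2 ^ k \<Longrightarrow> s (v_weight a) = Num (weight i g a)" and d: "d < k + 2 ^ k"
  shows "eval (update_expr k d) s = Num (if d < k then key_of ch d + cs ! i / scale * g ! d
     else (\<Sum>t<2 ^ k. \<Sum>a<2 ^ k. if and t a = d - k then key_of ch (k + t) * weight i g a else 0))"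
proof -
  have key: "eval (nth_expr d (nth_expr 0 (nth_expr 0 (Var v_pair)))) s = Num (key_of ch d)"
    if "d < k + 2 ^ k" for d
    using that p by (simp add: items_eval_nth_expr entry_def keyval_def encode_key_def)
  show ?thesis
  proof (cases "d < k")
    case True
    then show ?thesis using key[of d] eval_choice_expr[of s, OF p True] w d by (simp add: update_expr_def)
  next
    case False
    then show ?thesis unfolding update_expr_def
      by (auto simp: eval_sum_expr_upt key a intro!: sum.cong)
  qed
qed

lemma vars_update_expr: "vars (update_expr k d) \<subseteq> {v_pair, v_w} \<union> v_weight ` {..<2 ^ k}"
  by (auto simp: update_expr_def vars_sum_expr vars_nth_expr choice_expr_def split: if_splits)

lemma eval_solution_expr:
  assumes p: "s v_pair = List (entry ch # map Num g)" "length g = k"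
  shows "eval (solution_expr k) s = encode_choices k (g # ch)"
  unfolding solution_expr_def eval_list_expr encode_choices_def
  using p by (auto simp: eval_choice_expr[of s, OF p] items_eval_nth_expr entry_def encode_choices_def)

lemma eval_value_expr:
  assumes "s v_final = entry ch"
  shows "eval (value_expr k) s = Num (value_of (key_of ch))"
proof -
  have key: "eval (comp_expr v_final d) s = Num (key_of ch d)" if "d < k + 2 ^ k" for d
    using that assms by (simp add: comp_expr_def items_eval_nth_expr entry_def keyval_def encode_key_def)
  show ?thesis unfolding value_expr_def value_of_def eval_sum_expr_upt
    by (auto simp: key eval_min_exprs foldr_map o_def intro!: sum.cong foldr_cong)
qed

end

context pareto_dp_bounds
begin

lemma keyval_len: "val_len (keyval ch) \<le> 1 + (k + 2 ^ k) * b"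
proof -
  let ?vs = "map (\<lambda>d. Num (key_of ch d)) [0..<k + 2 ^ k]"
  have "val_len (List ?vs) \<le> 1 + length ?vs * b"
    using grid_len key_of_mem by (intro val_len_List) auto
  then show ?thesis by (simp add: keyval_def encode_key_def del: upt_Suc)
qed

lemma vector_len:
  assumes "admissible ch" "j < k"
  shows "val_len (List (map (\<lambda>g. Num (g ! j)) ch)) \<le> 1 + length ch * b"
proof -
  have "val_len (List (map (\<lambda>g. Num (g ! j)) ch)) \<le> 1 + length (map (\<lambda>g. Num (g ! j)) ch) * b"
    using assms grid_len tuples_nth admissible_tuples by (intro val_len_List) auto
  then show ?thesis by simp
qed

lemma choices_len:
  assumes "admissible ch" "length ch \<le> n"
  shows "val_len (encode_choices k ch) \<le> 1 + k * (1 + n * b)"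
proof -
  let ?vs = "map (\<lambda>j. List (map (\<lambda>g. Num (g ! j)) ch)) [0..<k]"
  have "val_len (List ?vs) \<le> 1 + length ?vs * (1 + n * b)"
  proof (rule val_len_List)
    fix v assume "v \<in> set ?vs"
    then obtain j where j: "j < k" "v = List (map (\<lambda>g. Num (g ! j)) ch)" by auto
    have "length ch * b \<le> n * b" using assms(2) by simp
    then show "val_len v \<le> 1 + n * b"
      using vector_len[OF assms(1) j(1)] unfolding j(2) by linarith
  qed
  then show ?thesis by (simp add: encode_choices_def)
qed

lemma entry_len:
  assumes "admissible ch" "length ch \<le> n"
  shows "val_len (entry ch) \<le> 3 + (k + 2 ^ k) * b + k * (1 + n * b)"
  using choices_len[OF assms] keyval_len[of ch] by (simp add: entry_def)

lemma entry_len_B: "admissible ch \<Longrightarrow> length ch \<le> n \<Longrightarrow> val_len (entry ch) \<le> B"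
  using entry_len[of ch] pair_len by linarith

lemma pair_len_B:
  assumes "admissible ch" "length ch \<le> n" "g \<in> tuples"
  shows "val_len (List (entry ch # map Num g)) \<le> B"
proof -
  have "val_len (List (map Num g)) \<le> 1 + length (map Num g) * b"
    using grid_len assms(3) by (intro val_len_List) (auto simp: tuples_def)
  then show ?thesis using entry_len[OF assms(1,2)] pair_len assms(3) by (simp add: tuples_def)
qed

lemma wp_weigh:
  assumes p: "s v_pair = List (e # map Num g)" "g \<in> tuples" and i: "i < n"
    and s: "s v_i = Num (of_nat i)" "s v_delta = Num dlt"
    and Q: "\<And>s'. (\<And>a. a < 2 ^ k \<Longrightarrow> s' (v_weight a) = Num (weight i g a)) \<Longrightarrow>
      (\<And>x. x \<notin> range v_weight \<Longrightarrow> s' x = s x) \<Longrightarrow> Q s'"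
  shows "wp Z \<Omega> (weigh_prog k) Q s"
  unfolding weigh_prog_def
proof (rule wp_seqs_upt[where J = "\<lambda>m s'. (\<forall>a<m. s' (v_weight a) = Num (weight i g a)) \<and>
    (\<forall>x. x \<notin> range v_weight \<longrightarrow> s' x = s x)"], goal_cases)
  case (2 a s')
  have fr: "s' x = s x" if "x \<notin> range v_weight" for x using 2 that by blast
  have p': "s' v_pair = List (e # map Num g)" and s': "s' v_i = Num (of_nat i)" "s' v_delta = Num dlt"
    using fr[of v_pair] fr[of v_i] fr[of v_delta] p s by (simp_all add: image_iff)
  have gk: "length g = k" using p by (simp add: tuples_def)
  note ev = eval_lo_expr[of s', OF p' gk, of a] eval_hi_expr[of s', OF p' gk, of a]
  show ?case
  proof (rule wp_Cond, goal_cases)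
    case 1
    then have lt: "lo g a < hi g a" using ev by (auto split: if_splits)
    let ?ans = "answer (\<Omega> ! i) (lo g a) (hi g a) dlt"
    have w: "weight i g a = ?ans / (1 + dlt)" using lt by (simp add: weight_def)
    show ?case
    proof (rule wp_Seq, rule wp_Query[where i = i, OF _ _ _ _ _ valid_query_lo_hi[OF p(2) lt]], goal_cases)
      case 1
      show ?case using s' by simp
    next
      case 2
      show ?case using i \<Omega> by simp
    next
      case 6
      show ?case by (rule latency_le[OF p(2) i lt])
    next
      case 7
      show ?case by (rule len_trans[OF answer_len[OF p(2) i lt]])
    next
      case 8
      show ?case
      proof (rule wp_Assign, goal_cases)
        case 1
        then show ?case using len_trans[OF weight_len[OF p(2) i, of a]] s' w
          by (simp del: val_len.simps)
      next
        case 2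
        then show ?case using 2 \<open>(\<forall>a'<a. s' (v_weight a') = Num (weight i g a')) \<and>
          (\<forall>x. x \<notin> range v_weight \<longrightarrow> s' x = s x)\<close> s' w by (auto simp: less_Suc_eq)
      qed
    qed (use ev s' in auto)
  next
    case 2
    then have "\<not> lo g a < hi g a" using ev by (auto split: if_splits)
    then have "weight i g a = 0" by (simp add: weight_def)
    then show ?case using B_ge B_le_Z \<open>(\<forall>a'<a. s' (v_weight a') = Num (weight i g a')) \<and>
          (\<forall>x. x \<notin> range v_weight \<longrightarrow> s' x = s x)\<close> by (intro wp_Assign) (auto simp: less_Suc_eq)
  qed
qed (auto intro: Q)

lemma wp_update:
  assumes p: "s v_pair = List (entry ch # map Num g)" "g \<in> tuples" "admissible ch" "length ch \<le> n"
    and i: "i < n" and w: "s v_w = Num (cs ! i / scale)"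
    and a: "\<And>a. a < 2 ^ k \<Longrightarrow> s (v_weight a) = Num (weight i g a)"
    and gr: "s v_grid = List (map Num grid)"
    and Q: "\<And>s'. s' v_key = encode_key k (next_key i g (key_of ch)) \<Longrightarrow>
      (\<And>x. x \<notin> range v_comp \<union> {v_arg, v_round, v_rest, v_gridpoint, v_key} \<Longrightarrow> s' x = s x) \<Longrightarrow> Q s'"
  shows "wp Z \<Omega> (update_prog k) Q s"
  unfolding update_prog_def
proof (rule wp_Seq, rule wp_seqs_upt[where J = "\<lambda>m s'.
    (\<forall>d<m. s' (v_comp d) = Num (next_key i g (key_of ch) d)) \<and>
    (\<forall>x. x \<notin> range v_comp \<union> {v_arg, v_round, v_rest, v_gridpoint} \<longrightarrow> s' x = s x)"], goal_cases)
  case (2 d s')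
  have fr: "s' x = s x" if "x \<notin> range v_comp \<union> {v_arg, v_round, v_rest, v_gridpoint}" for x
    using 2 that by blast
  have odd: "x \<notin> range v_comp" if "x < 50" for x using that by auto
  have wt: "v_weight a \<notin> range v_comp" for a by (auto, presburger)
  have p': "s' v_pair = List (entry ch # map Num g)" and w': "s' v_w = Num (cs ! i / scale)"
    and a': "\<And>a. a < 2 ^ k \<Longrightarrow> s' (v_weight a) = Num (weight i g a)"
    and gr': "s' v_grid = List (map Num grid)"
    using fr[of v_pair] fr[of v_w] fr[of v_grid] fr[of "v_weight _"] p w a gr odd wt by auto
  have gk: "length g = k" using p by (simp add: tuples_def)
  have ev: "eval (update_expr k d) s' = Num (if d < k then key_of ch d + cs ! i / scale * g ! d
     else (\<Sum>t<2 ^ k. \<Sum>a<2 ^ k. if and t a = d - k then key_of ch (k + t) * weight i g a else 0))"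
    by (rule eval_update_expr[of s', OF p' gk w' _ 2(1)]) (rule a')
  have "val_len (eval (update_expr k d) s') \<le> growth (update_expr k d) * B"
  proof (rule val_len_eval)
    fix x assume "x \<in> vars (update_expr k d)"
    then consider "x = v_pair" | "x = v_w" | a where "a < 2 ^ k" "x = v_weight a"
      using vars_update_expr by fastforce
    then show "val_len (s' x) \<le> B"
    proof cases
      case 1
      then show ?thesis using pair_len_B[OF p(3,4,2)] p' by metis
    next
      case 2
      then show ?thesis using share_len[of "cs ! i"] i w' by simp
    next
      case (3 a)
      then show ?thesis using weight_len[OF p(2) i, of a] a' by simp
    qed
  qed (use B_ge in simp)
  also have "\<dots> \<le> Z" by (rule update_len[OF 2(1)])
  finally have len: "val_len (eval (update_expr k d) s') \<le> Z" .
  show ?case unfolding seqs_simps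
  proof (rule wp_Seq, rule wp_Assign, rule len, rule wp_Seq,
      rule wp_round[where gs = grid, OF _ fun_upd_same[THEN trans, OF ev]], goal_cases)
    case 1
    then show ?case using gr' by simp
  next
    case 2
    then show ?case using B_ge B_le_Z by simp
  next
    case (3 s'')
    have r: "s'' v_round = Num (next_key i g (key_of ch) d)"
      using 3(1) by (simp add: next_key_def rd_def)
    have fr2: "s'' x = s' x" if "x \<notin> {v_arg, v_round, v_rest, v_gridpoint}" for x
      using 3(2)[of x] that by auto
    show ?case
    proof (intro wp_Seq wp_Assign wp_Skip, goal_cases)
      case 1
      have "next_key i g (key_of ch) d \<in> insert 0 (set grid)"
        unfolding next_key_def by (rule rd_mem)
      then show ?case using r grid_len b_le_B B_le_Z by fastforce
    next
      case 2
      have "s'' (v_comp d') = Num (next_key i g (key_of ch) d')" if "d' < d" for d'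
        using fr2[of "v_comp d'"] that \<open>(\<forall>d'<d. s' (v_comp d') = _ d') \<and> _\<close> by auto
      then show ?case using r fr fr2 by (auto simp: less_Suc_eq)
    qed
  qed
next
  case (3 s')
  have ev: "eval (list_expr (map (\<lambda>d. Var (v_comp d)) [0..<k + 2 ^ k])) s' =
      encode_key k (next_key i g (key_of ch))"
    using 3 by (auto simp: eval_list_expr encode_key_def)
  show ?case
  proof (rule wp_Assign, unfold ev)
    let ?vs = "map (\<lambda>d. Num (next_key i g (key_of ch) d)) [0..<k + 2 ^ k]"
    have "val_len (List ?vs) \<le> 1 + length ?vs * b"
      using grid_len rd_mem by (intro val_len_List) (auto simp: next_key_def)
    then have "val_len (encode_key k (next_key i g (key_of ch))) \<le> 1 + (k + 2 ^ k) * b"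
      by (simp add: encode_key_def del: upt_Suc)
    then show "val_len (encode_key k (next_key i g (key_of ch))) \<le> Z"
      using pair_len B_le_Z by linarith
    show "Q (s'(v_key := encode_key k (next_key i g (key_of ch))))"
      by (rule Q) (use 3 in auto)
  qed
qed auto

end

context pareto_dp_bounds
begin

definition collected :: "nat \<Rightarrow> state \<Rightarrow> rat list list list \<Rightarrow> bool" where
  "collected m s chs \<longleftrightarrow> s v_new = List (map entry chs) \<and> s v_keys = List (map keyval chs) \<and>
     set chs \<subseteq> chains m \<and> distinct (map keyval chs)"

lemma states_pow: "(depth + 2) ^ (k + 2 ^ k) * B < Z"
proof -
  have "(depth + 2) ^ (k + 2 ^ k) * B \<le> (depth + 2) ^ (k + 2 ^ k + k) * B"
    by (intro mult_le_mono1 power_increasing) auto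
  then show ?thesis using states_len by linarith
qed

lemma chain_lists_len:
  assumes "set chs \<subseteq> chains m" "m \<le> n" "distinct (map keyval chs)"
  shows "val_len (List (map entry chs)) \<le> Z" "val_len (List (map keyval chs)) \<le> Z"
proof -
  have B: "val_len (entry ch) \<le> B" if "ch \<in> set chs" for ch
    using entry_len_B[of ch] assms that by (auto simp: chains_def)
  have "length chs * B \<le> (depth + 2) ^ (k + 2 ^ k) * B"
    using length_le_states[OF assms(3)] by (rule mult_le_mono1)
  then have le: "1 + length chs * B \<le> Z" using states_pow by linarith
  have "val_len (List (map entry chs)) \<le> 1 + length (map entry chs) * B"
    using B by (intro val_len_List) auto
  then show "val_len (List (map entry chs)) \<le> Z" using le by simp
  have "val_len (keyval ch) \<le> B" if "ch \<in> set chs" for ch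
    using B[OF that] by (simp add: entry_def)
  then have "val_len (List (map keyval chs)) \<le> 1 + length (map keyval chs) * B"
    by (intro val_len_List) auto
  then show "val_len (List (map keyval chs)) \<le> Z" using le by simp
qed

lemma wp_insert:
  assumes p: "s v_pair = List (entry ch # map Num g)" "length g = k"
    and key: "s v_key = keyval (g # ch)" and ch: "g # ch \<in> chains m" "m \<le> n"
    and col: "collected m s chs"
    and Q: "\<And>s' chs'. collected m s' chs' \<Longrightarrow> set chs \<subseteq> set chs' \<Longrightarrow>
      keyval (g # ch) \<in> keyval ` set chs' \<Longrightarrow> Q s'"
  shows "wp Z \<Omega> (insert_prog k) Q s"
  unfolding insert_prog_def
proof (rule wp_Seq, rule wp_member[where v = "keyval (g # ch)" and vs = "map keyval chs"], goal_cases)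
  case (5 s')
  have fr: "s' x = s x" if "x \<notin> {v_found, v_members, v_member}" for x using 5(2) that by blast
  have p': "s' v_pair = List (entry ch # map Num g)" using fr[of v_pair] p by simp
  show ?case
  proof (rule wp_Cond, goal_cases)
    case 1
    then have "keyval (g # ch) \<in> keyval ` set chs" using 5(1) by (auto split: if_splits)
    moreover have "collected m s' chs" using col fr[of v_new] fr[of v_keys] by (simp add: collected_def)
    ultimately show ?case by (intro wp_Skip Q[of s' chs]) auto
  next
    case 2
    then have notin: "keyval (g # ch) \<notin> keyval ` set chs" using 5(1) by (auto split: if_splits)
    then have new: "set ((g # ch) # chs) \<subseteq> chains m" "distinct (map keyval ((g # ch) # chs))"
      using col ch by (auto simp: collected_def)
    have k': "s' v_key = keyval (g # ch)" "s' v_keys = List (map keyval chs)"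
      "s' v_new = List (map entry chs)"
      using fr[of v_key] fr[of v_keys] fr[of v_new] key col by (auto simp: collected_def)
    show ?case
    proof (intro wp_Seq wp_Assign, goal_cases)
      case 1
      then show ?case using chain_lists_len(2)[OF new(1) ch(2) new(2)] k' by simp
    next
      case 2
      let ?s = "s'(v_keys := eval (Binary Push (Var v_key) (Var v_keys)) s')"
      have "?s v_pair = List (entry ch # map Num g)" using p' by simp
      from eval_solution_expr[of ?s, OF this p(2)]
      have ev: "eval (Binary Push (list_expr [Var v_key, solution_expr k]) (Var v_new)) ?s
          = List (map entry ((g # ch) # chs))"
        using k' by (simp add: eval_list_expr entry_def)
      {
        case 2
        then show ?case using chain_lists_len(1)[OF new(1) ch(2) new(2)] unfolding ev .
      next
        case 3
        then show ?case unfolding ev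
          using k' new by (intro Q[of _ "(g # ch) # chs"]) (auto simp: collected_def)
      }
    qed
  qed
qed (use assms B_ge B_le_Z in \<open>auto simp: collected_def\<close>)

lemma wp_extend:
  assumes p: "s v_pair = List (entry ch # map Num g)" "g \<in> tuples" "ch \<in> chains m" and m: "m < n"
    and i: "s v_i = Num (of_nat (n - Suc m))" and dl: "s v_delta = Num dlt"
    and w: "s v_w = Num (cs ! (n - Suc m) / scale)" and gr: "s v_grid = List (map Num grid)"
    and col: "collected (Suc m) s chs"
    and Q: "\<And>s' chs'. collected (Suc m) s' chs' \<Longrightarrow> set chs \<subseteq> set chs' \<Longrightarrow>
      (excess (n - Suc m) g = 0 \<longrightarrow> keyval (g # ch) \<in> keyval ` set chs') \<Longrightarrow> Q s'"
  shows "wp Z \<Omega> (extend_prog k) Q s"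
  unfolding extend_prog_def
proof (rule wp_Seq, rule wp_weigh[where i = "n - Suc m" and g = g], rule p(1), goal_cases)
  case (5 s')
  let ?i = "n - Suc m"
  have fr: "s' x = s x" if "x < 50" for x using 5(2)[of x] that by auto
  have gk: "length g = k" using p(2) by (simp add: tuples_def)
  have ch: "length ch = m" "admissible ch" using p(3) by (auto simp: chains_def)
  have p': "s' v_pair = List (entry ch # map Num g)" "s' v_w = Num (cs ! ?i / scale)"
    "s' v_grid = List (map Num grid)" "collected (Suc m) s' chs"
    using fr p w gr col by (auto simp: collected_def)
  have ev: "eval (excess_expr k) s' = Num (excess ?i g)"
    by (rule eval_excess_expr) (rule 5(1))
  show ?case
  proof (rule wp_Cond, goal_cases)
    case 1
    then have ex: "excess ?i g = 0" using ev by (auto split: if_splits)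
    then have gch: "g # ch \<in> chains (Suc m)" using p(2) ch by (auto simp: chains_def)
    show ?case
    proof (rule wp_Seq, rule wp_update[of s' ch g ?i, OF p'(1) p(2) ch(2) _ _ p'(2) 5(1) p'(3)], goal_cases)
      case (4 s'')
      have fr2: "s'' x = s' x" if "x < 24" for x
      proof (rule 4(2))
        have "x \<notin> range v_comp" using that by auto
        then show "x \<notin> range v_comp \<union> {v_arg, v_round, v_rest, v_gridpoint, v_key}" using that by auto
      qed
      have "s'' v_key = keyval (g # ch)" using 4(1) ch(1) by (simp add: keyval_def)
      moreover have "s'' v_pair = List (entry ch # map Num g)" "collected (Suc m) s'' chs"
        using fr2 p' by (auto simp: collected_def)
      ultimately show ?case using gch m gk
        by (intro wp_insert[of s'' ch g "Suc m" chs Q]) (auto intro: Q)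
    qed (use m ch in auto)
  next
    case 2
    then have "excess ?i g \<noteq> 0" using ev by (auto split: if_splits)
    then show ?case using p'(4) by (intro wp_Skip Q[of s' chs]) auto
  qed
qed (use p i dl m in auto)

lemma writes_extend_small: "x \<in> {v_io, v_revcs, v_C, v_i, v_delta, v_grid, v_tuples, v_states, v_w, v_prod} \<Longrightarrow>
    x \<notin> {v_pair, v_pairs} \<union> writes (extend_prog k)"
  using writes_extend[of k] by auto

lemma wp_extend_pairs:
  assumes prod: "s v_prod = List zs"
      "set zs = {List (entry ch # map Num g) |ch g. ch \<in> set chs \<and> g \<in> tuples}"
    and chs: "set chs \<subseteq> chains m" "keyval ` chains m \<subseteq> keyval ` set chs" and m: "m < n"
    and empty: "s v_new = List []" "s v_keys = List []"
    and i: "s v_i = Num (of_nat (n - Suc m))" and dl: "s v_delta = Num dlt"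
    and w: "s v_w = Num (cs ! (n - Suc m) / scale)" and gr: "s v_grid = List (map Num grid)"
    and Q: "\<And>s' news. collected (Suc m) s' news \<Longrightarrow>
      keyval ` chains (Suc m) \<subseteq> keyval ` set news \<Longrightarrow> s' v_i = s v_i \<Longrightarrow> Q s'"
  shows "wp Z \<Omega> (foreach v_pair v_pairs (Var v_prod) (extend_prog k)) Q s"
proof -
  let ?i = "n - Suc m"
  define J where "J e s' \<longleftrightarrow> (\<exists>news. collected (Suc m) s' news \<and>
    (\<forall>ch\<in>set chs. \<forall>g\<in>tuples. List (entry ch # map Num g) \<in> set e \<longrightarrow> excess ?i g = 0 \<longrightarrow>
       keyval (g # ch) \<in> keyval ` set news))" for e s'
  have len: "length ch = m" if "ch \<in> set chs" for ch
    using subsetD[OF chs(1) that] by (simp add: chains_def)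
  show ?thesis
  proof (rule wp_foreach_Var[where vs = zs and J = J], goal_cases)
    case 2
    show ?case using writes_extend[of k] by auto
  next
    case 4
    show ?case unfolding J_def using empty by (intro exI[of _ "[]"]) (auto simp: collected_def)
  next
    case (5 e u r s')
    from 5(2) obtain news where news: "collected (Suc m) s' news"
      "\<And>ch g. ch \<in> set chs \<Longrightarrow> g \<in> tuples \<Longrightarrow> List (entry ch # map Num g) \<in> set e \<Longrightarrow>
         excess ?i g = 0 \<Longrightarrow> keyval (g # ch) \<in> keyval ` set news" unfolding J_def by blast
    have "u \<in> set zs" using 5(1) by simp
    then obtain ch g where u: "u = List (entry ch # map Num g)" "ch \<in> set chs" "g \<in> tuples"
      unfolding prod(2) by blast
    have fr: "s' x = s x" if "x \<in> {v_i, v_delta, v_grid, v_w}" for x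
      using 5(4)[OF writes_extend_small[of x]] that by auto
    show ?case
    proof (rule wp_extend[of _ ch g m news], goal_cases)
      case 3
      show ?case using chs(1) u(2) by (rule subsetD)
    next
      case 5
      show ?case using fr[of v_i] i by simp
    next
      case 9
      show ?case using news(1) by (simp add: collected_def)
    next
      case (10 s'' news')
      have "keyval (g' # ch') \<in> keyval ` set news'" if c: "ch' \<in> set chs" "g' \<in> tuples"
        "List (entry ch' # map Num g') \<in> set (e @ [u])" "excess ?i g' = 0" for ch' g'
      proof (cases "List (entry ch' # map Num g') \<in> set e")
        case True
        then show ?thesis using news(2)[OF c(1,2)] c(4) 10(2) by blast
      next
        case False
        then have "entry ch' = entry ch" "map Num g' = map Num g" using c(3) u(1) by auto
        then have "keyval ch' = keyval ch" "g' = g" by (auto simp: entry_def inj_map_eq_map inj_def)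
        then have "keyval (g' # ch') = keyval (g # ch)"
          using keyval_Cons_cong len[OF c(1)] len[OF u(2)] by metis
        then show ?thesis using 10(3) c(4) \<open>g' = g\<close> by simp
      qed
      then show ?case unfolding J_def using 10(1) by blast
    qed (use u m fr[of v_delta] fr[of v_grid] fr[of v_w] dl gr w in simp_all)
  next
    case (6 s')
    from 6(1) obtain news where news: "collected (Suc m) s' news"
      and sub: "\<And>ch g. ch \<in> set chs \<Longrightarrow> g \<in> tuples \<Longrightarrow> List (entry ch # map Num g) \<in> set zs \<Longrightarrow>
         excess ?i g = 0 \<Longrightarrow> keyval (g # ch) \<in> keyval ` set news" unfolding J_def by blast
    have "keyval ` chains (Suc m) \<subseteq> keyval ` set news"
    proof (intro image_subsetI)
      fix ch assume "ch \<in> chains (Suc m)"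
      then obtain g ch0 where ch: "ch = g # ch0" "g \<in> tuples" "ch0 \<in> chains m" "excess ?i g = 0"
        by (cases ch) (auto simp: chains_def)
      from subsetD[OF chs(2) imageI[OF ch(3)]]
      obtain ch1 where ch1: "ch1 \<in> set chs" "keyval ch1 = keyval ch0" by auto
      have "keyval (g # ch1) \<in> keyval ` set news"
        by (rule sub[OF ch1(1) ch(2) _ ch(4)]) (use ch1(1) ch(2) in \<open>auto simp: prod(2)\<close>)
      moreover have "length ch1 = length ch0" using len[OF ch1(1)] ch(3) by (simp add: chains_def)
      ultimately show "keyval ch \<in> keyval ` set news"
        using keyval_Cons_cong[OF ch1(2)] ch(1) by metis
    qed
    then show ?case using 6(3)[OF writes_extend_small[of v_i]] by (intro Q[OF news]) auto
  qed (use prod in auto)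
qed

lemma wp_dp:
  assumes rc: "s v_revcs = List (map Num (rev cs))" and C: "s v_C = Num scale"
    and i: "s v_i = Num (of_nat n)" and dl: "s v_delta = Num dlt"
    and gr: "s v_grid = List (map Num grid)"
    and tps: "s v_tuples = List (map encode_tuple tps)" "set tps = tuples" "length tps \<le> (depth + 2) ^ k"
    and Q: "\<And>s' chs. s' v_states = List (map entry chs) \<Longrightarrow> set chs \<subseteq> chains n \<Longrightarrow>
      keyval ` chains n \<subseteq> keyval ` set chs \<Longrightarrow> Q s'"
  shows "wp Z \<Omega> (dp_prog k) Q s"
proof -
  define J where "J d s' \<longleftrightarrow> (\<exists>chs. s' v_states = List (map entry chs) \<and> set chs \<subseteq> chains (length d) \<and>
    distinct (map keyval chs) \<and> keyval ` chains (length d) \<subseteq> keyval ` set chs \<and>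
    s' v_i = Num (of_nat (n - length d)))" for d :: "val list" and s'
  have entry0: "List [List [encode_key k (initial_key k), encode_choices k []]] = List (map entry [[]])"
    by (simp add: entry_def keyval_def)
  show ?thesis unfolding dp_prog_def
  proof (rule wp_Seq, rule wp_Assign, goal_cases)
    case 1
    have "val_len (List (map entry [[]])) \<le> Z"
      by (rule chain_lists_len(1)[of _ 0]) (auto simp: chains_def)
    then show ?case using entry0 by simp
  next
    case 2
    show ?case
    proof (rule wp_foreach_Var[where vs = "map Num (rev cs)" and J = J], goal_cases)
      case 1
      then show ?case using rc by simp
    next
      case 2
      then show ?case using writes_extend[of k] by auto
    next
      case 4
      then show ?case unfolding J_def using entry0 i
        by (intro exI[of _ "[[]]"]) (auto simp: chains_def)
    next
      case (5 d v r s')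
      let ?m = "length d"
      let ?i = "n - Suc ?m"
      have len: "n = ?m + Suc (length r)" using 5(1) by (metis length_append length_Cons length_map length_rev)
      have m: "?m < n" using len by simp
      have "v = map Num (rev cs) ! ?m" using 5(1) by simp
      then have v: "v = Num (cs ! ?i)" using m by (simp add: rev_nth)
      have fr: "s' x = s x" if "x \<in> {v_C, v_delta, v_grid, v_tuples}" for x
        using 5(4)[of x] that writes_extend_small[of x] by auto
      from 5(2) obtain chs where chs: "s' v_states = List (map entry chs)" "set chs \<subseteq> chains ?m"
        "distinct (map keyval chs)" "keyval ` chains ?m \<subseteq> keyval ` set chs"
        and vi: "s' v_i = Num (of_nat (n - ?m))" unfolding J_def by blast
      have i1: "of_nat (n - ?m) - 1 = (of_nat ?i :: rat)" using len by simp
      have clen: "val_len (Num (of_nat ?i)) \<le> Z" by (rule len_trans[OF nat_len]) simp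
      have ci: "cs ! ?i \<in> set cs" using m by simp
      have wlen: "val_len (Num (cs ! ?i / scale)) \<le> Z" by (rule len_trans[OF share_len[OF ci]])
      have small5: "5 \<le> Z" using B_ge B_le_Z by simp
      let ?s = "s'(v_c' := v, v_cs' := List r, v_i := Num (of_nat ?i), v_w := Num (cs ! ?i / scale))"
      have rest: "wp Z \<Omega> (seqs [product_prog v_states v_tuples, Assign v_new nil_const,
         Assign v_keys nil_const, foreach v_pair v_pairs (Var v_prod) (extend_prog k),
         Assign v_states (Var v_new)]) (J (d @ [v])) ?s"
        unfolding seqs_simps
      proof (rule wp_Seq, rule wp_product[where xs = "map entry chs" and ys = "map encode_tuple tps" and B = B], goal_cases)
        case (4 x y)
        then obtain ch g where "x = entry ch" "ch \<in> chains ?m" "y = encode_tuple g" "g \<in> tuples"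
          using chs(2) tps(2) by auto
        then show ?case using pair_len_B[of ch g] m by (simp add: encode_tuple_def chains_def)
      next
        case 5
        have "length chs * length tps * B \<le> (depth + 2) ^ (k + 2 ^ k) * (depth + 2) ^ k * B"
          using length_le_states[OF chs(3)] tps(3) by (intro mult_le_mono) auto
        also have "\<dots> = (depth + 2) ^ (k + 2 ^ k + k) * B" by (simp only: power_add)
        finally show ?case using states_len unfolding length_map by linarith
      next
        case (6 s1 zs)
        have zs: "set zs = {List (entry ch # map Num g) |ch g. ch \<in> set chs \<and> g \<in> tuples}"
          unfolding 6(2) using tps(2) by (auto simp: encode_tuple_def; force)
        have fr1: "s1 x = ?s x" if "x \<notin> {v_prod, v_lefts, v_left, v_rights, v_right}" for x
          by (rule 6(4)[OF that])
        show ?case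
        proof (intro wp_Seq wp_Assign, goal_cases)
          case 3
          show ?case
          proof (rule wp_extend_pairs[OF _ zs chs(2,4) m], goal_cases)
            case (8 s2 news)
            show ?case
            proof (intro wp_Seq wp_Assign wp_Skip, goal_cases)
              case 1
              then show ?case using 8(1) chain_lists_len(1)[of news "Suc ?m"] m
                by (auto simp: collected_def simp del: val_len.simps)
            next
              case 2
              then show ?case using 8 fr1[of v_i]
                by (auto simp: J_def collected_def intro!: exI[of _ news])
            qed
          qed (use 6(1) fr1 fr[of v_delta] fr[of v_grid] dl gr in \<open>simp_all del: of_nat_diff\<close>)
        qed (use small5 in auto)
      qed (use chs(1) tps(1) fr[of v_tuples] in auto)
      show ?case unfolding seqs_simps
      proof (rule wp_Seq, rule wp_Assign, goal_cases)
        case 1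
        then show ?case using vi i1 clen by (simp del: val_len.simps of_nat_diff)
      next
        case 2
        show ?case
        proof (rule wp_Seq, rule wp_Assign, goal_cases)
          case 1
          then show ?case using v fr[of v_C] C wlen by (simp del: val_len.simps)
        next
          case 2
          then show ?case using rest v vi i1 fr[of v_C] C by (simp add: fun_upd_def del: of_nat_diff)
        qed
      qed
    next
      case (6 s')
      then show ?case unfolding J_def using Q by auto
    qed auto
  qed
qed

lemma wp_select:
  assumes st: "s v_states = List (map entry chs)" "set chs \<subseteq> chains n" "chs \<noteq> []"
    and Q: "\<And>s' ch. s' v_sol = encode_choices k ch \<Longrightarrow> ch \<in> set chs \<Longrightarrow>
      (\<And>ch'. ch' \<in> set chs \<Longrightarrow> value_of (key_of ch) \<le> value_of (key_of ch')) \<Longrightarrow> Q s'"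
  shows "wp Z \<Omega> (select_prog k) Q s"
proof -
  have elen: "val_len (entry ch) \<le> B" if "ch \<in> set chs" for ch
    using that st(2) by (intro entry_len_B) (auto simp: chains_def)
  have vlen: "val_len (Num (value_of (key_of ch))) \<le> Z" if ch: "ch \<in> set chs" for ch
  proof -
    let ?s = "\<lambda>_. entry ch"
    have "val_len (eval (value_expr k) ?s) \<le> growth (value_expr k) * B"
      using elen[OF ch] B_ge by (intro val_len_eval) auto
    then show ?thesis using value_len eval_value_expr[of ?s ch] by simp
  qed
  have clen: "val_len (encode_choices k ch) \<le> Z" if "ch \<in> set chs" for ch
    using elen[OF that] B_le_Z by (simp add: entry_def)
  have solev: "eval (nth_expr 1 (Var v_final)) s' = encode_choices k ch" if "s' v_final = entry ch" for s' ch
    using that by (simp add: items_eval_nth_expr entry_def)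
  have h: "hd chs \<in> set chs" using st(3) by simp
  have hd_ev: "eval (nth_expr 0 (Var v_states)) s = entry (hd chs)"
    using st(1,3) by (simp add: items_eval_nth_expr nth_map hd_conv_nth)
  define J where "J d s' \<longleftrightarrow> (\<exists>ch\<in>set chs. s' v_sol = encode_choices k ch \<and>
      s' v_best = Num (value_of (key_of ch)) \<and>
      (\<forall>ch'\<in>set chs. entry ch' \<in> set d \<longrightarrow> value_of (key_of ch) \<le> value_of (key_of ch')))" for d and s' :: state
  show ?thesis unfolding select_prog_def seqs_simps
  proof (rule wp_Seq, rule wp_Assign, goal_cases)
    case 1
    then show ?case unfolding hd_ev by (rule len_trans[OF elen[OF h]])
  next
    case 2
    let ?s = "s(v_final := entry (hd chs))"
    have ev: "eval (value_expr k) ?s = Num (value_of (key_of (hd chs)))"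
      by (rule eval_value_expr) simp
    show ?case unfolding hd_ev
    proof (rule wp_Seq, rule wp_Assign, unfold ev, rule vlen[OF h], rule wp_Seq, rule wp_Assign, goal_cases)
      case 1
      show ?case by (subst solev[of _ "hd chs"]) (use clen[OF h] in auto)
    next
      case 2
      show ?case
      proof (subst solev[of _ "hd chs"], simp, rule wp_Seq,
          rule wp_foreach_Var[where vs = "map entry chs" and J = J], goal_cases)
        case 4
        show ?case unfolding J_def using h by (intro bexI[of _ "hd chs"]) auto
      next
        case (5 d v r s')
        have "v \<in> set (map entry chs)" using 5(1) by simp
        then obtain ch where ch: "v = entry ch" "ch \<in> set chs" by auto
        have same: "value_of (key_of ch') = value_of (key_of ch)" if "entry ch' = v" for ch'
          using that ch by (intro value_of_cong) (auto simp: entry_def)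
        obtain ch0 where ch0: "ch0 \<in> set chs" "s' v_sol = encode_choices k ch0"
          "s' v_best = Num (value_of (key_of ch0))"
          "\<And>ch'. ch' \<in> set chs \<Longrightarrow> entry ch' \<in> set d \<Longrightarrow> value_of (key_of ch0) \<le> value_of (key_of ch')"
          using 5(2) unfolding J_def by blast
        let ?s' = "s'(v_final := v, v_finals := List r)"
        have ev: "eval (value_expr k) ?s' = Num (value_of (key_of ch))"
          by (rule eval_value_expr) (simp add: ch)
        show ?case
        proof (rule wp_Seq, rule wp_Assign, unfold ev, rule vlen[OF ch(2)], rule wp_Cond, goal_cases)
          case 1
          then have less: "value_of (key_of ch) < value_of (key_of ch0)"
            using ch0(3) by (auto split: if_splits)
          show ?case
          proof (rule wp_Seq, rule wp_Assign, goal_cases)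
            case 1
            then show ?case using vlen[OF ch(2)] by (simp del: val_len.simps)
          next
            case 2
            show ?case
            proof (rule wp_Assign, goal_cases)
              case 1
              then show ?case by (subst solev[of _ ch]) (use clen[OF ch(2)] ch(1) in auto)
            next
              case 2
              have "value_of (key_of ch) \<le> value_of (key_of ch')"
                if "ch' \<in> set chs" "entry ch' \<in> set (d @ [v])" for ch'
                using that same[of ch'] ch0(4)[of ch'] less by auto
              then show ?case
                by (subst solev[of _ ch]) (use ch in \<open>auto simp: J_def\<close>)
            qed
          qed
        next
          case 2
          then have "\<not> value_of (key_of ch) < value_of (key_of ch0)"
            using ch0(3) by (auto split: if_splits)
          then have "value_of (key_of ch0) \<le> value_of (key_of ch')"
            if "ch' \<in> set chs" "entry ch' \<in> set (d @ [v])" for ch'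
            using that same[of ch'] ch0(4)[of ch'] by auto
          then show ?case using ch0 by (intro wp_Skip) (auto simp: J_def)
        qed
      next
        case (6 s')
        then show ?case unfolding J_def by (auto intro!: wp_Skip intro: Q)
      qed (use st in auto)
    qed
  qed
qed

lemma wp_collect:
  assumes "s v_vector = encode_tuple v" "s v_out = List (map encode_tuple out)"
    "s v_count = Num (of_nat (length out))"
    and len: "\<And>u. u \<in> set (v # out) \<Longrightarrow> val_len (encode_tuple u) \<le> 2 * B" and out: "length out \<le> k"
    and Q: "\<And>s'. s' v_out = List (map encode_tuple (collect v out)) \<Longrightarrow>
      s' v_count = Num (of_nat (length (collect v out))) \<Longrightarrow> Q s'"
  shows "wp Z \<Omega> (collect_prog k) Q s"
  unfolding collect_prog_def
proof (rule wp_Seq, rule wp_member[where vs = "map encode_tuple out" and v = "encode_tuple v"], goal_cases)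
  case (5 s')
  have fr: "s' x = s x" if "x \<notin> {v_found, v_members, v_member}" for x using 5(2) that by blast
  have s': "s' v_vector = encode_tuple v" "s' v_out = List (map encode_tuple out)"
    "s' v_count = Num (of_nat (length out))" using fr assms by auto
  have mem: "encode_tuple v \<in> set (map encode_tuple out) \<longleftrightarrow> v \<in> set out"
    using inj_encode_tuple by (auto dest: injD)
  show ?case
  proof (rule wp_Cond, goal_cases)
    case 1
    then have "v \<in> set out" using 5(1) mem by (auto split: if_splits)
    then show ?case using s' by (intro wp_Skip Q) (auto simp: collect_def)
  next
    case 2
    then have notin: "v \<notin> set out" using 5(1) mem by (auto split: if_splits)
    show ?case
    proof (rule wp_Cond, goal_cases)
      case 1
      then have less: "length out < k" using s' by (auto split: if_splits)
      then have c: "collect v out = v # out" using notin by (simp add: collect_def)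
      have "val_len (List (map encode_tuple (v # out))) \<le> 1 + length (map encode_tuple (v # out)) * (2 * B)"
        using len by (intro val_len_List) auto
      also have "\<dots> \<le> 1 + k * (2 * B)" using less by (intro add_mono mult_le_mono) auto
      also have "\<dots> \<le> Z" using output_len by simp
      finally have 1: "val_len (List (map encode_tuple (v # out))) \<le> Z" .
      have 2: "val_len (Num (of_nat (length (v # out)))) \<le> Z"
        using less by (intro len_trans[OF nat_len]) auto
      show ?case
        by (intro wp_Seq wp_Assign Q) (use s' 1 2 c in \<open>auto simp: add.commute simp del: val_len.simps\<close>)
    next
      case 2
      then have "k \<le> length out" using s' by (auto split: if_splits)
      then show ?case using s' by (intro wp_Skip Q) (auto simp: collect_def)
    qed
  qed
qed (use assms B_ge B_le_Z in auto)

lemma wp_output: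
  assumes ch: "ch \<in> chains n" and sol: "s v_sol = encode_choices k ch"
    and Q: "\<And>s'. s' v_io = encode_vectors (output_of ch) \<Longrightarrow> Q s'"
  shows "wp Z \<Omega> (output_prog k) Q s"
proof -
  have enc: "encode_vectors vs = List (map encode_tuple vs)" for vs
    by (simp add: encode_vectors_def encode_tuple_def)
  have adm: "admissible ch" "length ch = n" using ch by (auto simp: chains_def)
  have ne: "ch \<noteq> []" using adm(2) cs by auto
  have vec_len: "val_len (encode_tuple u) \<le> B" if u: "u \<in> set (vectors ch)" for u
  proof -
    have "val_len (encode_tuple u) < val_len (encode_choices k ch)"
      unfolding encode_choices_vectors enc using u by (intro val_len_mem) auto
    also have "\<dots> \<le> val_len (entry ch)" by (simp add: entry_def)
    also have "\<dots> \<le> B" using adm by (intro entry_len_B) auto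
    finally show ?thesis by simp
  qed
  have v0: "vectors ch ! 0 \<in> set (vectors ch)" using k by (intro nth_mem) simp
  have v0_ne: "vectors ch ! 0 \<noteq> []" using k ne by (simp add: vectors_def)
  have fill_len: "val_len (encode_tuple u) \<le> 2 * B" if u: "u \<in> set (fillers ch)" for u
  proof -
    obtain j where j: "j < k" "u = 1 / of_nat (Suc j) # tl (vectors ch ! 0)"
      using u by (auto simp: fillers_def)
    have "val_len (encode_tuple (tl (vectors ch ! 0))) < val_len (encode_tuple (vectors ch ! 0))"
      using v0_ne val_len_pos by (cases "vectors ch ! 0") (auto simp: encode_tuple_def less_eq_Suc_le)
    then show ?thesis using j filler_len[OF j(1)] vec_len[OF v0] by (simp add: encode_tuple_def)
  qed
  define J where "J vs out0 d s' \<longleftrightarrow> (\<exists>us. d = map encode_tuple us \<and> set us \<subseteq> set vs \<and>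
     s' v_out = List (map encode_tuple (fold collect us out0)) \<and>
     s' v_count = Num (of_nat (length (fold collect us out0))))" for vs out0 d and s' :: state
  have loop: "wp Z \<Omega> (foreach v_vector v_pool e (collect_prog k)) Q' s"
    if e: "eval e s = List (map encode_tuple vs)" "val_len (List (map encode_tuple vs)) \<le> Z"
      and vs: "\<And>u. u \<in> set (vs @ out0) \<Longrightarrow> val_len (encode_tuple u) \<le> 2 * B"
      and out0: "distinct out0" "length out0 \<le> k"
      and s: "s v_out = List (map encode_tuple out0)" "s v_count = Num (of_nat (length out0))"
      and Q': "\<And>s'. s' v_out = List (map encode_tuple (fold collect vs out0)) \<Longrightarrow>
        s' v_count = Num (of_nat (length (fold collect vs out0))) \<Longrightarrow> s' v_sol = s v_sol \<Longrightarrow> Q' s'"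
    for e vs out0 Q' s
  proof (rule wp_foreach[OF e, where J = "J vs out0"], goal_cases)
    case 3
    show ?case unfolding J_def using s by (intro exI[of _ "[]"]) auto
  next
    case (4 d v r s')
    obtain us where us: "d = map encode_tuple us" "set us \<subseteq> set vs"
      "s' v_out = List (map encode_tuple (fold collect us out0))"
      "s' v_count = Num (of_nat (length (fold collect us out0)))" using 4(2) unfolding J_def by blast
    have "v \<in> set (map encode_tuple vs)" using 4(1) by simp
    then obtain u where u: "v = encode_tuple u" "u \<in> set vs" by auto
    note fc = fold_collect[OF out0, of us]
    show ?case
    proof (rule wp_collect[of _ u "fold collect us out0"], goal_cases)
      case (4 x)
      then show ?case using fc us(2) u(2) vs by auto
    next
      case (6 s'')
      then show ?case unfolding J_def using us(1,2) u
        by (intro exI[of _ "us @ [u]"]) auto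
    qed (use us u fc in auto)
  next
    case (5 s')
    then obtain us where us: "map encode_tuple vs = map encode_tuple us"
      "s' v_out = List (map encode_tuple (fold collect us out0))"
      "s' v_count = Num (of_nat (length (fold collect us out0)))" unfolding J_def by blast
    then have "vs = us" using inj_encode_tuple by (simp add: inj_map_eq_map)
    then show ?case using us 5(3)[of v_sol] by (intro Q') auto
  qed auto
  let ?o = "fold collect (vectors ch) []"
  have o: "distinct ?o" "length ?o \<le> k" "set ?o \<subseteq> set (vectors ch)"
    using fold_collect[of "[]" "vectors ch"] by auto
  show ?thesis unfolding output_prog_def seqs_simps
  proof (intro wp_Seq wp_Assign, goal_cases)
    case 3
    show ?case
    proof (rule loop[of _ _ "vectors ch" "[]"], goal_cases)
      case 1
      show ?case using sol encode_choices_vectors enc by simp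
    next
      case 2
      have "val_len (encode_choices k ch) \<le> val_len (entry ch)" by (simp add: entry_def)
      also have "\<dots> \<le> B" using adm by (intro entry_len_B) auto
      finally show ?case using B_le_Z unfolding encode_choices_vectors enc by simp
    next
      case (3 u)
      then show ?case using vec_len[of u] by simp
    next
      case (8 s')
      have sol': "s' v_sol = List (map encode_tuple (vectors ch))"
        using 8(3) sol encode_choices_vectors enc by simp
      have f1: "eval (fillers_expr k) s' = List (map encode_tuple (fillers ch))"
        using sol' k by (auto simp: fillers_expr_def eval_list_expr fillers_def encode_tuple_def
            items_eval_nth_expr map_tl)
      have "val_len (List (map encode_tuple (fillers ch))) \<le> 1 + length (map encode_tuple (fillers ch)) * (2 * B)"
        using fill_len by (intro val_len_List) auto
      then have f2: "val_len (List (map encode_tuple (fillers ch))) \<le> Z"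
        using output_len by simp
      show ?case
      proof (rule wp_Seq, rule loop[OF f1 f2, of ?o], goal_cases)
        case (1 u)
        then show ?case using fill_len[of u] vec_len[of u] o(3) by fastforce
      next
        case (6 s'')
        then have out: "s'' v_out = encode_vectors (output_of ch)" by (simp add: enc output_of_def)
        show ?case
        proof (rule wp_small, rule wp_Seq, rule wp_Assign, goal_cases)
          case 1
          then show ?case by (simp add: small_def)
        next
          case 2
          show ?case by (rule wp_Skip, rule Q) (simp add: out)
        qed
      qed (use 8 o in auto)
    qed auto
  qed (use B_ge B_le_Z in auto)
qed

theorem wp_main:
  assumes "chains n \<noteq> {}"
    and "s v_io = List [List (map Num cs), Num (of_nat k), Num al]" "s v_G = Num (of_nat G)"
  shows "wp Z \<Omega> (main_prog k) (\<lambda>s'. \<exists>ch\<in>chains n.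
    (\<forall>ch'\<in>chains n. value_of (key_of ch) \<le> value_of (key_of ch')) \<and>
    s' v_io = encode_vectors (output_of ch)) s"
  unfolding main_prog_def seqs_simps
proof (rule wp_Seq, rule wp_setup[OF assms(2,3)], goal_cases)
  case (1 s1)
  note su = 1
  show ?case
  proof (rule wp_Seq, rule wp_grid[OF 1(5,6)], goal_cases)
    case (1 s2)
    note grid = 1
    have fr2: "s2 x = s1 x" if "x \<notin> {v_y, v_grid}" for x by (rule 1(2)[OF that])
    show ?case
    proof (rule wp_Seq, rule wp_tuples[of s2, OF 1(1)], goal_cases)
      case (1 s3 tps)
      have fr3: "s3 x = s2 x" if "x \<notin> {v_prod, v_lefts, v_left, v_rights, v_right, v_tuples}" for x
        by (rule 1(4)[OF that])
      have "s3 v_revcs = List (map Num (rev cs))" "s3 v_C = Num scale"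
        "s3 v_i = Num (of_nat n)" "s3 v_delta = Num dlt" "s3 v_grid = List (map Num grid)"
        using fr3 fr2 su(1-4) grid(1) by simp_all
      note dp_ready = this
      show ?case
      proof (rule wp_Seq, rule wp_dp[of s3, OF dp_ready 1(1-3)], goal_cases)
        case (1 s4 chs)
        note dp = 1
        then have "chs \<noteq> []" using assms(1) by auto
        show ?case
        proof (rule wp_Seq, rule wp_select[of s4 chs, OF 1(1,2) \<open>chs \<noteq> []\<close>], goal_cases)
          case (1 s5 ch)
          have chn: "ch \<in> chains n" using dp(2) 1(2) by (rule subsetD)
          have best: "value_of (key_of ch) \<le> value_of (key_of ch')" if "ch' \<in> chains n" for ch'
          proof -
            from subsetD[OF dp(3) imageI[OF that]]
            obtain ch2 where "ch2 \<in> set chs" "keyval ch' = keyval ch2" by auto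
            then show ?thesis using 1(3)[of ch2] value_of_cong[of ch' ch2] by simp
          qed
          show ?case
            by (rule wp_Seq, rule wp_output[of ch s5, OF chn 1(1)], rule wp_Skip)
              (use chn best in \<open>intro bexI[of _ ch] conjI ballI; simp\<close>)
        qed
      qed
    qed
  qed
qed

end

section \<open>Bit masks of finite predicates\<close>

definition mask_of :: "nat \<Rightarrow> (nat \<Rightarrow> bool) \<Rightarrow> nat" where
  "mask_of k P = horner_sum of_bool 2 (map P [0..<k])"

lemma bit_mask_of: "bit (mask_of k P) j \<longleftrightarrow> j < k \<and> P j"
  by (auto simp: mask_of_def bit_horner_sum_bit_iff)

lemma bit_imp_less: "(a :: nat) < 2 ^ k \<Longrightarrow> bit a j \<Longrightarrow> j < k"
  by (metis bit_take_bit_iff take_bit_nat_eq_self_iff)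

lemma less_exp_if_bits: "(\<And>j. bit (a :: nat) j \<Longrightarrow> j < k) \<Longrightarrow> a < 2 ^ k"
  by (metis bit_take_bit_iff bit_eqI take_bit_nat_eq_self_iff)

lemma mask_of_less: "mask_of k P < 2 ^ k"
  by (rule less_exp_if_bits) (simp add: bit_mask_of)

lemma and_less: "(a :: nat) < 2 ^ k \<Longrightarrow> and a b < 2 ^ k"
  by (rule less_exp_if_bits) (auto simp: bit_and_iff intro: bit_imp_less)

lemma mask_of_eq_iff: "a < 2 ^ k \<Longrightarrow> mask_of k P = a \<longleftrightarrow> (\<forall>j<k. P j \<longleftrightarrow> bit a j)"
  by (metis bit_mask_of bit_eqI bit_imp_less)

lemma bit_full: "bit (2 ^ k - 1 :: nat) j \<longleftrightarrow> j < k"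
  by (metis bit_mask_iff mask_eq_exp_minus_1 possible_bit_def bot_nat_0.not_eq_extremum possible_bit_nat)

lemma sum_over_and:
  fixes f :: "nat \<Rightarrow> real"
  shows "(\<Sum>t'<2 ^ k. f t' * (\<Sum>t<2 ^ k. \<Sum>a<2 ^ k. if and t a = t' then h t a else 0)) =
    (\<Sum>t<2 ^ k. \<Sum>a<2 ^ k. f (and t a) * h t a)"
proof -
  have "(\<Sum>t'<2 ^ k. f t' * (\<Sum>t<2 ^ k. \<Sum>a<2 ^ k. if and t a = t' then h t a else 0)) =
    (\<Sum>t'<2 ^ k. \<Sum>t<2 ^ k. \<Sum>a<2 ^ k. if and t a = t' then f t' * h t a else 0)"
    by (simp add: sum_distrib_left if_distrib cong: if_cong)
  also have "\<dots> = (\<Sum>t<2 ^ k. \<Sum>t'<2 ^ k. \<Sum>a<2 ^ k. if and t a = t' then f t' * h t a else 0)"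
    by (rule sum.swap)
  also have "\<dots> = (\<Sum>t<2 ^ k. \<Sum>a<2 ^ k. \<Sum>t'<2 ^ k. if and t a = t' then f t' * h t a else 0)"
    by (intro sum.cong refl sum.swap)
  also have "\<dots> = (\<Sum>t<2 ^ k. \<Sum>a<2 ^ k. f (and t a) * h t a)"
    by (intro sum.cong refl) (simp add: sum.delta' and_less)
  finally show ?thesis .
qed

lemma foldr_min_le: "j \<in> set js \<Longrightarrow> foldr (\<lambda>j. min (f j)) js (c :: 'a :: linorder) \<le> f j"
  by (induction js) (auto simp: min_le_iff_disj)

lemma foldr_min_le_start: "foldr (\<lambda>j. min (f j)) js (c :: 'a :: linorder) \<le> c"
  by (induction js) (auto simp: min_le_iff_disj)

lemma foldr_min_cases:
  "foldr (\<lambda>j. min (f j)) js (c :: 'a :: linorder) = c \<or> (\<exists>j\<in>set js. foldr (\<lambda>j. min (f j)) js c = f j)"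
  by (induction js) (auto simp: min_def)

lemma le_foldr_min: "(\<And>j. j \<in> set js \<Longrightarrow> x \<le> f j) \<Longrightarrow> x \<le> c \<Longrightarrow> x \<le> foldr (\<lambda>j. min (f j)) js (c :: 'a :: linorder)"
  by (induction js) auto

lemma le_foldr_max: "j \<in> set js \<Longrightarrow> f j \<le> foldr (\<lambda>j. max (f j)) js (c :: 'a :: linorder)"
  by (induction js) (auto simp: le_max_iff_disj)

lemma foldr_max_less: 
  "foldr (\<lambda>j. max (f j)) js (c :: 'a :: linorder) < x \<longleftrightarrow> c < x \<and> (\<forall>j\<in>set js. f j < x)"
  by (induction js) auto

lemma le_foldr_min_iff: 
  "x \<le> foldr (\<lambda>j. min (f j)) js (c :: 'a :: linorder) \<longleftrightarrow> x \<le> c \<and> (\<forall>j\<in>set js. x \<le> f j)"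
  by (induction js) auto

lemma of_rat_min: "of_rat (min a b) = min (of_rat a :: real) (of_rat b)"
  and of_rat_max: "of_rat (max a b) = max (of_rat a :: real) (of_rat b)"
  by (auto simp: min_def max_def of_rat_less_eq)

lemma of_rat_foldr_min: "of_rat (foldr (\<lambda>j. min (f j)) js c) = foldr (\<lambda>j. min (of_rat (f j) :: real)) js (of_rat c)"
  and of_rat_foldr_max: "of_rat (foldr (\<lambda>j. max (f j)) js c) = foldr (\<lambda>j. max (of_rat (f j) :: real)) js (of_rat c)"
  by (induction js) (auto simp: of_rat_min of_rat_max)

lemma power_one_plus_le:
  fixes x :: real
  assumes "0 \<le> x" "2 * (of_nat m * x) \<le> 1"
  shows "(1 + x) ^ m \<le> 1 + 2 * (of_nat m * x)"
proof (cases "m = 0")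
  case False
  let ?y = "of_nat m * x"
  have "1 * x \<le> of_nat m * x" using False assms(1) by (intro mult_right_mono) auto
  then have x1: "x \<le> 1" using assms(2) assms(1) by linarith
  have "1 + of_nat m * (- x) \<le> (1 + (- x)) ^ m" by (rule Bernoulli_inequality) (use x1 in simp)
  then have "(1 + x) ^ m * (1 - ?y) \<le> (1 + x) ^ m * (1 - x) ^ m"
    using assms(1) by (intro mult_left_mono) auto
  also have "\<dots> = (1 - x ^ 2) ^ m"
    by (simp add: power_mult_distrib[symmetric] power2_eq_square algebra_simps)
  also have "\<dots> \<le> 1" using x1 assms(1) by (intro power_le_one) (auto simp: power_le_one)
  finally have 1: "(1 + x) ^ m * (1 - ?y) \<le> 1" .
  have "?y * (1 - 2 * ?y) \<ge> 0" using assms by (intro mult_nonneg_nonneg) auto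
  then have "1 \<le> (1 + 2 * ?y) * (1 - ?y)" by (simp add: algebra_simps)
  then have "(1 + x) ^ m * (1 - ?y) \<le> (1 + 2 * ?y) * (1 - ?y)" using 1 by linarith
  moreover have "0 < 1 - ?y" using assms by linarith
  ultimately show ?thesis by (simp add: mult_le_cancel_right)
qed simp

section \<open>Accuracy of the rounded dynamic program\<close>

locale pareto_measures = pareto_dp +
  fixes \<nu> :: "nat \<Rightarrow> real measure"
  assumes unit_prob: "\<And>i. unit_prob (\<nu> i)"
    and answer_ge: "\<And>i a b \<delta>. i < n \<Longrightarrow> valid_query a b \<delta> \<Longrightarrow>
      inverse (1 + of_rat \<delta>) * measure (\<nu> i) ({of_rat a<..of_rat b} \<inter> {0..1}) \<le> of_rat (answer (\<Omega> ! i) a b \<delta>)"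
    and answer_le: "\<And>i a b \<delta>. i < n \<Longrightarrow> valid_query a b \<delta> \<Longrightarrow>
      of_rat (answer (\<Omega> ! i) a b \<delta>) \<le> (1 + of_rat \<delta>) * measure (\<nu> i) ({of_rat a<..of_rat b} \<inter> {0..1})"
    and mean_ge: "\<And>i. i < n \<Longrightarrow> of_rat al \<le> (\<integral>x. x \<partial>\<nu> i)"
begin

abbreviation (input) D :: real where "D \<equiv> 1 + of_rat dlt"

definition cell :: "rat list \<Rightarrow> nat \<Rightarrow> real set" where
  "cell g a = {of_rat (lo g a)<..of_rat (hi g a)} \<inter> {0..1}"

lemma prob_space_nu: "prob_space (\<nu> i)" and space_nu: "space (\<nu> i) = {0..1}"
  and sets_nu: "sets (\<nu> i) = sets (restrict_space borel {0..1})"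
  using unit_prob[of i] sets_eq_imp_space_eq[of "\<nu> i" "restrict_space borel {0..1}"]
  by (auto simp: unit_prob_def space_restrict_space)

lemma cell_sets: "cell g a \<in> sets (\<nu> i)"
  unfolding sets_nu cell_def by (subst sets_restrict_space_iff) auto

lemma mem_cell_iff:
  assumes "y \<in> {0..1}" "a < 2 ^ k"
  shows "y \<in> cell g a \<longleftrightarrow> mask_of k (\<lambda>j. y \<le> of_rat (g ! j)) = a"
proof -
  have "y \<in> cell g a \<longleftrightarrow> (\<forall>j<k. \<not> bit a j \<longrightarrow> of_rat (g ! j) < y) \<and> (\<forall>j<k. bit a j \<longrightarrow> y \<le> of_rat (g ! j))"
    using assms(1) unfolding cell_def lo_def hi_def of_rat_foldr_max of_rat_foldr_min
    by (auto simp: foldr_max_less le_foldr_min_iff)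
  also have "\<dots> \<longleftrightarrow> (\<forall>j<k. y \<le> of_rat (g ! j) \<longleftrightarrow> bit a j)" by (meson not_le)
  finally show ?thesis using mask_of_eq_iff[OF assms(2)] by simp
qed

lemma nn_integral_mask:
  fixes f :: "nat \<Rightarrow> real"
  assumes "\<And>a. 0 \<le> f a"
  shows "(\<integral>\<^sup>+y. ennreal (f (mask_of k (\<lambda>j. y \<le> of_rat (g ! j)))) \<partial>\<nu> i) =
    ennreal (\<Sum>a<2 ^ k. f a * measure (\<nu> i) (cell g a))"
proof -
  interpret prob_space "\<nu> i" by (rule prob_space_nu)
  have "(\<integral>\<^sup>+y. ennreal (f (mask_of k (\<lambda>j. y \<le> of_rat (g ! j)))) \<partial>\<nu> i) =
    (\<integral>\<^sup>+y. (\<Sum>a<2 ^ k. ennreal (f a) * indicator (cell g a) y) \<partial>\<nu> i)"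
  proof (rule nn_integral_cong)
    fix y assume "y \<in> space (\<nu> i)"
    then have y: "y \<in> {0..1}" by (simp add: space_nu)
    have "(\<Sum>a<2 ^ k. ennreal (f a) * indicator (cell g a) y) =
      (\<Sum>a<2 ^ k. if a = mask_of k (\<lambda>j. y \<le> of_rat (g ! j)) then ennreal (f a) else 0)"
      by (intro sum.cong refl) (auto simp: indicator_def mem_cell_iff[OF y])
    also have "\<dots> = ennreal (f (mask_of k (\<lambda>j. y \<le> of_rat (g ! j))))"
      by (simp add: sum.delta mask_of_less)
    finally show "ennreal (f (mask_of k (\<lambda>j. y \<le> of_rat (g ! j)))) = (\<Sum>a<2 ^ k. ennreal (f a) * indicator (cell g a) y)" ..
  qed
  also have "\<dots> = (\<Sum>a<2 ^ k. ennreal (f a) * emeasure (\<nu> i) (cell g a))"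
    using cell_sets by (subst nn_integral_sum) (auto simp: nn_integral_cmult_indicator)
  also have "\<dots> = (\<Sum>a<2 ^ k. ennreal (f a * measure (\<nu> i) (cell g a)))"
    using assms by (intro sum.cong refl) (simp add: emeasure_eq_measure ennreal_mult)
  also have "\<dots> = ennreal (\<Sum>a<2 ^ k. f a * measure (\<nu> i) (cell g a))"
    using assms by (intro sum_ennreal) simp
  finally show ?thesis .
qed

lemma sum_cells: "(\<Sum>a<2 ^ k. measure (\<nu> i) (cell g a)) = 1"
proof -
  interpret prob_space "\<nu> i" by (rule prob_space_nu)
  have "ennreal (\<Sum>a<2 ^ k. measure (\<nu> i) (cell g a)) = 1"
    using nn_integral_mask[where f = "\<lambda>_. 1" and g = g and i = i] by (simp add: emeasure_space_1)
  then show ?thesis by (simp add: sum_nonneg)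
qed

lemma weight_le: "g \<in> tuples \<Longrightarrow> i < n \<Longrightarrow> of_rat (weight i g a) \<le> measure (\<nu> i) (cell g a)"
  and weight_ge: "g \<in> tuples \<Longrightarrow> i < n \<Longrightarrow>
    measure (\<nu> i) (cell g a) \<le> D ^ 2 * of_rat (weight i g a)"
proof -
  assume g: "g \<in> tuples" and i: "i < n"
  have d: "(0 :: real) < 1 + of_rat dlt" using dlt by (simp add: add_pos_pos)
  show "of_rat (weight i g a) \<le> measure (\<nu> i) (cell g a)"
  proof (cases "lo g a < hi g a")
    case True
    then show ?thesis using answer_le[OF i valid_query_lo_hi[OF g True]] d
      by (simp add: weight_def cell_def of_rat_divide of_rat_add pos_divide_le_eq mult.commute)
  qed (simp add: weight_def)
  show "measure (\<nu> i) (cell g a) \<le> D ^ 2 * of_rat (weight i g a)"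
  proof (cases "lo g a < hi g a")
    case True
    let ?a = "of_rat (answer (\<Omega> ! i) (lo g a) (hi g a) dlt) :: real"
    have "inverse D * measure (\<nu> i) (cell g a) \<le> ?a"
      using answer_ge[OF i valid_query_lo_hi[OF g True]] by (simp add: cell_def)
    then have "D * (inverse D * measure (\<nu> i) (cell g a)) \<le> D * ?a"
      using d by (intro mult_left_mono) auto
    also have "D * (inverse D * measure (\<nu> i) (cell g a)) = measure (\<nu> i) (cell g a)"
      using d by simp
    also have "D * ?a = D ^ 2 * (?a / D)" using d by (simp add: power2_eq_square)
    finally show ?thesis using True by (simp add: weight_def of_rat_divide of_rat_add)
  next
    case False
    then have "cell g a = {}" by (auto simp: cell_def not_less of_rat_less_eq[symmetric, where 'a = real] simp del: of_rat_less_eq)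
    then show ?thesis using False by (simp add: weight_def)
  qed
qed

text \<open>\<open>expect ch f\<close> is the mean of \<open>f\<close> at the set of vectors that cover a random point in the last
  \<open>length ch\<close> coordinates.\<close>
primrec expect :: "rat list list \<Rightarrow> (nat \<Rightarrow> real) \<Rightarrow> real" where
  "expect [] f = f (2 ^ k - 1)"
| "expect (g # ch) f = expect ch (\<lambda>t. \<Sum>a<2 ^ k. f (and t a) *
     measure (\<nu> (n - Suc (length ch))) (cell g a))"

primrec cost_share :: "rat list list \<Rightarrow> nat \<Rightarrow> real" where
  "cost_share [] j = 0"
| "cost_share (g # ch) j = cost_share ch j + of_rat (cs ! (n - Suc (length ch)) / scale * g ! j)"

lemma expect_mono: "(\<And>t. t < 2 ^ k \<Longrightarrow> f t \<le> f' t) \<Longrightarrow> expect ch f \<le> expect ch f'"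
proof (induction ch arbitrary: f f')
  case (Cons g ch)
  show ?case unfolding expect.simps
    by (intro Cons.IH sum_mono mult_right_mono Cons.prems and_less measure_nonneg)
qed simp

lemma expect_affine: "expect ch (\<lambda>t. c * f t + d) = c * expect ch f + d"
proof (induction ch arbitrary: f)
  case (Cons g ch)
  have "expect (g # ch) (\<lambda>t. c * f t + d) = expect ch (\<lambda>t. c * (\<Sum>a<2 ^ k. f (and t a) *
     measure (\<nu> (n - Suc (length ch))) (cell g a)) + d)"
    by (simp add: algebra_simps sum.distrib sum_distrib_left[symmetric] sum_cells)
  then show ?case using Cons by simp
qed simp

lemma expect_bounds:
  assumes "\<And>t. t < 2 ^ k \<Longrightarrow> 0 \<le> f t" "\<And>t. t < 2 ^ k \<Longrightarrow> f t \<le> 1"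
  shows "0 \<le> expect ch f" "expect ch f \<le> 1"
  using expect_mono[of "\<lambda>_. 0" f ch] expect_mono[of f "\<lambda>_. 1" ch] assms
    expect_affine[of ch 0 f 0] expect_affine[of ch 0 f 1] by auto

lemma rd_real:
  assumes "0 \<le> x" "x \<le> 1"
  shows "(of_rat (rd x) :: real) \<le> of_rat x" "of_rat x \<le> D * of_rat (rd x) + (of_rat thr :: real)"
proof -
  show "(of_rat (rd x) :: real) \<le> of_rat x" using rd_cases[OF assms] by (simp add: of_rat_less_eq)
  have "0 \<le> rd x" using rd_mem[of x] grid_bounds[of "rd x"] by auto
  moreover have "1 / ratio = 1 + dlt" using prec_ge by (simp add: ratio_def dlt_def field_simps)
  then have "rd x / ratio = (1 + dlt) * rd x" by (metis mult.commute times_divide_eq_right mult.right_neutral)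
  ultimately have "x \<le> (1 + dlt) * rd x + thr"
    using rd_cases(2)[OF assms] thr_pos by auto
  then have "(of_rat x :: real) \<le> of_rat ((1 + dlt) * rd x + thr)" by (simp only: of_rat_less_eq)
  then show "of_rat x \<le> D * of_rat (rd x) + (of_rat thr :: real)"
    by (simp add: of_rat_add of_rat_mult)
qed

lemma key_nonneg: "0 \<le> key_of ch d"
  using key_of_mem[of ch d] grid_bounds[of "key_of ch d"] by auto

lemma share_bounds:
  assumes "i < n"
  shows "0 \<le> cs ! i / scale" "cs ! i / scale \<le> 1 / of_nat n"
proof -
  have m: "cs ! i \<le> max_cost" "0 \<le> max_cost" using le_max_cost max_cost_nonneg assms by auto
  have c: "0 \<le> cs ! i" using costs assms by auto
  then show "0 \<le> cs ! i / scale" using m(2) by (simp add: scale_def)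
  show "cs ! i / scale \<le> 1 / of_nat n"
  proof (cases "max_cost = 0")
    case False
    have "cs ! i / max_cost \<le> 1" using m False by (simp add: divide_le_eq)
    then have "cs ! i / max_cost / of_nat n \<le> 1 / of_nat n"
      by (intro divide_right_mono) auto
    then show ?thesis by (simp add: scale_def mult.commute)
  qed (simp add: scale_def)
qed

lemma admissible_length:
  assumes "g # ch \<in> chains m" "m \<le> n"
  shows "ch \<in> chains (length ch)" "n - Suc (length ch) < n" "m = Suc (length ch)" "g \<in> tuples"
  using assms cs by (auto simp: chains_def)

lemma cost_share_le:
  assumes "ch \<in> chains m" "m \<le> n" "j < k"
  shows "cost_share ch j \<le> of_nat m / of_nat n \<and> 0 \<le> cost_share ch j"
  using assms
proof (induction ch arbitrary: m)
  case (Cons g ch)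
  note adm = admissible_length[OF Cons.prems(1,2)]
  let ?i = "n - Suc (length ch)"
  have g: "0 \<le> g ! j" "g ! j \<le> 1" using grid_bounds[OF tuples_nth[OF adm(4) Cons.prems(3)]] by auto
  have "cs ! ?i / scale * g ! j \<le> 1 / of_nat n * 1"
    using share_bounds[OF adm(2)] g by (intro mult_mono) auto
  then have "(of_rat (cs ! ?i / scale * g ! j) :: real) \<le> of_rat (1 / of_nat n * 1)" by (simp only: of_rat_less_eq)
  then have 1: "(of_rat (cs ! ?i / scale * g ! j) :: real) \<le> 1 / of_nat n" by (simp add: of_rat_divide)
  have "0 \<le> cs ! ?i / scale * g ! j" using share_bounds[OF adm(2)] g by (intro mult_nonneg_nonneg) auto
  then have 2: "(0 :: real) \<le> of_rat (cs ! ?i / scale * g ! j)" by simp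
  have IH: "cost_share ch j \<le> of_nat (length ch) / of_nat n" "0 \<le> cost_share ch j"
    using Cons.IH[OF adm(1)] adm(2,3) Cons.prems(2,3) by auto
  show ?case using IH 1 2 adm(3) by (simp add: add_divide_distrib)
qed (auto simp: chains_def)

lemma cost_share_key:
  assumes "ch \<in> chains m" "m \<le> n" "j < k"
  shows "of_rat (key_of ch j) \<le> cost_share ch j \<and> cost_share ch j \<le>
    D ^ m * of_rat (key_of ch j) + of_nat m * D ^ m * of_rat thr"
  using assms
proof (induction ch arbitrary: m)
  case Nil
  have "(1 :: nat) \<le> 2 ^ k" by simp
  with Nil have "j \<noteq> k + (2 ^ k - 1)" by linarith
  with Nil show ?case by (simp add: initial_key_def chains_def del: One_nat_def)
next
  case (Cons g ch)
  note adm = admissible_length[OF Cons.prems(1,2)]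
  let ?i = "n - Suc (length ch)" and ?m = "length ch"
  let ?c = "cs ! ?i / scale * g ! j" and ?q = "key_of ch j" and ?r = "key_of (g # ch) j"
  have IH: "of_rat ?q \<le> cost_share ch j"
    "cost_share ch j \<le> D ^ ?m * of_rat ?q + of_nat ?m * D ^ ?m * of_rat thr"
    using Cons.IH[OF adm(1)] adm(2,3) Cons.prems(2,3) by auto
  have g: "0 \<le> g ! j" using grid_bounds[OF tuples_nth[OF adm(4) Cons.prems(3)]] by auto
  have c: "0 \<le> ?c" using share_bounds[OF adm(2)] g by (intro mult_nonneg_nonneg) auto
  have D: "1 \<le> D" using dlt by simp
  have r: "?r = rd (?q + ?c)" using Cons.prems(3) by (simp add: next_key_def)
  have "(of_rat (?q + ?c) :: real) \<le> cost_share (g # ch) j" using IH(1) by (simp add: of_rat_add)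
  also have "\<dots> \<le> 1"
    using conjunct1[OF cost_share_le[OF Cons.prems]] Cons.prems(2) cs by (auto intro: order_trans)
  finally have le1: "?q + ?c \<le> 1" by simp
  have ge0: "0 \<le> ?q + ?c" using key_nonneg c by simp
  note rr = rd_real[OF ge0 le1, folded r]
  have "of_rat ?r \<le> cost_share (g # ch) j"
    using rr(1) \<open>of_rat (?q + ?c) \<le> cost_share (g # ch) j\<close> by simp
  moreover have "cost_share (g # ch) j \<le> D ^ Suc ?m * of_rat ?r + of_nat (Suc ?m) * D ^ Suc ?m * of_rat thr"
  proof -
    have "cost_share (g # ch) j \<le> D ^ ?m * of_rat ?q + of_nat ?m * D ^ ?m * of_rat thr + 1 * of_rat ?c"
      using IH(2) by simp
    also have "\<dots> \<le> D ^ ?m * of_rat ?q + of_nat ?m * D ^ ?m * of_rat thr + D ^ ?m * of_rat ?c"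
      using c D by (intro add_left_mono mult_right_mono one_le_power) auto
    also have "\<dots> = D ^ ?m * of_rat (?q + ?c) + of_nat ?m * D ^ ?m * of_rat thr"
      by (simp add: of_rat_add algebra_simps)
    also have "\<dots> \<le> D ^ ?m * (D * of_rat ?r + of_rat thr) + of_nat ?m * D ^ ?m * of_rat thr"
      using rr(2) D by (intro add_right_mono mult_left_mono) auto
    also have "\<dots> = D ^ Suc ?m * of_rat ?r + of_nat (Suc ?m) * D ^ ?m * of_rat thr"
      by (simp add: algebra_simps)
    also have "\<dots> \<le> D ^ Suc ?m * of_rat ?r + of_nat (Suc ?m) * D ^ Suc ?m * of_rat thr"
      using D thr_pos by (intro add_left_mono mult_right_mono mult_left_mono power_increasing) auto
    finally show ?thesis .
  qed
  ultimately show ?case using adm(3) by simp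
qed

abbreviation mass :: "rat list list \<Rightarrow> nat \<Rightarrow> real" where
  "mass ch t \<equiv> of_rat (key_of ch (k + t))"

lemma mass_Cons:
  assumes "t' < 2 ^ k"
  shows "key_of (g # ch) (k + t') = rd (\<Sum>t<2 ^ k. \<Sum>a<2 ^ k.
     if and t a = t' then key_of ch (k + t) * weight (n - Suc (length ch)) g a else 0)"
  by (simp add: next_key_def)

text \<open>The rounded masses are compared with the exact distribution through arbitrary test functions
  \<open>f\<close>. In this form the error is not multiplied by the number of masks in every step.\<close>
lemma mass_expect:
  assumes "ch \<in> chains m" "m \<le> n"
  shows "(\<forall>t<2 ^ k. 0 \<le> f t) \<Longrightarrow> (\<Sum>t<2 ^ k. f t * mass ch t) \<le> expect ch f \<and>
    ((\<forall>t<2 ^ k. f t \<le> 1) \<longrightarrow> expect ch f \<le> D ^ (3 * m) * (\<Sum>t<2 ^ k. f t * mass ch t) +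
      of_nat m * D ^ (3 * m) * 2 ^ k * of_rat thr)"
  using assms
proof (induction ch arbitrary: m f)
  case Nil
  have "(\<Sum>t<2 ^ k. f t * mass [] t) = (\<Sum>t<2 ^ k. if t = 2 ^ k - 1 then f t else 0)"
    by (intro sum.cong refl) (auto simp: initial_key_def simp del: One_nat_def)
  also have "\<dots> = f (2 ^ k - 1)" by (simp add: sum.delta)
  finally show ?case using Nil by (simp add: chains_def)
next
  case (Cons g ch)
  note adm = admissible_length[OF Cons.prems(2,3)]
  let ?i = "n - Suc (length ch)" and ?m = "length ch"
  let ?w = "\<lambda>a. measure (\<nu> ?i) (cell g a)" and ?wh = "\<lambda>a. weight ?i g a"
  define S where "S t' = (\<Sum>t<2 ^ k. \<Sum>a<2 ^ k. if and t a = t' then key_of ch (k + t) * ?wh a else 0)" for t'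
  have D: "1 \<le> D" using dlt by simp
  have wh0: "0 \<le> ?wh a" for a by (rule weight_nonneg[OF adm(4,2)])
  have S_real: "of_rat (S t') = (\<Sum>t<2 ^ k. \<Sum>a<2 ^ k. if and t a = t' then mass ch t * of_rat (?wh a) else 0)" for t'
    by (simp add: S_def of_rat_sum of_rat_mult if_distrib cong: if_cong)
  have S0: "0 \<le> S t'" for t'
    unfolding S_def using key_nonneg wh0 by (intro sum_nonneg) auto
  have len: "?m \<le> n" using adm(3) Cons.prems(3) by simp
  have push: "(\<Sum>t'<2 ^ k. f t' * of_rat (S t')) =
      (\<Sum>t<2 ^ k. (\<Sum>a<2 ^ k. f (and t a) * of_rat (?wh a)) * mass ch t)" for f :: "nat \<Rightarrow> real"
    unfolding S_real sum_over_and sum_distrib_right by (intro sum.cong refl) (simp only: mult_ac)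
  have low: "(\<Sum>t'<2 ^ k. f t' * of_rat (S t')) \<le> expect (g # ch) f" if f: "\<forall>t<2 ^ k. 0 \<le> f t" for f
  proof -
    have "(\<Sum>t'<2 ^ k. f t' * of_rat (S t')) \<le> (\<Sum>t<2 ^ k. (\<Sum>a<2 ^ k. f (and t a) * ?w a) * mass ch t)"
      unfolding push using f and_less weight_le[OF adm(4,2)] key_nonneg
      by (intro sum_mono mult_right_mono mult_left_mono) auto
    also have "\<dots> \<le> expect (g # ch) f" unfolding expect.simps
    proof (rule conjunct1[OF Cons.IH[OF _ adm(1) len]])
      show "\<forall>t<2 ^ k. 0 \<le> (\<Sum>a<2 ^ k. f (and t a) * ?w a)"
        using f and_less by (auto intro!: sum_nonneg mult_nonneg_nonneg)
    qed
    finally show ?thesis .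
  qed
  have S1: "S t' \<le> 1" if t': "t' < 2 ^ k" for t'
  proof -
    let ?f = "\<lambda>t. if t = t' then 1 else 0 :: real"
    have "(of_rat (S t') :: real) = (\<Sum>t<2 ^ k. ?f t * of_rat (S t))"
      using t' by (simp add: if_distrib[of "\<lambda>x. x * _"] sum.delta cong: if_cong)
    also have "\<dots> \<le> expect (g # ch) ?f" by (rule low) auto
    also have "\<dots> \<le> 1" by (rule expect_bounds(2)) auto
    finally show ?thesis by simp
  qed
  have mass: "mass (g # ch) t' \<le> of_rat (S t')"
    "of_rat (S t') \<le> D * mass (g # ch) t' + of_rat thr" if "t' < 2 ^ k" for t'
    unfolding mass_Cons[OF that] S_def[symmetric] by (rule rd_real[OF S0 S1[OF that]])+
  show ?case
  proof (intro conjI impI)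
    have "(\<Sum>t<2 ^ k. f t * mass (g # ch) t) \<le> (\<Sum>t<2 ^ k. f t * of_rat (S t))"
      using mass(1) Cons.prems(1) by (intro sum_mono mult_left_mono) auto
    also have "\<dots> \<le> expect (g # ch) f" by (rule low[OF Cons.prems(1)])
    finally show "(\<Sum>t<2 ^ k. f t * mass (g # ch) t) \<le> expect (g # ch) f" .
  next
    assume f1: "\<forall>t<2 ^ k. f t \<le> 1"
    let ?F = "\<lambda>t. \<Sum>a<2 ^ k. f (and t a) * ?w a"
    have F0: "\<forall>t<2 ^ k. 0 \<le> ?F t" using Cons.prems(1) and_less
      by (auto intro!: sum_nonneg mult_nonneg_nonneg)
    have F1: "\<forall>t<2 ^ k. ?F t \<le> 1"
    proof (intro allI impI)
      fix t :: nat assume "t < 2 ^ k"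
      then have "?F t \<le> (\<Sum>a<2 ^ k. 1 * ?w a)" using f1 and_less by (intro sum_mono mult_right_mono) auto
      then show "?F t \<le> 1" by (simp add: sum_cells)
    qed
    have "(\<Sum>t<2 ^ k. ?F t * mass ch t) \<le>
        (\<Sum>t<2 ^ k. (\<Sum>a<2 ^ k. f (and t a) * (D ^ 2 * of_rat (?wh a))) * mass ch t)"
      using Cons.prems(1) and_less weight_ge[OF adm(4,2)] key_nonneg
      by (intro sum_mono mult_right_mono mult_left_mono) auto
    also have "\<dots> = D ^ 2 * (\<Sum>t'<2 ^ k. f t' * of_rat (S t'))"
      unfolding push by (simp add: sum_distrib_left sum_distrib_right algebra_simps)
    also have "(\<Sum>t'<2 ^ k. f t' * of_rat (S t')) \<le> (\<Sum>t'<2 ^ k. f t' * (D * mass (g # ch) t') + of_rat thr)"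
    proof (intro sum_mono)
      fix t' :: nat assume "t' \<in> {..<2 ^ k}"
      then have t': "t' < 2 ^ k" by simp
      have "f t' * of_rat (S t') \<le> f t' * (D * mass (g # ch) t' + of_rat thr)"
        using mass(2)[OF t'] Cons.prems(1) t' by (intro mult_left_mono) auto
      also have "\<dots> = f t' * (D * mass (g # ch) t') + f t' * of_rat thr" by (simp add: algebra_simps)
      also have "f t' * of_rat thr \<le> 1 * of_rat thr" using f1 t' thr_pos by (intro mult_right_mono) auto
      finally show "f t' * of_rat (S t') \<le> f t' * (D * mass (g # ch) t') + of_rat thr" by simp
    qed
    also have "\<dots> = D * (\<Sum>t'<2 ^ k. f t' * mass (g # ch) t') + 2 ^ k * of_rat thr"
      by (simp add: sum.distrib sum_distrib_left algebra_simps)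
    finally have 1: "(\<Sum>t<2 ^ k. ?F t * mass ch t) \<le>
        D ^ 2 * (D * (\<Sum>t'<2 ^ k. f t' * mass (g # ch) t') + 2 ^ k * of_rat thr)"
      using D by (simp add: mult_left_mono)
    let ?X = "\<Sum>t'<2 ^ k. f t' * mass (g # ch) t'"
    have "expect (g # ch) f \<le> D ^ (3 * ?m) * (\<Sum>t<2 ^ k. ?F t * mass ch t) +
        of_nat ?m * D ^ (3 * ?m) * 2 ^ k * of_rat thr"
      using Cons.IH[OF F0 adm(1) len] F1 by simp
    also have "\<dots> \<le> D ^ (3 * ?m) * (D ^ 2 * (D * ?X + 2 ^ k * of_rat thr)) +
        of_nat ?m * D ^ (3 * ?m) * 2 ^ k * of_rat thr"
      using 1 D by (intro add_right_mono mult_left_mono) auto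
    also have "\<dots> = D ^ (3 * Suc ?m) * ?X + (D ^ (3 * ?m + 2) + of_nat ?m * D ^ (3 * ?m)) * (2 ^ k * of_rat thr)"
      by (simp add: algebra_simps power_add eval_nat_numeral)
    also have "\<dots> \<le> D ^ (3 * Suc ?m) * ?X + (D ^ (3 * Suc ?m) + of_nat ?m * D ^ (3 * Suc ?m)) * (2 ^ k * of_rat thr)"
      using D thr_pos by (intro add_left_mono mult_right_mono add_mono mult_left_mono power_increasing) auto
    also have "\<dots> = D ^ (3 * Suc ?m) * ?X + of_nat (Suc ?m) * D ^ (3 * Suc ?m) * 2 ^ k * of_rat thr"
      by (simp add: algebra_simps)
    finally show "expect (g # ch) f \<le> D ^ (3 * m) * ?X + of_nat m * D ^ (3 * m) * 2 ^ k * of_rat thr"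
      using adm(3) by simp
  qed
qed

definition cheapest :: "(nat \<Rightarrow> real) \<Rightarrow> nat \<Rightarrow> real" where
  "cheapest f t = foldr (\<lambda>j. min (f j)) (filter (bit t) [0..<k]) 1"

lemma cheapest_bounds: "(\<And>j. j < k \<Longrightarrow> 0 \<le> f j) \<Longrightarrow> 0 \<le> cheapest f t" "cheapest f t \<le> 1"
  unfolding cheapest_def by (rule le_foldr_min, simp, simp) (rule foldr_min_le_start)

lemma cheapest_mono: "(\<And>j. j < k \<Longrightarrow> f j \<le> g j) \<Longrightarrow> cheapest f t \<le> cheapest g t"
proof -
  assume "\<And>j. j < k \<Longrightarrow> f j \<le> g j"
  then have "foldr (\<lambda>j. min (f j)) js (1 :: real) \<le> foldr (\<lambda>j. min (g j)) js 1" if "\<forall>j\<in>set js. j < k" for js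
    using that by (induction js) (auto simp: min_le_iff_disj)
  then show ?thesis by (simp add: cheapest_def)
qed

lemma cheapest_affine:
  assumes "\<And>j. j < k \<Longrightarrow> g j \<le> c * f j + d" "1 \<le> c" "0 \<le> d"
  shows "cheapest g t \<le> c * cheapest f t + d"
proof -
  have "foldr (\<lambda>j. min (g j)) js (1 :: real) \<le> c * foldr (\<lambda>j. min (f j)) js 1 + d" if "\<forall>j\<in>set js. j < k" for js
    using that
  proof (induction js)
    case (Cons j js)
    then show ?case using assms(1)[of j] assms(2)
      by (cases "f j \<le> foldr (\<lambda>j. min (f j)) js 1") (auto simp: min_le_iff_disj min_def)
  qed (use assms in auto)
  then show ?thesis by (simp add: cheapest_def)
qed

definition objective :: "rat list list \<Rightarrow> real" where
  "objective ch = expect ch (cheapest (cost_share ch))"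

lemma value_le_objective:
  assumes "ch \<in> chains n"
  shows "of_rat (value_of (key_of ch)) \<le> objective ch"
proof -
  have "of_rat (value_of (key_of ch)) = (\<Sum>t<2 ^ k. cheapest (\<lambda>j. of_rat (key_of ch j)) t * mass ch t)"
    by (simp add: value_of_def cheapest_def of_rat_sum of_rat_mult of_rat_foldr_min mult.commute)
  also have "\<dots> \<le> (\<Sum>t<2 ^ k. cheapest (cost_share ch) t * mass ch t)"
    using cost_share_key[OF assms] key_nonneg by (intro sum_mono mult_right_mono cheapest_mono) auto
  also have "\<dots> \<le> objective ch" unfolding objective_def
    using mass_expect[OF assms order_refl] cost_share_le[OF assms order_refl] cheapest_bounds(1) by blast
  finally show ?thesis .
qed

lemma objective_le_value:
  assumes ch: "ch \<in> chains n"
  shows "objective ch \<le> D ^ (4 * n) *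
    (of_rat (value_of (key_of ch)) + of_nat n * (1 + 2 ^ k) * of_rat thr)"
proof -
  let ?V = "of_rat (value_of (key_of ch)) :: real" and ?t = "of_rat thr :: real"
  let ?f = "cheapest (cost_share ch)" and ?h = "cheapest (\<lambda>j. of_rat (key_of ch j))"
  have D: "1 \<le> D" using dlt by simp
  have t: "0 \<le> ?t" using thr_pos by simp
  have f0: "\<forall>t<2 ^ k. 0 \<le> ?f t" and f1: "\<forall>t<2 ^ k. ?f t \<le> 1"
    using cost_share_le[OF ch order_refl] cheapest_bounds by blast+
  have V: "?V = (\<Sum>t<2 ^ k. ?h t * mass ch t)"
    by (simp add: value_of_def cheapest_def of_rat_sum of_rat_mult of_rat_foldr_min mult.commute)
  have mass1: "(\<Sum>t<2 ^ k. mass ch t) \<le> 1"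
    using mass_expect[OF ch order_refl, of "\<lambda>_. 1"] expect_bounds(2)[of "\<lambda>_. 1" ch] by simp
  have "(\<Sum>t<2 ^ k. ?f t * mass ch t) \<le> (\<Sum>t<2 ^ k. (D ^ n * ?h t + of_nat n * D ^ n * ?t) * mass ch t)"
    using cost_share_key[OF ch order_refl] key_nonneg D t
    by (intro sum_mono mult_right_mono cheapest_affine) (auto intro: one_le_power)
  also have "\<dots> = D ^ n * ?V + of_nat n * D ^ n * ?t * (\<Sum>t<2 ^ k. mass ch t)"
    unfolding V by (simp add: sum.distrib sum_distrib_left algebra_simps)
  also have "\<dots> \<le> D ^ n * ?V + of_nat n * D ^ n * ?t * 1"
    using mass1 D t by (intro add_left_mono mult_left_mono) auto
  finally have 1: "(\<Sum>t<2 ^ k. ?f t * mass ch t) \<le> D ^ n * (?V + of_nat n * ?t)"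
    by (simp add: algebra_simps)
  have "objective ch \<le> D ^ (3 * n) * (\<Sum>t<2 ^ k. ?f t * mass ch t) + of_nat n * D ^ (3 * n) * 2 ^ k * ?t"
    unfolding objective_def using mass_expect[OF ch order_refl f0] f1 by blast
  also have "\<dots> \<le> D ^ (3 * n) * (D ^ n * (?V + of_nat n * ?t)) + of_nat n * D ^ (3 * n) * 2 ^ k * ?t"
    using 1 D by (intro add_right_mono mult_left_mono) auto
  also have "\<dots> = D ^ (4 * n) * (?V + of_nat n * ?t) + D ^ (3 * n) * (of_nat n * 2 ^ k * ?t)"
    by (simp add: power_add[symmetric] algebra_simps)
  also have "\<dots> \<le> D ^ (4 * n) * (?V + of_nat n * ?t) + D ^ (4 * n) * (of_nat n * 2 ^ k * ?t)"
    using D t by (intro add_left_mono mult_right_mono power_increasing) auto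
  also have "\<dots> = D ^ (4 * n) * (?V + of_nat n * (1 + 2 ^ k) * ?t)" by (simp add: algebra_simps)
  finally show ?thesis .
qed

end

section \<open>Expected costs\<close>

context pareto_measures
begin

abbreviation suffix_measure :: "nat \<Rightarrow> (nat \<Rightarrow> real) measure" where
  "suffix_measure m \<equiv> PiM {n - m..<n} \<nu>"

abbreviation (input) full_measure :: "(nat \<Rightarrow> real) measure" where
  "full_measure \<equiv> PiM {..<n} \<nu>"

lemma suffix_full: "suffix_measure n = full_measure"
  by (simp add: atLeast0LessThan)

lemma product_sigma_finite_nu: "product_sigma_finite \<nu>"
  by (simp add: product_sigma_finite_def prob_space_nu prob_space_imp_sigma_finite)

lemma prob_space_full: "prob_space full_measure"
  by (intro prob_space_PiM prob_space_nu)

lemma space_full: "space full_measure = cube n"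
  by (simp add: space_PiM space_nu cube_def)

primrec covered :: "rat list list \<Rightarrow> (nat \<Rightarrow> real) \<Rightarrow> nat" where
  "covered [] x = 2 ^ k - 1"
| "covered (g # ch) x = and (covered ch x)
     (mask_of k (\<lambda>j. x (n - Suc (length ch)) \<le> of_rat (g ! j)))"

lemma bit_covered:
  assumes "length ch \<le> n"
  shows "bit (covered ch x) j \<longleftrightarrow>
    j < k \<and> (\<forall>i<length ch. x (n - length ch + i) \<le> of_rat (ch ! i ! j))"
  using assms
proof (induction ch)
  case (Cons g ch)
  have eq: "n - length ch + i = n - Suc (length ch) + Suc i" for i
    using Cons.prems by simp
  have "(\<forall>i<length (g # ch). x (n - length (g # ch) + i) \<le> of_rat ((g # ch) ! i ! j)) \<longleftrightarrow>
    x (n - Suc (length ch)) \<le> of_rat (g ! j) \<and>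
    (\<forall>i<length ch. x (n - length ch + i) \<le> of_rat (ch ! i ! j))"
    unfolding length_Cons All_less_Suc2 eq by simp
  then show ?case using Cons by (auto simp: bit_and_iff bit_mask_of)
qed (simp add: bit_full del: One_nat_def)

lemma covered_upd: "length ch \<le> n \<Longrightarrow> i < n - length ch \<Longrightarrow> covered ch (x(i := y)) = covered ch x"
  by (induction ch) auto

lemma measurable_covered:
  fixes f :: "nat \<Rightarrow> ennreal"
  assumes "length ch \<le> n" "{n - length ch..<n} \<subseteq> J"
  shows "(\<lambda>x. f (covered ch x)) \<in> borel_measurable (PiM J \<nu>)"
  using assms
proof (induction ch arbitrary: f)
  case (Cons g ch)
  let ?i = "n - Suc (length ch)"
  have i: "?i \<in> J" using Cons.prems by auto
  have meas: "(\<lambda>x. \<Sum>a<2 ^ k. indicator (cell g a) (x ?i) * f (and (covered ch x) a)) \<in> borel_measurable (PiM J \<nu>)"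
  proof (intro borel_measurable_sum borel_measurable_times_ennreal)
    fix a
    show "(\<lambda>x. indicator (cell g a) (x ?i) :: ennreal) \<in> borel_measurable (PiM J \<nu>)"
      by (rule measurable_compose[OF measurable_component_singleton[OF i] borel_measurable_indicator[OF cell_sets]])
    show "(\<lambda>x. f (and (covered ch x) a)) \<in> borel_measurable (PiM J \<nu>)"
    proof (rule Cons.IH[of "\<lambda>t. f (and t a)"])
      show "{n - length ch..<n} \<subseteq> J"
        by (rule subset_trans[OF _ Cons.prems(2)]) auto
    qed (use Cons.prems(1) in simp)
  qed
  have eq: "f (covered (g # ch) x) = (\<Sum>a<2 ^ k. indicator (cell g a) (x ?i) * f (and (covered ch x) a))"
    if "x \<in> space (PiM J \<nu>)" for x
  proof -
    have y: "x ?i \<in> {0..1}" using that i by (auto simp: space_PiM space_nu PiE_iff)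
    let ?a = "mask_of k (\<lambda>j. x ?i \<le> of_rat (g ! j))"
    have "(\<Sum>a<2 ^ k. indicator (cell g a) (x ?i) * f (and (covered ch x) a)) =
      (\<Sum>a<2 ^ k. if a = ?a then f (and (covered ch x) a) else 0)"
      by (intro sum.cong refl) (auto simp: indicator_def mem_cell_iff[OF y])
    then show ?thesis by (simp add: sum.delta mask_of_less)
  qed
  show ?case by (rule measurable_cong[THEN iffD2, OF eq meas])
qed simp

lemma nn_integral_covered:
  assumes "length ch \<le> n" "\<And>t. 0 \<le> f t"
  shows "(\<integral>\<^sup>+x. ennreal (f (covered ch x)) \<partial>suffix_measure (length ch)) = ennreal (expect ch f)"
  using assms
proof (induction ch arbitrary: f)
  case Nil
  interpret product_sigma_finite \<nu> by (rule product_sigma_finite_nu)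
  show ?case
    using nn_integral_empty[of "\<lambda>x. ennreal (f (covered [] x))"] by (simp del: nn_integral_const)
next
  case (Cons g ch)
  interpret product_sigma_finite \<nu> by (rule product_sigma_finite_nu)
  let ?i = "n - Suc (length ch)" and ?J = "{n - length ch..<n}"
  let ?m = "\<lambda>y. mask_of k (\<lambda>j. y \<le> real_of_rat (g ! j))"
  have J: "{n - length (g # ch)..<n} = insert ?i ?J" "?i \<notin> ?J" "finite ?J"
    using Cons.prems(1) by auto
  have "(\<integral>\<^sup>+x. ennreal (f (covered (g # ch) x)) \<partial>suffix_measure (length (g # ch))) =
    (\<integral>\<^sup>+x. (\<integral>\<^sup>+y. ennreal (f (covered (g # ch) (x(?i := y)))) \<partial>\<nu> ?i) \<partial>suffix_measure (length ch))"
    unfolding J(1) using J(2,3) Cons.prems(1)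
    by (intro product_nn_integral_insert measurable_covered[of "g # ch" _ "\<lambda>t. ennreal (f t)"]) auto
  also have "\<dots> = (\<integral>\<^sup>+x. (\<integral>\<^sup>+y. ennreal (f (and (covered ch x) (?m y))) \<partial>\<nu> ?i) \<partial>suffix_measure (length ch))"
    using Cons.prems(1) by (simp add: covered_upd)
  also have "\<dots> = (\<integral>\<^sup>+x. ennreal (\<Sum>a<2 ^ k. f (and (covered ch x) a) * measure (\<nu> ?i) (cell g a)) \<partial>suffix_measure (length ch))"
    using Cons.prems(2) by (intro nn_integral_cong nn_integral_mask) auto
  also have "\<dots> = ennreal (expect (g # ch) f)"
    unfolding expect.simps
    by (rule Cons.IH) (use Cons.prems in \<open>auto intro!: sum_nonneg mult_nonneg_nonneg\<close>)
  finally show ?case .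
qed

lemma expect_uncovered:
  assumes "ch \<in> chains m" "m \<le> n"
  shows "expect ch (\<lambda>t. if bit t 0 then 0 else 1) = 0"
  using assms
proof (induction ch arbitrary: m)
  case (Cons g ch)
  note adm = admissible_length[OF Cons.prems]
  let ?i = "n - Suc (length ch)" and ?u = "\<lambda>t :: nat. if bit t 0 then 0 else (1 :: real)"
  have "excess ?i g = 0" using Cons.prems by (auto simp: chains_def)
  then have z: "\<forall>a\<in>{..<2 ^ k}. (if bit a 0 then 0 else weight ?i g a) = 0"
    unfolding excess_def using weight_nonneg[OF adm(4,2)]
    by (subst (asm) sum_nonneg_eq_0_iff) auto
  then have "weight ?i g a = 0" if "a < 2 ^ k" "\<not> bit a 0" for a
    using bspec[OF z, of a] that by (simp del: bit_0)
  then have w: "measure (\<nu> ?i) (cell g a) = 0" if "a < 2 ^ k" "\<not> bit a 0" for a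
    using weight_ge[OF adm(4,2), of a] that measure_nonneg[of "\<nu> ?i" "cell g a"] by simp
  have "(\<Sum>a<2 ^ k. ?u (and t a) * measure (\<nu> ?i) (cell g a)) = (\<Sum>a<2 ^ k. ?u t * measure (\<nu> ?i) (cell g a))" for t
    by (intro sum.cong refl) (auto simp: bit_and_iff w simp del: bit_0)
  then have "(\<Sum>a<2 ^ k. ?u (and t a) * measure (\<nu> ?i) (cell g a)) = ?u t" for t
    by (simp add: sum_distrib_left[symmetric] sum_cells del: bit_0)
  then have "expect (g # ch) ?u = expect ch ?u" unfolding expect.simps by presburger
  then show ?case using Cons.IH[OF adm(1)] adm(3) Cons.prems(2) by simp
qed (use k in \<open>simp add: bit_full del: One_nat_def bit_0\<close>)

lemma AE_covered:
  assumes "ch \<in> chains n"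
  shows "AE x in full_measure. bit (covered ch x) 0"
proof -
  have len: "length ch = n" using assms by (simp add: chains_def)
  let ?u = "\<lambda>t :: nat. if bit t 0 then 0 else (1 :: real)"
  have "(\<integral>\<^sup>+x. ennreal (?u (covered ch x)) \<partial>full_measure) = 0"
    using nn_integral_covered[of ch ?u] expect_uncovered[OF assms order_refl] len suffix_full
    by (simp del: bit_0)
  moreover have "(\<lambda>x. ennreal (?u (covered ch x))) \<in> borel_measurable full_measure"
    using measurable_covered[of ch "{..<n}" "\<lambda>t. ennreal (?u t)"] len
    by (simp add: atLeast0LessThan del: bit_0)
  ultimately have "AE x in full_measure. ennreal (?u (covered ch x)) = 0"
    by (simp add: nn_integral_0_iff_AE del: bit_0)
  then show ?thesis by (rule AE_mp) (auto intro!: AE_I2 simp del: bit_0 split: if_splits)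
qed

abbreviation (input) costs_fn :: "nat \<Rightarrow> real" where
  "costs_fn \<equiv> (\<lambda>i. of_rat (cs ! i))"

definition expcost :: "(nat \<Rightarrow> real) set \<Rightarrow> ennreal" where
  "expcost B = (\<integral>\<^sup>+x. e2ennreal (cover_cost n costs_fn B x) \<partial>full_measure)"

lemma scale_share: "i < n \<Longrightarrow> of_rat scale * of_rat (cs ! i / scale * y) = (of_rat (cs ! i * y) :: real)"
proof -
  assume i: "i < n"
  have "cs ! i = 0" if "scale = 0"
    using that le_max_cost[of "cs ! i"] i costs[of "cs ! i"] cs by (auto simp: scale_def)
  then show ?thesis by (cases "scale = 0") (auto simp: of_rat_mult[symmetric])
qed

lemma cost_share_sum:
  assumes "length ch \<le> n"
  shows "of_rat scale * cost_share ch j =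
    (\<Sum>i<length ch. of_rat (cs ! (n - length ch + i)) * of_rat (ch ! i ! j))"
  using assms
proof (induction ch)
  case (Cons g ch)
  let ?i = "n - Suc (length ch)"
  have eq: "n - length ch + i = ?i + Suc i" for i using Cons.prems by simp
  have "of_rat scale * cost_share (g # ch) j = of_rat scale * cost_share ch j + of_rat (cs ! ?i * g ! j)"
    using scale_share[of ?i "g ! j"] Cons.prems by (simp add: distrib_left)
  also have "\<dots> = (\<Sum>i<length ch. of_rat (cs ! (?i + Suc i)) * of_rat (ch ! i ! j)) + of_rat (cs ! ?i) * of_rat (g ! j)"
    using Cons by (simp add: of_rat_mult eq)
  also have "\<dots> = (\<Sum>i<length (g # ch). of_rat (cs ! (?i + i)) * of_rat ((g # ch) ! i ! j))"
    unfolding length_Cons sum.lessThan_Suc_shift by simp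
  finally show ?case by simp
qed simp

definition cover_vec :: "rat list list \<Rightarrow> nat \<Rightarrow> nat \<Rightarrow> real" where
  "cover_vec ch j = vec_of (vectors ch ! j)"

lemma cover_vec_nth: "i < length ch \<Longrightarrow> j < k \<Longrightarrow> cover_vec ch j i = of_rat (ch ! i ! j)"
  by (simp add: cover_vec_def vec_of_def vectors_def)

lemma covers_cover_vec:
  assumes "length ch = n" "j < k"
  shows "covers n (cover_vec ch j) x \<longleftrightarrow> bit (covered ch x) j"
  using assms by (auto simp: covers_def bit_covered cover_vec_nth)

lemma cost_cover_vec:
  assumes "length ch = n" "j < k"
  shows "(\<Sum>i<n. of_rat (cs ! i) * cover_vec ch j i) = of_rat scale * cost_share ch j"
  using assms by (simp add: cost_share_sum cover_vec_nth)

lemma cube_vec_of: "length v = n \<Longrightarrow> (\<And>y. y \<in> set v \<Longrightarrow> 0 \<le> y \<and> y \<le> 1) \<Longrightarrow> vec_of v \<in> cube n"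
  unfolding cube_def vec_of_def by (auto simp: PiE_iff of_rat_le_1_iff)

lemma output_vectors:
  assumes ch: "ch \<in> chains n" and v: "v \<in> set (output_of ch)"
  shows "length v = n \<and> (\<forall>y\<in>set v. 0 \<le> y \<and> y \<le> 1)"
proof -
  have adm: "admissible ch" "length ch = n" "ch \<noteq> []" using ch cs by (auto simp: chains_def)
  have vec: "length v = n \<and> (\<forall>y\<in>set v. 0 \<le> y \<and> y \<le> 1)" if "v \<in> set (vectors ch)" for v
    using that adm tuples_nth admissible_tuples grid_bounds unfolding vectors_def
    by (fastforce intro: less_imp_le)
  have v0: "vectors ch ! 0 \<in> set (vectors ch)" using k by (intro nth_mem) simp
  have fill: "length v = n \<and> (\<forall>y\<in>set v. 0 \<le> y \<and> y \<le> 1)" if v: "v \<in> set (fillers ch)" for v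
  proof -
    obtain j where "v = 1 / of_nat (Suc j) # tl (vectors ch ! 0)" using v
      by (auto simp: fillers_def simp del: of_nat_Suc)
    then show ?thesis using vec[OF v0] adm cs list.set_sel(2)[of "vectors ch ! 0"]
      by (cases "vectors ch ! 0") (auto simp: divide_le_eq)
  qed
  show ?thesis using output_of(4)[OF adm(3)] v vec fill by blast
qed

lemma output_feasible:
  assumes ch: "ch \<in> chains n"
  shows "pareto_cover n full_measure (vec_of ` set (output_of ch))"
    "card (vec_of ` set (output_of ch)) = k"
proof -
  interpret prob_space full_measure by (rule prob_space_full)
  let ?B = "vec_of ` set (output_of ch)"
  have adm: "length ch = n" "ch \<noteq> []" using ch cs by (auto simp: chains_def)
  have "inj_on vec_of (set (output_of ch))"
  proof (rule inj_onI)
    fix u v assume uv: "u \<in> set (output_of ch)" "v \<in> set (output_of ch)" "vec_of u = vec_of v"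
    then have len: "length u = length v" using output_vectors[OF ch] by metis
    have "u ! i = v ! i" if "i < length u" for i
      using fun_cong[OF uv(3), of i] that len by (simp add: vec_of_def)
    then show "u = v" using len by (intro nth_equalityI) auto
  qed
  then show "card ?B = k"
    using output_of[OF adm(2)] by (simp add: card_image distinct_card)
  have Bcube: "?B \<subseteq> cube n" using output_vectors[OF ch] cube_vec_of by blast
  have b0: "cover_vec ch 0 \<in> ?B"
    using output_of(3)[OF adm(2)] k unfolding cover_vec_def by (intro imageI) (auto simp: subset_iff)
  let ?S = "{x \<in> space full_measure. \<exists>b\<in>?B. covers n b x}"
  have "?S = (\<Union>b\<in>?B. {x \<in> space full_measure. \<forall>i\<in>{..<n}. x i \<in> {0..b i} \<inter> {0..1}})"
    by (auto simp: covers_def space_PiM space_nu PiE_iff)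
  also have "\<dots> \<in> sets full_measure"
  proof (intro sets.finite_UN sets.sets_Collect_finite_All)
    fix b i assume i: "i \<in> {..<n}"
    have "(\<lambda>x. x i) -` ({0..b i} \<inter> {0..1}) \<inter> space full_measure \<in> sets full_measure"
      by (rule measurable_sets[OF measurable_component_singleton[OF i]])
        (simp add: sets_nu sets_restrict_space_iff)
    then show "{x \<in> space full_measure. x i \<in> {0..b i} \<inter> {0..1}} \<in> sets full_measure"
      by (simp add: vimage_def Int_def conj_commute)
  qed auto
  finally have S: "?S \<in> sets full_measure" .
  have "AE x in full_measure. x \<in> ?S"
    using AE_covered[OF ch] AE_space
  proof eventually_elim
    fix x assume x: "bit (covered ch x) 0" "x \<in> space full_measure"
    then have "covers n (cover_vec ch 0) x" using covers_cover_vec[OF adm(1), of 0] k by simp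
    then show "x \<in> ?S" using b0 x(2) by blast
  qed
  then have "emeasure full_measure ?S = 1" using S by (rule emeasure_eq_1_AE[rotated])
  then show "pareto_cover n full_measure ?B"
    using Bcube unfolding pareto_cover_def space_full by simp
qed

lemma expcost_output_le:
  assumes ch: "ch \<in> chains n"
  shows "expcost (vec_of ` set (output_of ch)) \<le> ennreal (of_rat scale * objective ch)"
proof -
  let ?B = "vec_of ` set (output_of ch)" and ?f = "cheapest (cost_share ch)"
  have adm: "length ch = n" "ch \<noteq> []" using ch cs by (auto simp: chains_def)
  have share: "cost_share ch j \<le> 1" "0 \<le> cost_share ch j" if "j < k" for j
    using cost_share_le[OF ch order_refl that] cs by auto
  have s: "(0 :: real) \<le> of_rat scale" using scale_nonneg by simp
  have "expcost ?B \<le> (\<integral>\<^sup>+x. ennreal (of_rat scale * ?f (covered ch x)) \<partial>full_measure)"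
    unfolding expcost_def
  proof (rule nn_integral_mono_AE, use AE_covered[OF ch] in eventually_elim)
    fix x assume b0: "bit (covered ch x) 0"
    have "\<exists>j<k. bit (covered ch x) j \<and> ?f (covered ch x) = cost_share ch j"
    proof (cases "?f (covered ch x) = 1")
      case True
      have "?f (covered ch x) \<le> cost_share ch 0"
        unfolding cheapest_def using b0 k by (intro foldr_min_le) (auto simp del: bit_0)
      then show ?thesis using True share(1)[of 0] k b0 by (intro exI[of _ 0]) auto
    next
      case False
      then show ?thesis
        using foldr_min_cases[of "cost_share ch" "filter (bit (covered ch x)) [0..<k]" 1]
        unfolding cheapest_def by auto
    qed
    then obtain j where j: "j < k" "bit (covered ch x) j" "?f (covered ch x) = cost_share ch j" by blast
    have "cover_vec ch j \<in> {b \<in> ?B. covers n b x}"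
      using j output_of(3)[OF adm(2)] covers_cover_vec[OF adm(1) j(1)]
      unfolding cover_vec_def by (auto simp: subset_iff)
    then have "cover_cost n costs_fn ?B x \<le> ereal (\<Sum>i<n. of_rat (cs ! i) * cover_vec ch j i)"
      unfolding cover_cost_def by (rule INF_lower)
    then have "e2ennreal (cover_cost n costs_fn ?B x) \<le> e2ennreal (ereal (of_rat scale * cost_share ch j))"
      unfolding cost_cover_vec[OF adm(1) j(1)] by (rule e2ennreal_mono)
    then show "e2ennreal (cover_cost n costs_fn ?B x) \<le> ennreal (of_rat scale * ?f (covered ch x))"
      using j(3) by simp
  qed
  also have "\<dots> = ennreal (expect ch (\<lambda>t. of_rat scale * ?f t))"
    using nn_integral_covered[of ch "\<lambda>t. of_rat scale * ?f t"] adm(1) suffix_full s share(2) cheapest_bounds(1)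
    by simp
  also have "\<dots> = ennreal (of_rat scale * objective ch)"
    using expect_affine[of ch "of_rat scale" ?f 0] by (simp add: objective_def)
  finally show ?thesis .
qed

lemma admissible_iff:
  assumes "length ch \<le> n"
  shows "admissible ch \<longleftrightarrow>
    (\<forall>i<length ch. ch ! i \<in> tuples \<and> excess (n - length ch + i) (ch ! i) = 0)"
  using assms
proof (induction ch)
  case (Cons g ch)
  have eq: "n - length ch + i = n - Suc (length ch) + Suc i" for i
    using Cons.prems by simp
  show ?case using Cons unfolding length_Cons All_less_Suc2 eq by auto
qed simp

lemma excess_eq_0:
  assumes "g \<in> tuples" "i < n" "measure (\<nu> i) ({of_rat (g ! 0)<..1} \<inter> {0..1}) = 0"
  shows "excess i g = 0"
proof -
  interpret prob_space "\<nu> i" by (rule prob_space_nu)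
  have "weight i g a = 0" if "\<not> bit a 0" for a
  proof -
    have "g ! 0 \<le> lo g a" unfolding lo_def using that k by (intro le_foldr_max) (auto simp del: bit_0)
    then have "(of_rat (g ! 0) :: real) \<le> of_rat (lo g a)" by (simp only: of_rat_less_eq)
    then have "cell g a \<subseteq> {of_rat (g ! 0)<..1} \<inter> {0..1}" by (auto simp: cell_def)
    then have "measure (\<nu> i) (cell g a) \<le> measure (\<nu> i) ({of_rat (g ! 0)<..1} \<inter> {0..1})"
      by (intro finite_measure_mono) (auto simp: sets_nu sets_restrict_space_iff)
    then have "(of_rat (weight i g a) :: real) \<le> 0"
      using weight_le[OF assms(1,2), of a] unfolding assms(3) by (rule order_trans[rotated])
    then show ?thesis using weight_nonneg[OF assms(1,2), of a] by simp
  qed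
  then show ?thesis unfolding excess_def by (intro sum.neutral) (auto simp del: bit_0)
qed

lemma chains_nonempty: "chains n \<noteq> {}"
proof -
  let ?g = "replicate k (1 :: rat)"
  have g: "?g \<in> tuples" using one_in_grid by (auto simp: tuples_def)
  have "?g ! 0 = 1" using k by simp
  then have "excess i ?g = 0" if "i < n" for i
    using g that by (intro excess_eq_0) auto
  then have "replicate n ?g \<in> chains n"
    using g by (auto simp: chains_def admissible_iff)
  then show ?thesis by blast
qed

lemma grid_above:
  fixes y :: real
  assumes "0 \<le> y" "y \<le> 1"
  shows "\<exists>g\<in>set grid. y \<le> of_rat g \<and> of_rat g \<le> D * y + of_rat thr"
proof (cases "of_rat (ratio ^ depth) < y")
  case True
  then obtain l where l: "l < depth" "y \<le> of_rat (ratio ^ l)" "of_rat (ratio ^ Suc l) < y"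
    using ex_least_nat_less[of "\<lambda>l. of_rat (ratio ^ l) < y" depth] assms by (auto simp: not_less)
  have "1 / ratio = 1 + dlt" using prec_ge by (simp add: ratio_def dlt_def field_simps)
  then have "(1 + dlt) * ratio = 1" using ratio by (simp add: field_simps)
  then have "ratio ^ l = (1 + dlt) * ratio ^ Suc l" by (simp add: mult.assoc[symmetric])
  then have "(of_rat (ratio ^ l) :: real) = of_rat (1 + dlt) * of_rat (ratio ^ Suc l)" by (metis of_rat_mult)
  also have "\<dots> \<le> of_rat (1 + dlt) * y" using l(3) dlt by (intro mult_left_mono) auto
  finally have "(of_rat (ratio ^ l) :: real) \<le> D * y + of_rat thr"
    using thr_pos by (simp add: of_rat_add add_increasing2)
  then show ?thesis using l(1,2) by (intro bexI[of _ "ratio ^ l"]) (auto simp: set_grid)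
next
  case False
  have "(of_rat (ratio ^ depth) :: real) \<le> of_rat thr" using depth_le by (simp only: of_rat_less_eq)
  moreover have "0 \<le> D * y" using dlt assms by simp
  ultimately show ?thesis using False by (intro bexI[of _ "ratio ^ depth"]) (auto simp: set_grid)
qed

lemma dominating_member:
  assumes "pareto_cover n full_measure B"
  shows "\<exists>b\<in>B. \<forall>i<n. measure (\<nu> i) ({b i<..1} \<inter> {0..1}) = 0"
proof (rule ccontr)
  interpret P: prob_space full_measure by (rule prob_space_full)
  interpret product_sigma_finite \<nu> by (rule product_sigma_finite_nu)
  have fin: "finite B" using assms by (simp add: pareto_cover_def)
  assume "\<not> ?thesis"
  then obtain w where w: "\<And>b. b \<in> B \<Longrightarrow> w b < n"
    "\<And>b. b \<in> B \<Longrightarrow> measure (\<nu> (w b)) ({b (w b)<..1} \<inter> {0..1}) \<noteq> 0" by metis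
  define A where "A i = {0..1} \<inter> {y. \<forall>b\<in>B. w b = i \<longrightarrow> b i < y}" for i
  have A_sets: "A i \<in> sets (\<nu> i)" for i
  proof -
    have "A i = {0..1} \<inter> (\<Inter>b\<in>{b \<in> B. w b = i}. {b i<..})" by (auto simp: A_def)
    also have "\<dots> \<in> sets borel" using fin by (intro sets.Int borel_closed borel_open open_INT) auto
    finally show ?thesis by (simp add: sets_nu sets_restrict_space_iff A_def)
  qed
  have "measure (\<nu> i) (A i) \<noteq> 0" for i
  proof (cases "{b \<in> B. w b = i} = {}")
    case True
    then have "A i = space (\<nu> i)" by (auto simp: A_def space_nu)
    then show ?thesis using prob_space.prob_space[OF prob_space_nu, of i] by simp
  next
    case False
    have "Max ((\<lambda>b. b i) ` {b \<in> B. w b = i}) \<in> (\<lambda>b. b i) ` {b \<in> B. w b = i}"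
      using False fin by (intro Max_in) auto
    then obtain b where b: "b \<in> B" "w b = i" "b i = Max ((\<lambda>b. b i) ` {b \<in> B. w b = i})" by auto
    have "b i < y \<longleftrightarrow> (\<forall>b'\<in>B. w b' = i \<longrightarrow> b' i < y)" for y
      unfolding b(3) using Max_less_iff[of "(\<lambda>b. b i) ` {b \<in> B. w b = i}" y] fin False by auto
    then have "A i = {b i<..1} \<inter> {0..1}" unfolding A_def by auto
    then show ?thesis using w(2)[OF b(1)] b(2) by simp
  qed
  then have "emeasure (\<nu> i) (A i) \<noteq> 0" for i by (simp add: measure_def enn2real_eq_0_iff)
  then have pos: "emeasure full_measure (PiE {..<n} A) \<noteq> 0"
    using A_sets by (simp add: emeasure_PiM)
  let ?C = "{x \<in> cube n. \<exists>b\<in>B. covers n b x}"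
  have C1: "emeasure full_measure ?C = 1" using assms by (simp add: pareto_cover_def)
  then have C: "?C \<in> sets full_measure" using emeasure_notin_sets by fastforce
  have "PiE {..<n} A \<subseteq> space full_measure - ?C"
  proof
    fix x assume x: "x \<in> PiE {..<n} A"
    then have "x \<in> space full_measure" unfolding space_full cube_def by (auto simp: A_def PiE_iff)
    moreover have "\<not> covers n b x" if b: "b \<in> B" for b
    proof -
      have "x (w b) \<in> A (w b)" using x w(1)[OF b] by auto
      then have "b (w b) < x (w b)" using b by (auto simp: A_def)
      then show ?thesis using w(1)[OF b] by (auto simp: covers_def not_le)
    qed
    ultimately show "x \<in> space full_measure - ?C" by auto
  qed
  then have "emeasure full_measure (PiE {..<n} A) \<le> emeasure full_measure (space full_measure - ?C)"
    using C by (intro emeasure_mono) auto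
  also have "\<dots> = 0" using C C1 by (subst emeasure_compl) (auto simp: P.emeasure_space_1)
  finally show False using pos by simp
qed

lemma sum_costs_le: "(\<Sum>i<n. of_rat (cs ! i) :: real) \<le> of_rat scale"
proof -
  have "of_rat (cs ! i) \<le> (of_rat scale / of_nat n :: real)" if "i < n" for i
  proof -
    have "(of_rat (cs ! i) :: real) = of_rat scale * of_rat (cs ! i / scale)"
      using scale_share[OF that, of 1] by simp
    also have "\<dots> \<le> of_rat scale * of_rat (1 / of_nat n)"
      using share_bounds[OF that] scale_nonneg by (intro mult_left_mono) (auto simp only: of_rat_less_eq zero_le_of_rat_iff)
    finally show ?thesis by (simp add: of_rat_divide)
  qed
  then have "(\<Sum>i<n. of_rat (cs ! i) :: real) \<le> (\<Sum>i<n. of_rat scale / of_nat n)"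
    by (intro sum_mono) auto
  then show ?thesis using cs by simp
qed

lemma le_cover_cost:
  assumes "\<And>b. b \<in> B \<Longrightarrow> covers n b x \<Longrightarrow> r \<le> (\<Sum>i<n. of_rat (cs ! i) * b i)"
  shows "ennreal r \<le> e2ennreal (cover_cost n costs_fn B x)"
proof -
  have "ereal r \<le> cover_cost n costs_fn B x"
    unfolding cover_cost_def by (rule INF_greatest) (use assms in auto)
  from e2ennreal_mono[OF this] show ?thesis by simp
qed

lemma rounded_up_chain:
  assumes pc: "pareto_cover n full_measure B" and card: "card B = k"
  shows "\<exists>ch\<in>chains n.
    ennreal (of_rat scale * ((objective ch - of_rat thr) / D)) \<le> expcost B"
proof -
  let ?t = "of_rat thr :: real"
  have D: "1 \<le> D" "0 < D" using dlt by (auto intro: add_pos_pos)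
  have s: "(0 :: real) \<le> of_rat scale" using scale_nonneg by simp
  have fin: "finite B" and cube: "B \<subseteq> cube n" using pc by (auto simp: pareto_cover_def)
  obtain b0 where b0: "b0 \<in> B" "\<And>i. i < n \<Longrightarrow> measure (\<nu> i) ({b0 i<..1} \<inter> {0..1}) = 0"
    using dominating_member[OF pc] by blast
  obtain h where h: "bij_betw h {0..<k} B" using ex_bij_betw_nat_finite[OF fin] card by auto
  then obtain m where m: "m < k" "h m = b0" using b0(1) by (auto simp: bij_betw_def)
  define e where "e j = (if j = 0 then h m else if j = m then h 0 else h j)" for j
  have e: "e 0 = b0" "\<And>j. j < k \<Longrightarrow> e j \<in> B" "\<And>b. b \<in> B \<Longrightarrow> \<exists>j<k. e j = b"
  proof -
    show "e 0 = b0" by (simp add: e_def m)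
    show "e j \<in> B" if "j < k" for j using that h m k by (auto simp: e_def bij_betw_def)
    show "\<exists>j<k. e j = b" if b: "b \<in> B" for b
    proof -
      obtain l where l: "l < k" "h l = b" using h b by (auto simp: bij_betw_def)
      have "e (if l = 0 then m else if l = m then 0 else l) = b" using l by (auto simp: e_def)
      moreover have "(if l = 0 then m else if l = m then 0 else l) < k" using l m by auto
      ultimately show ?thesis by blast
    qed
  qed
  have e01: "0 \<le> e j i \<and> e j i \<le> 1" if "j < k" "i < n" for i j
    using e(2)[OF that(1)] cube that(2) by (auto simp: cube_def PiE_iff)
  obtain r where r: "\<And>y. 0 \<le> y \<Longrightarrow> y \<le> 1 \<Longrightarrow> r y \<in> set grid \<and> y \<le> of_rat (r y) \<and> of_rat (r y) \<le> D * y + ?t"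
    using grid_above by metis
  define ch where "ch = map (\<lambda>i. map (\<lambda>j. r (e j i)) [0..<k]) [0..<n]"
  have ch_nth: "ch ! i ! j = r (e j i)" if "i < n" "j < k" for i j using that by (simp add: ch_def)
  have len: "length ch = n" by (simp add: ch_def)
  have tup: "ch ! i \<in> tuples" if "i < n" for i
    using that r e01 by (auto simp: ch_def tuples_def)
  have "excess i (ch ! i) = 0" if i: "i < n" for i
  proof (rule excess_eq_0[OF tup[OF i] i])
    interpret prob_space "\<nu> i" by (rule prob_space_nu)
    have "b0 i \<le> of_rat (ch ! i ! 0)" using r[of "e 0 i"] e01[of 0 i] e(1) k i ch_nth[of i 0] by auto
    then have "measure (\<nu> i) ({of_rat (ch ! i ! 0)<..1} \<inter> {0..1}) \<le> measure (\<nu> i) ({b0 i<..1} \<inter> {0..1})"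
      by (intro finite_measure_mono) (auto simp: sets_nu sets_restrict_space_iff)
    then show "measure (\<nu> i) ({of_rat (ch ! i ! 0)<..1} \<inter> {0..1}) = 0"
      using b0(2)[OF i] measure_nonneg[of "\<nu> i"] by (simp add: antisym)
  qed
  then have chn: "ch \<in> chains n" using tup len by (auto simp: chains_def admissible_iff)
  let ?f = "cheapest (cost_share ch)"
  define \<psi> where "\<psi> t = of_rat scale * max 0 ((?f t - ?t) / D)" for t
  have \<psi>0: "0 \<le> \<psi> t" for t unfolding \<psi>_def using s by simp
  have pointwise: "ennreal (\<psi> (covered ch x)) \<le> e2ennreal (cover_cost n costs_fn B x)" for x
  proof (rule le_cover_cost)
    fix b assume b: "b \<in> B" "covers n b x"
    then obtain j where j: "j < k" "e j = b" using e(3) by blast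
    have b01: "0 \<le> b i \<and> b i \<le> 1" if "i < n" for i using e01[OF j(1) that] j(2) by simp
    let ?cb = "\<Sum>i<n. of_rat (cs ! i) * b i"
    have "x i \<le> of_rat (ch ! i ! j)" if "i < n" for i
    proof -
      have "x i \<le> b i" using b(2) that by (simp add: covers_def)
      also have "\<dots> \<le> of_rat (r (b i))" using r[of "b i"] b01[OF that] by simp
      finally show ?thesis using ch_nth[OF that j(1)] j(2) by simp
    qed
    then have "bit (covered ch x) j" using j(1) len by (simp add: bit_covered)
    then have "?f (covered ch x) \<le> cost_share ch j"
      unfolding cheapest_def using j(1) by (intro foldr_min_le) auto
    then have "of_rat scale * ?f (covered ch x) \<le> of_rat scale * cost_share ch j"
      using s by (rule mult_left_mono)
    also have "\<dots> = (\<Sum>i<n. of_rat (cs ! i) * of_rat (r (b i)))"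
      using len cost_share_sum[of ch j] ch_nth j by simp
    also have "\<dots> \<le> (\<Sum>i<n. of_rat (cs ! i) * (D * b i + ?t))"
      using r b01 costs by (intro sum_mono mult_left_mono) auto
    also have "\<dots> = D * ?cb + (\<Sum>i<n. of_rat (cs ! i)) * ?t"
      by (simp add: sum.distrib sum_distrib_left sum_distrib_right algebra_simps)
    also have "\<dots> \<le> D * ?cb + of_rat scale * ?t"
      using sum_costs_le thr_pos by (intro add_left_mono mult_right_mono) auto
    finally have "of_rat scale * (?f (covered ch x) - ?t) \<le> D * ?cb" by (simp add: algebra_simps)
    then have 1: "of_rat scale * ((?f (covered ch x) - ?t) / D) \<le> ?cb"
      using D by (simp add: pos_divide_le_eq mult.commute)
    have "0 \<le> ?cb" using costs b01 by (intro sum_nonneg mult_nonneg_nonneg) auto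
    then show "\<psi> (covered ch x) \<le> ?cb" using 1 unfolding \<psi>_def by (auto simp: max_def)
  qed
  have "of_rat scale * ((objective ch - ?t) / D) =
      expect ch (\<lambda>t. (of_rat scale / D) * ?f t + - (of_rat scale * ?t / D))"
    unfolding expect_affine objective_def by (simp add: diff_divide_distrib algebra_simps)
  also have "\<dots> \<le> expect ch \<psi>"
  proof (rule expect_mono)
    fix t
    have "(of_rat scale / D) * ?f t + - (of_rat scale * ?t / D) = of_rat scale * ((?f t - ?t) / D)"
      by (simp add: diff_divide_distrib algebra_simps)
    also have "\<dots> \<le> \<psi> t" unfolding \<psi>_def using s by (intro mult_left_mono) auto
    finally show "(of_rat scale / D) * ?f t + - (of_rat scale * ?t / D) \<le> \<psi> t" .
  qed
  finally have "ennreal (of_rat scale * ((objective ch - ?t) / D)) \<le> ennreal (expect ch \<psi>)"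
    by (rule ennreal_leI)
  also have "\<dots> = (\<integral>\<^sup>+x. ennreal (\<psi> (covered ch x)) \<partial>full_measure)"
    using nn_integral_covered[of ch \<psi>] len \<psi>0 suffix_full by simp
  also have "\<dots> \<le> expcost B" unfolding expcost_def by (intro nn_integral_mono pointwise)
  finally show ?thesis using chn by blast
qed

lemma mean_le_expcost:
  "ennreal (of_rat al * of_rat scale / of_nat n) \<le> expcost B"
proof -
  consider "max_cost = 0" | i where "i < n" "max_cost = cs ! i"
    using max_cost_mem by (auto simp: in_set_conv_nth)
  then show ?thesis
  proof cases
    case 1
    then show ?thesis by (simp add: scale_def)
  next
    case (2 i)
    interpret N: prob_space "\<nu> i" by (rule prob_space_nu)
    let ?c = "of_rat (cs ! i) :: real"
    have c: "0 \<le> ?c" using costs 2(1) by simp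
    have bm: "(\<lambda>y. y) \<in> borel_measurable (\<nu> i)"
      by (simp add: measurable_cong_sets[OF sets_nu refl] measurable_restrict_space1)
    have int: "integrable (\<nu> i) (\<lambda>y. y)"
      using bm by (intro N.integrable_const_bound[where B = 1] AE_I2) (auto simp: space_nu)
    have "of_rat al * of_rat scale / of_nat n = ?c * of_rat al"
      using 2(2) cs by (simp add: scale_def of_rat_mult)
    also have "\<dots> \<le> ?c * (\<integral>y. y \<partial>\<nu> i)" using mean_ge[OF 2(1)] c by (rule mult_left_mono)
    finally have "ennreal (of_rat al * of_rat scale / of_nat n) \<le> ennreal (?c * (\<integral>y. y \<partial>\<nu> i))"
      by (rule ennreal_leI)
    also have "\<dots> = ennreal (\<integral>y. ?c * y \<partial>\<nu> i)" by simp
    also have "\<dots> = (\<integral>\<^sup>+y. ennreal (?c * y) \<partial>\<nu> i)"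
      using int c by (intro nn_integral_eq_integral[symmetric] AE_I2) (auto simp: space_nu)
    also have "\<dots> = (\<integral>\<^sup>+y. ennreal (?c * y) \<partial>distr full_measure (\<nu> i) (\<lambda>x. x i))"
      using 2(1) prob_space_nu by (subst distr_PiM_component) auto
    also have "\<dots> = (\<integral>\<^sup>+x. ennreal (?c * x i) \<partial>full_measure)"
      using 2(1) bm by (intro nn_integral_distr measurable_component_singleton) auto
    also have "\<dots> \<le> expcost B" unfolding expcost_def
    proof (intro nn_integral_mono le_cover_cost)
      fix x b assume x: "x \<in> space full_measure" and b: "covers n b x"
      have x0: "0 \<le> x j" if "j < n" for j
        using x that unfolding space_full by (auto simp: cube_def PiE_iff)
      have "?c * x i \<le> ?c * b i" using b 2(1) c by (intro mult_left_mono) (auto simp: covers_def)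
      also have "\<dots> \<le> (\<Sum>j<n. of_rat (cs ! j) * b j)"
      proof (rule member_le_sum[of i "{..<n}" "\<lambda>j. of_rat (cs ! j) * b j"])
        fix j assume "j \<in> {..<n} - {i}"
        then have j: "j < n" by simp
        have "0 \<le> b j" using x0[OF j] b j order_trans[of 0 "x j" "b j"] by (simp add: covers_def)
        then show "0 \<le> of_rat (cs ! j) * b j" using costs j by simp
      qed (use 2(1) in auto)
      finally show "?c * x i \<le> (\<Sum>j<n. of_rat (cs ! j) * b j)" .
    qed
    finally show ?thesis .
  qed
qed

theorem output_near_optimal:
  assumes ch: "ch \<in> chains n"
    and best: "\<And>ch'. ch' \<in> chains n \<Longrightarrow> value_of (key_of ch) \<le> value_of (key_of ch')"
    and B: "pareto_cover n full_measure B" "card B = k"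
  shows "expcost (vec_of ` set (output_of ch)) \<le> ennreal (1 + 1 / of_nat G) * expcost B"
proof (cases "expcost B = \<infinity>")
  case True
  have "0 < 1 + 1 / (of_nat G :: real)" by (simp add: add_pos_nonneg)
  then show ?thesis using True by (simp add: ennreal_mult_top)
next
  case False
  then obtain E where E: "expcost B = ennreal E" "0 \<le> E" by (cases "expcost B") auto
  let ?t = "of_rat thr :: real"
  let ?s = "of_rat scale :: real"
  let ?V = "of_rat (value_of (key_of ch)) :: real"
  define g where "g = 1 / (of_nat G :: real)"
  have n: "1 \<le> (of_nat n :: real)" using cs by (simp add: Suc_le_eq)
  have G1: "1 \<le> (of_nat G :: real)" using G by simp
  have D: "1 \<le> D" using dlt by simp
  have Dn: "D \<noteq> 0" using D by linarith
  have s: "0 \<le> ?s" using scale_nonneg by simp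
  have t: "0 \<le> ?t" using thr_pos by simp
  obtain ch' where ch': "ch' \<in> chains n"
    "ennreal (?s * ((objective ch' - ?t) / D)) \<le> expcost B" using rounded_up_chain[OF B] by blast
  have e1: "?s * ((objective ch' - ?t) / D) \<le> E"
    using ch'(2) E by (simp add: ennreal_le_iff)
  have e2: "of_rat al * ?s / of_nat n \<le> E"
    using mean_le_expcost[of B] E by (simp add: ennreal_le_iff)
  have e3: "?s * objective ch' \<le> D * E + ?s * ?t"
  proof -
    have "D * (?s * ((objective ch' - ?t) / D)) \<le> D * E" using e1 D by (intro mult_left_mono) auto
    also have "D * (?s * ((objective ch' - ?t) / D)) = ?s * (objective ch' - ?t)" using Dn by simp
    finally show ?thesis by (simp add: algebra_simps)
  qed
  have V: "?V \<le> objective ch'"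
    using best[OF ch'(1)] value_le_objective[OF ch'(1)]
    by (meson of_rat_less_eq order_trans)
  define F where "F = D ^ (7 * n)"
  have dlt_eq: "of_rat dlt = 1 / (28 * (of_nat n * of_nat G) :: real)"
    by (simp add: dlt_def prec_def of_rat_divide of_rat_mult)
  have small: "of_nat (7 * n) * of_rat dlt = g / 4"
    unfolding dlt_eq g_def using cs G by (simp add: field_simps)
  have g1: "0 \<le> g" "g \<le> 1" using G1 by (auto simp: g_def divide_le_eq)
  have "0 \<le> (of_rat dlt :: real)" using dlt by simp
  moreover have "2 * (of_nat (7 * n) * of_rat dlt) \<le> (1 :: real)" unfolding small using g1 by simp
  ultimately have "F \<le> 1 + 2 * (of_nat (7 * n) * of_rat dlt)"
    unfolding F_def by (rule power_one_plus_le)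
  then have F_le: "F \<le> 1 + g / 2" unfolding small by simp
  have F1: "1 \<le> F" unfolding F_def using D by (rule one_le_power)
  have F_half: "F \<le> 3 / 2" using F_le g1 by linarith
  have D4: "D ^ (4 * n) \<le> F" unfolding F_def using D by (intro power_increasing) auto
  have D4': "D ^ (4 * n) * D \<le> F"
  proof -
    have "D ^ (4 * n) * D = D ^ (4 * n + 1)" by simp
    also have "\<dots> \<le> F" unfolding F_def using D cs by (intro power_increasing) (auto simp: Suc_le_eq)
    finally show ?thesis .
  qed
  have "?s * objective ch \<le> ?s * (D ^ (4 * n) * (?V + of_nat n * (1 + 2 ^ k) * ?t))"
    using objective_le_value[OF ch] s by (rule mult_left_mono)
  also have "\<dots> \<le> ?s * (D ^ (4 * n) * (objective ch' + of_nat n * (1 + 2 ^ k) * ?t))"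
    using V s D by (intro mult_left_mono add_right_mono) auto
  also have "\<dots> = D ^ (4 * n) * (?s * objective ch') + D ^ (4 * n) * (?s * of_nat n * (1 + 2 ^ k) * ?t)"
    by (simp add: algebra_simps)
  also have "\<dots> \<le> D ^ (4 * n) * (D * E + ?s * ?t) + D ^ (4 * n) * (?s * of_nat n * (1 + 2 ^ k) * ?t)"
    using e3 D by (intro add_right_mono mult_left_mono) auto
  also have "\<dots> = (D ^ (4 * n) * D) * E + D ^ (4 * n) * (?s * ?t * (1 + of_nat n * (1 + 2 ^ k)))"
    by (simp add: algebra_simps)
  also have "\<dots> \<le> F * E + F * (?s * ?t * (1 + of_nat n * (1 + 2 ^ k)))"
    using D4 D4' E(2) s t by (intro add_mono mult_right_mono) auto
  also have "\<dots> \<le> F * E + 3 / 2 * (?s * ?t * (of_nat n * 2 ^ k * 2))"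
  proof -
    have "(2 :: real) \<le> 2 ^ k" using k power_increasing[of 1 k "2 :: real"] by simp
    then have "1 * 1 + of_nat n * 1 \<le> of_nat n * (2 ^ k :: real)"
    proof -
      have "1 + of_nat n \<le> of_nat n * (2 :: real)" using n by simp
      also have "\<dots> \<le> of_nat n * 2 ^ k" using \<open>2 \<le> 2 ^ k\<close> by (intro mult_left_mono) auto
      finally show ?thesis by simp
    qed
    then have "1 + of_nat n * (1 + 2 ^ k) \<le> (of_nat n * 2 ^ k * 2 :: real)" by (simp add: algebra_simps)
    then show ?thesis using F_half F1 s t by (intro add_left_mono mult_mono mult_left_mono) auto
  qed
  also have "\<dots> \<le> F * E + g / 2 * E"
  proof -
    have thr_eq: "?t = of_rat al / (16 * 2 ^ k * (of_nat n * of_nat n * of_nat G))"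
      by (simp add: thr_def of_rat_divide of_rat_mult of_rat_power)
    have "3 / 2 * (?s * ?t * (of_nat n * 2 ^ k * 2)) = 3 / 16 * (g * (of_rat al * ?s / of_nat n))"
      unfolding thr_eq g_def using n G1 by (simp add: field_simps)
    also have "\<dots> \<le> 3 / 16 * (g * E)" using e2 g1 by (intro mult_left_mono) auto
    also have "\<dots> \<le> g / 2 * E"
      using mult_nonneg_nonneg[OF g1(1) E(2)] by (simp add: mult.commute)
    finally show ?thesis by simp
  qed
  also have "\<dots> \<le> (1 + g / 2) * E + g / 2 * E"
    using F_le E(2) by (intro add_right_mono mult_right_mono) auto
  also have "\<dots> = (1 + g) * E" by (simp add: algebra_simps)
  finally have "ennreal (?s * objective ch) \<le> ennreal ((1 + g) * E)" by (rule ennreal_leI)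
  then show ?thesis using expcost_output_le[OF ch] E g1 by (simp add: ennreal_mult g_def[symmetric])
qed

end

section \<open>Polynomial size bounds\<close>

lemma poly_le_monomial: "\<exists>a m. \<forall>y\<ge>1. poly (p :: real poly) (real y) \<le> real (a * y ^ m)"
proof -
  define c where "c = (\<Sum>i\<le>degree p. \<bar>coeff p i\<bar>)"
  have "poly p (real y) \<le> real (nat \<lceil>c\<rceil> * y ^ degree p)" if y: "1 \<le> y" for y
  proof -
    have "poly p (real y) = (\<Sum>i\<le>degree p. coeff p i * real y ^ i)" by (rule poly_altdef)
    also have "\<dots> \<le> (\<Sum>i\<le>degree p. \<bar>coeff p i\<bar> * real y ^ degree p)"
      using y by (intro sum_mono mult_mono power_increasing) auto
    also have "\<dots> = c * real y ^ degree p" by (simp add: c_def sum_distrib_right)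
    also have "\<dots> \<le> real (nat \<lceil>c\<rceil>) * real y ^ degree p"
      by (intro mult_right_mono real_nat_ceiling_ge) auto
    finally show ?thesis by simp
  qed
  then show ?thesis by blast
qed

definition prec_bound :: "nat \<Rightarrow> nat" where
  "prec_bound x = 28 * (x * x)"
definition thr_bound :: "nat \<Rightarrow> nat \<Rightarrow> nat" where
  "thr_bound k x = x + 16 * 2 ^ k * (x * x * x)"
definition depth_bound :: "nat \<Rightarrow> nat \<Rightarrow> nat" where
  "depth_bound k x = prec_bound x * thr_bound k x"
definition grid_len_bound :: "nat \<Rightarrow> nat \<Rightarrow> nat" where
  "grid_len_bound k x = 5 + depth_bound k x * (2 * prec_bound x + 7)"
definition latency_bound :: "nat \<Rightarrow> nat \<Rightarrow> nat \<Rightarrow> nat \<Rightarrow> nat" where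
  "latency_bound k a m x = a * (2 * grid_len_bound k x + prec_bound x + 20) ^ m"
definition scalar_bound :: "nat \<Rightarrow> nat \<Rightarrow> nat \<Rightarrow> nat \<Rightarrow> nat" where
  "scalar_bound k a m x =
     4 + (k + 2 ^ k) * grid_len_bound k x + k * (1 + x * grid_len_bound k x) + k * grid_len_bound k x +
     (latency_bound k a m x + 4 * prec_bound x + thr_bound k x + 5 * x + k + 50)"
definition size_bound :: "nat \<Rightarrow> nat \<Rightarrow> nat \<Rightarrow> nat \<Rightarrow> nat" where
  "size_bound k a m x =
     ((\<Sum>d<k + 2 ^ k. growth (update_expr k d)) + growth (value_expr k) +
      (depth_bound k x + 2) ^ (k + 2 ^ k + k) + x + 4 * k + 1) * scalar_bound k a m x +
     latency_bound k a m x + x + 10"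

lemma poly_bounded_size_bound: "poly_bounded (size_bound k a m)"
  unfolding size_bound_def scalar_bound_def latency_bound_def grid_len_bound_def depth_bound_def
    thr_bound_def prec_bound_def
  by (intro poly_bounded_intros)

lemma answer_val_len:
  assumes "nice_oracle p \<mu> \<sigma>" "valid_query a b \<delta>"
  shows "val_len (Num (answer \<sigma> a b \<delta>)) \<le> latency \<sigma> a b \<delta>"
proof -
  obtain P where "runs [] P (List [Num a, Num b, Num \<delta>]) (latency \<sigma> a b \<delta>) (Num (answer \<sigma> a b \<delta>))"
    using assms unfolding nice_oracle_def by blast
  then obtain s where s: "exec [] P ((\<lambda>_. List [])(0 := List [Num a, Num b, Num \<delta>])) (latency \<sigma> a b \<delta>) s"
    "s 0 = Num (answer \<sigma> a b \<delta>)" unfolding runs_def by blast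
  show ?thesis using exec_val_len[OF s(1), of 0] s(2) by auto
qed

lemma inverse_power_le_rat:
  assumes "0 < (r :: rat)"
  shows "1 / 2 ^ rat_len r \<le> r"
proof -
  obtain a b where r: "r = of_int a / of_int b" "b > 0" "rat_len r = int_len a + int_len b"
    using rat_cases_len by metis
  have a: "1 \<le> a" using assms r by (simp add: zero_less_divide_iff)
  have "\<bar>b\<bar> < 2 ^ (int_len b - 1)" by (rule int_len_bound)
  also have "(2 :: int) ^ (int_len b - 1) \<le> 2 ^ rat_len r" using r(3) by (intro power_increasing) auto
  finally have "(of_int b :: rat) \<le> of_int (2 ^ rat_len r)" using r(2) by (simp only: of_int_le_iff)
  then have b: "(of_int b :: rat) \<le> 2 ^ rat_len r" by simp
  have "1 / 2 ^ rat_len r \<le> 1 / (of_int b :: rat)" using b r(2) by (intro divide_left_mono) auto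
  also have "\<dots> \<le> of_int a / of_int b" using a r(2) by (intro divide_right_mono) auto
  finally show ?thesis using r(1) by simp
qed

context pareto_dp
begin

lemma ratio_power_prec: "ratio ^ prec \<le> 1 / 2"
proof -
  have N: "0 < (of_nat prec :: rat)" using prec_ge by simp
  have "1 + of_nat prec * (1 / of_nat prec :: rat) \<le> (1 + 1 / of_nat prec) ^ prec"
    by (rule Bernoulli_inequality) (rule order_trans[of _ 0]; simp)
  then have "2 \<le> (1 + 1 / of_nat prec :: rat) ^ prec" using N by simp
  moreover have "ratio = 1 / (1 + 1 / of_nat prec)" using N by (simp add: ratio_def field_simps)
  ultimately show ?thesis by (simp add: power_one_over power_divide divide_le_eq_1 field_simps)
qed

lemma size_facts:
  assumes x: "n \<le> x" "G \<le> x"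
  shows "prec \<le> prec_bound x"
    "16 * 2 ^ k * (n * n * G) \<le> 16 * 2 ^ k * (x * x * x)"
proof -
  have "n * G \<le> x * x" using x by (rule mult_le_mono)
  then show "prec \<le> prec_bound x" by (simp add: prec_def prec_bound_def)
  have "n * n * G \<le> x * x * x" using x by (intro mult_le_mono)
  then show "16 * 2 ^ k * (n * n * G) \<le> 16 * 2 ^ k * (x * x * x)" by simp
qed

lemma thr_of_nat: "thr = al / of_nat (16 * 2 ^ k * (n * n * G))"
  by (simp add: thr_def)

lemma depth_le_bound:
  assumes x: "n \<le> x" "G \<le> x" "rat_len al \<le> x"
  shows "depth \<le> depth_bound k x"
proof -
  let ?M = "16 * 2 ^ k * (n * n * G)" and ?T = "thr_bound k x"
  note sf = size_facts[OF x(1,2)]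
  have M0: "0 < ?M" using cs G by simp
  have "ratio ^ (prec * ?T) = (ratio ^ prec) ^ ?T" by (rule power_mult)
  also have "\<dots> \<le> (1 / 2) ^ ?T" using ratio_power_prec ratio by (intro power_mono) auto
  also have "\<dots> \<le> (1 / 2) ^ (rat_len al + ?M)"
    unfolding thr_bound_def using add_mono[OF x(3) sf(2)] by (intro power_decreasing) auto
  also have "\<dots> = (1 / 2 ^ rat_len al) * (1 / 2 ^ ?M)" by (simp add: power_add power_one_over)
  also have "\<dots> \<le> al * (1 / of_nat ?M)"
  proof (intro mult_mono)
    show "1 / 2 ^ rat_len al \<le> al" by (rule inverse_power_le_rat[OF al(1)])
    have "of_nat ?M \<le> (of_nat (2 ^ ?M) :: rat)" using of_nat_le_iff less_imp_le less_exp by blast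
    then have "(of_nat ?M :: rat) \<le> 2 ^ ?M" by simp
    then show "1 / 2 ^ ?M \<le> (1 / of_nat ?M :: rat)"
      using M0 by (intro divide_left_mono mult_pos_pos) (simp_all del: of_nat_mult of_nat_power of_nat_numeral)
  qed (use al in auto)
  also have "\<dots> = thr" by (simp add: thr_of_nat)
  finally have "depth \<le> prec * ?T" by (rule depth_least)
  also have "\<dots> \<le> prec_bound x * ?T" using sf(1) by simp
  finally show ?thesis by (simp add: depth_bound_def)
qed

lemma pareto_dp_bounds_size_bound:
  assumes x: "n \<le> x" "G \<le> x" "rat_len al \<le> x" "\<And>c. c \<in> set cs \<Longrightarrow> val_len (Num c) \<le> x"
    and lat: "\<And>i u v \<delta>. i < n \<Longrightarrow> valid_query u v \<delta> \<Longrightarrow>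
      latency (\<Omega> ! i) u v \<delta> \<le> a * (rat_len u + rat_len v + rat_len \<delta>) ^ m"
    and ans: "\<And>i u v \<delta>. i < n \<Longrightarrow> valid_query u v \<delta> \<Longrightarrow>
      val_len (Num (answer (\<Omega> ! i) u v \<delta>)) \<le> latency (\<Omega> ! i) u v \<delta>"
  shows "pareto_dp_bounds k cs al G \<Omega> (grid_len_bound k x) (scalar_bound k a m x) (size_bound k a m x)"
proof -
  let ?b = "grid_len_bound k x" and ?L = "latency_bound k a m x" and ?B = "scalar_bound k a m x"
    and ?Z = "size_bound k a m x" and ?P = "prec_bound x" and ?M = "16 * 2 ^ k * (n * n * G)"
  note sf = size_facts[OF x(1,2)]
  have M: "?M + rat_len al \<le> thr_bound k x" using add_mono[OF sf(2) x(3)] by (simp add: thr_bound_def)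
  have B: "?L + 4 * ?P + thr_bound k x + 5 * x + k + 50 \<le> ?B" unfolding scalar_bound_def by linarith
  have nat: "rat_len (of_nat i) \<le> i + 3" for i by (rule rat_len_of_nat)
  have one: "rat_len (1 / y) \<le> rat_len y + 4" for y using rat_len_divide[of 1 y] by simp
  have prec_len: "rat_len (of_nat prec) \<le> ?P + 3" using nat[of prec] sf(1) by linarith
  have dlt_len: "rat_len dlt \<le> ?P + 7" using one[of "of_nat prec"] prec_len unfolding dlt_def by linarith
  have ratio_len: "rat_len ratio \<le> 2 * ?P + 7"
    using rat_len_divide[of "of_nat prec" "of_nat (Suc prec)"] prec_len nat[of "Suc prec"] sf(1)
    by (simp add: ratio_def add.commute)
  have grid_len: "val_len (Num y) \<le> ?b" if y: "y \<in> insert 0 (set grid)" for y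
  proof -
    consider "y = 0" | l where "l \<le> depth" "y = ratio ^ l" using y by (auto simp: set_grid)
    then show ?thesis
    proof cases
      case 1
      then show ?thesis by (simp add: grid_len_bound_def)
    next
      case (2 l)
      have "l * rat_len ratio \<le> depth_bound k x * (2 * ?P + 7)"
        using 2(1) depth_le_bound[OF x(1-3)] ratio_len by (intro mult_le_mono) auto
      then show ?thesis using rat_len_power[of ratio l] 2(2) by (simp add: grid_len_bound_def)
    qed
  qed
  have lo_hi: "rat_len (lo g w) \<le> ?b" "rat_len (hi g w) \<le> ?b" if "g \<in> tuples" for g w
  proof -
    have "rat_len (- 1) \<le> ?b" "rat_len 1 \<le> ?b"
      using rat_len_minus[of 1] by (auto simp: grid_len_bound_def)
    then show "rat_len (lo g w) \<le> ?b" "rat_len (hi g w) \<le> ?b"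
      using lo_mem[OF that, of w] hi_mem[OF that, of w] grid_len[of "lo g w"] grid_len[of "hi g w"] by auto
  qed
  have lat': "latency (\<Omega> ! i) (lo g w) (hi g w) dlt \<le> ?L"
    if g: "g \<in> tuples" "i < n" "lo g w < hi g w" for g i w
  proof -
    have "rat_len (lo g w) + rat_len (hi g w) + rat_len dlt \<le> 2 * ?b + ?P + 20"
      using lo_hi[OF g(1), of w] dlt_len by linarith
    then have "a * (rat_len (lo g w) + rat_len (hi g w) + rat_len dlt) ^ m \<le> ?L"
      unfolding latency_bound_def by (intro mult_le_mono power_mono) auto
    then show ?thesis using lat[OF g(2) valid_query_lo_hi[OF g(1,3)]] by linarith
  qed
  have ans': "val_len (Num (answer (\<Omega> ! i) (lo g w) (hi g w) dlt)) \<le> ?L"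
    if g: "g \<in> tuples" "i < n" "lo g w < hi g w" for g i w
    using ans[OF g(2) valid_query_lo_hi[OF g(1,3)]] lat'[OF g] by linarith
  have "rat_len max_cost \<le> x + 3" using max_cost_mem x(4)[of max_cost] by auto
  then have scale_len: "rat_len scale \<le> 2 * x + 6"
    using rat_len_mult[of "of_nat n" max_cost] nat[of "n"] x(1) unfolding scale_def by linarith
  define W where "W = (\<Sum>d<k + 2 ^ k. growth (update_expr k d)) + growth (value_expr k) +
      (depth_bound k x + 2) ^ (k + 2 ^ k + k) + x + 4 * k + 1"
  have Z: "?Z = W * ?B + ?L + x + 10" by (simp add: size_bound_def W_def)
  have W: "c * ?B + ?L + x + 10 \<le> ?Z" if "c \<le> W" for c
    using mult_le_mono1[OF that, of ?B] unfolding Z by linarith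
  show ?thesis
  proof (unfold_locales, goal_cases)
    case (1 y)
    then show ?case by (rule grid_len)
  next
    case 2
    have "k * (1 + n * ?b) \<le> k * (1 + x * ?b)" using x(1) by (intro mult_le_mono add_mono) auto
    then show ?case unfolding scalar_bound_def by linarith
  next
    case (3 i)
    then show ?case using nat[of i] B x(1) by simp
  next
    case (4 c)
    then show ?case using x(4)[of c] B by linarith
  next
    case 5
    then show ?case using scale_len B by simp
  next
    case 6
    then show ?case using prec_len B by simp
  next
    case 7
    then show ?case using dlt_len B by simp
  next
    case 8
    then show ?case using ratio_len B by simp
  next
    case 9
    show ?case using rat_len_divide[of al "of_nat ?M"] nat[of ?M] M B unfolding thr_of_nat val_len.simps
      by linarith
  next
    case (10 c)
    then show ?case using rat_len_divide[of c scale] scale_len x(4)[of c] B by simp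
  next
    case (11 i)
    then show ?case using one[of "of_nat (Suc i)"] nat[of "Suc i"] B unfolding val_len.simps by linarith
  next
    case (12 i g w)
    then show ?case using ans'[OF 12] B by linarith
  next
    case (13 i g w)
    show ?case
    proof (cases "lo g w < hi g w")
      case True
      have "rat_len (1 + dlt) \<le> 2 * (4 + (?P + 7))" using rat_len_add[of 1 dlt] dlt_len by simp
      then show ?thesis
        using ans'[OF 13 True] rat_len_divide[of "answer (\<Omega> ! i) (lo g w) (hi g w) dlt" "1 + dlt"] True B
        by (simp add: weight_def)
    next
      case False
      then show ?thesis using B by (simp add: weight_def)
    qed
  next
    case (14 i g w)
    then show ?case using lat'[OF 14] unfolding Z by linarith
  next
    case (15 d)
    have "growth (update_expr k d) \<le> (\<Sum>d<k + 2 ^ k. growth (update_expr k d))"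
      using 15 by (intro member_le_sum) auto
    then show ?case using W[of "growth (update_expr k d)"] by (simp add: W_def)
  next
    case 16
    then show ?case using W[of "growth (value_expr k)"] by (simp add: W_def)
  next
    case 17
    have "(depth + 2) ^ (k + 2 ^ k + k) \<le> (depth_bound k x + 2) ^ (k + 2 ^ k + k)"
      using depth_le_bound[OF x(1-3)] by (intro power_mono) auto
    then have "(depth + 2) ^ (k + 2 ^ k + k) \<le> W" unfolding W_def by linarith
    then show ?case using W by fastforce
  next
    case 18
    have "n \<le> W" using x(1) by (simp add: W_def)
    then show ?case using W by fastforce
  next
    case 19
    have "4 * k \<le> W" by (simp add: W_def)
    then show ?case using W by fastforce
  next
    case 20
    then show ?case using B by linarith
  qed
qed

end

section \<open>The approximation scheme\<close>

lemma valid_instance_measures: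
  assumes v: "valid_instance p I" and G: "1 \<le> G"
  defines "\<nu> \<equiv> \<lambda>i. if i < dim I then measures I ! i else measures I ! 0"
  shows "pareto_measures (cover_size I) (costs I) (alpha I) G (oracles I) \<nu>"
    "product_measure I = PiM {..<length (costs I)} \<nu>"
proof -
  have n: "1 \<le> dim I" "length (measures I) = dim I" "length (oracles I) = dim I"
    and nice: "\<And>i. i < dim I \<Longrightarrow> nice (measures I ! i)"
    and nor: "\<And>i. i < dim I \<Longrightarrow> nice_oracle p (measures I ! i) (oracles I ! i)"
    and rest: "\<And>i. i < dim I \<Longrightarrow> 0 \<le> costs I ! i" "1 \<le> cover_size I" "0 < alpha I" "alpha I < 1"
      "\<And>i. i < dim I \<Longrightarrow> of_rat (alpha I) \<le> (\<integral>x. x \<partial>(measures I ! i))"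
    using v by (auto simp: valid_instance_def)
  have or: "0 \<le> answer (oracles I ! i) a b \<delta>"
    "inverse (1 + of_rat \<delta>) * measure (measures I ! i) ({of_rat a<..of_rat b} \<inter> {0..1})
          \<le> of_rat (answer (oracles I ! i) a b \<delta>)"
    "of_rat (answer (oracles I ! i) a b \<delta>)
          \<le> (1 + of_rat \<delta>) * measure (measures I ! i) ({of_rat a<..of_rat b} \<inter> {0..1})"
    if "i < dim I" "valid_query a b \<delta>" for i a b \<delta>
    using nor[OF that(1)] that(2) unfolding nice_oracle_def by blast+
  show "pareto_measures (cover_size I) (costs I) (alpha I) G (oracles I) \<nu>"
  proof (unfold_locales, goal_cases)
    case 2
    then show ?case using n by (auto simp: dim_def)
  next
    case (7 c)
    then show ?case using rest(1) by (auto simp: dim_def in_set_conv_nth)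
  next
    case (9 i)
    then show ?case using nice n(1) by (auto simp: \<nu>_def nice_def)
  qed (use or rest n G in \<open>auto simp: dim_def \<nu>_def\<close>)
  show "product_measure I = PiM {..<length (costs I)} \<nu>"
    unfolding product_measure_def by (intro PiM_cong) (auto simp: \<nu>_def dim_def)
qed

lemma pareto_prog_correct:
  assumes v: "valid_instance p I" and sz: "cover_size I = k" and \<gamma>: "0 < \<gamma>" "\<gamma> < 1"
    and p: "\<And>y. 1 \<le> y \<Longrightarrow> poly p (real y) \<le> real (a * y ^ m)"
  defines "x \<equiv> val_len (encode_instance I) + nat (\<lfloor>1 / \<gamma>\<rfloor> + 1)"
  shows "\<exists>t bss. runs (oracles I) (pareto_prog k) (List [encode_instance I, Num \<gamma>]) t (encode_vectors bss) \<and>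
    approx_solution \<gamma> I (vec_of ` set bss) \<and>
    t \<le> time_bound (2 + val_len (encode_instance I) + rat_len \<gamma>) reduce_prog +
      time_bound (size_bound k a m x) (main_prog k)"
proof -
  define G where "G = nat (\<lfloor>1 / \<gamma>\<rfloor> + 1)"
  have "1 \<le> 1 / \<gamma>" using \<gamma> by (simp add: le_divide_eq)
  then have fl: "1 \<le> \<lfloor>1 / \<gamma>\<rfloor>" by (simp add: le_floor_iff)
  have "1 \<le> nat (z + 1) \<and> (of_nat (nat (z + 1)) :: rat) = of_int z + 1" if "1 \<le> z" for z
    using that by auto
  from this[OF fl] have G1: "1 \<le> G" and G_eq: "(of_nat G :: rat) = of_int \<lfloor>1 / \<gamma>\<rfloor> + 1"
    unfolding G_def by auto
  have "1 / \<gamma> < of_nat G" using G_eq floor_correct[of "1 / \<gamma>"] by simp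
  then have "1 / of_nat G < \<gamma>" using \<gamma> G1 by (simp add: divide_less_eq mult.commute)
  then have "(of_rat (1 / of_nat G) :: real) < of_rat \<gamma>" by (simp only: of_rat_less)
  then have G\<gamma>: "1 / of_nat G \<le> (of_rat \<gamma> :: real)" by (simp add: of_rat_divide)
  define \<nu> where "\<nu> = (\<lambda>i. if i < dim I then measures I ! i else measures I ! 0)"
  let ?cs = "costs I"
  interpret pareto_measures k ?cs "alpha I" G "oracles I" \<nu>
    using valid_instance_measures(1)[OF v G1] unfolding sz \<nu>_def .
  have pm: "product_measure I = PiM {..<length ?cs} \<nu>"
    using valid_instance_measures(2)[OF v G1] unfolding \<nu>_def .
  have cost_eq: "expected_cost I B = expcost B" for B
    unfolding expected_cost_def expcost_def pm dim_def ..
  have xG: "x = val_len (encode_instance I) + G" by (simp add: x_def G_def)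
  have enc_parts: "val_len (List (map Num ?cs)) \<le> x" "rat_len (alpha I) \<le> x"
    unfolding xG encode_instance_def by auto
  have ora: "nice_oracle p (measures I ! i) (oracles I ! i)" if "i < length ?cs" for i
    using v that by (auto simp: valid_instance_def dim_def)
  let ?Z = "size_bound k a m x"
  have "pareto_dp_bounds k ?cs (alpha I) G (oracles I) (grid_len_bound k x) (scalar_bound k a m x) ?Z"
  proof (rule pareto_dp_bounds_size_bound)
    show "length ?cs \<le> x" using enc_parts(1) length_le_val_len[of "map Num ?cs"] by simp
    show "G \<le> x" by (simp add: xG)
    show "rat_len (alpha I) \<le> x" by (rule enc_parts(2))
    show "val_len (Num c) \<le> x" if "c \<in> set ?cs" for c
      using val_len_mem[of "Num c" "map Num ?cs"] that enc_parts(1) by auto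
    fix i u w \<delta> assume i: "i < length ?cs" and q: "valid_query u w \<delta>"
    have "real (latency (oracles I ! i) u w \<delta>) \<le> poly p (real (rat_len u + rat_len w + rat_len \<delta>))"
      using ora[OF i] q unfolding nice_oracle_def by blast
    also have "\<dots> \<le> real (a * (rat_len u + rat_len w + rat_len \<delta>) ^ m)"
      by (rule p) (use rat_len_pos[of u] in linarith)
    finally show "latency (oracles I ! i) u w \<delta> \<le> a * (rat_len u + rat_len w + rat_len \<delta>) ^ m" by linarith
    show "val_len (Num (answer (oracles I ! i) u w \<delta>)) \<le> latency (oracles I ! i) u w \<delta>"
      by (rule answer_val_len[OF ora[OF i] q])
  qed
  then interpret bnd: pareto_dp_bounds k ?cs "alpha I" G "oracles I" "grid_len_bound k x" "scalar_bound k a m x" ?Z .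
  let ?in = "List [encode_instance I, Num \<gamma>]" and ?e1 = precision_expr and ?e2 = "nth_expr 0 (Var v_io)"
  let ?s0 = "(\<lambda>_. List [])(v_io := ?in)"
  let ?s1 = "?s0(v_G := eval ?e1 ?s0)"
  let ?s2 = "?s1(v_io := eval ?e2 ?s1)"
  let ?Y = "2 + val_len (encode_instance I) + rat_len \<gamma>"
  have ev1: "eval ?e1 ?s0 = Num (of_nat G)" by (simp add: precision_expr_def items_eval_nth_expr G_eq)
  have ev2: "eval ?e2 ?s1 = encode_instance I"
    by (simp add: items_eval_nth_expr)
  have exec1: "exec (oracles I) reduce_prog ?s0
      ((1 + eval_cost ?e1 ?s0) + (1 + eval_cost ?e2 ?s1)) ?s2"
    unfolding reduce_prog_def by (rule exec_Seq[OF exec_Assign exec_Assign])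
  have "eval_cost ?e1 ?s0 \<le> cost_growth ?e1 * ?Y" "eval_cost ?e2 ?s1 \<le> cost_growth ?e2 * ?Y"
    by (rule eval_cost_le; simp add: vars_nth_expr precision_expr_def)+
  then have time1: "(1 + eval_cost ?e1 ?s0) + (1 + eval_cost ?e2 ?s1) \<le>
      time_bound ?Y reduce_prog" by (simp add: reduce_prog_def)
  have Zx: "x + 10 \<le> ?Z" unfolding size_bound_def by linarith
  have small: "small ?Z ?s2"
  proof -
    have "val_len (Num (of_nat G)) \<le> ?Z" using rat_len_of_nat[of G] Zx xG by simp
    moreover have "val_len (encode_instance I) \<le> ?Z" using Zx xG by simp
    moreover have "val_len (List []) \<le> ?Z" using Zx by simp
    ultimately have bound: "val_len w \<le> ?Z" if "w \<in> {encode_instance I, Num (of_nat G), List []}" for w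
      using that by (elim insertE emptyE) simp_all
    have "?s2 y \<in> {encode_instance I, Num (of_nat G), List []}" for y
      by (subst ev2, subst ev1) auto
    from bound[OF this] show ?thesis unfolding small_def by (rule allI)
  qed
  have "wp ?Z (oracles I) (main_prog k) (\<lambda>s'. \<exists>ch\<in>chains (length ?cs).
    (\<forall>ch'\<in>chains (length ?cs). value_of (key_of ch) \<le> value_of (key_of ch')) \<and>
    s' v_io = encode_vectors (output_of ch)) ?s2"
  proof (rule bnd.wp_main[OF chains_nonempty])
    show "?s2 v_io = List [List (map Num ?cs), Num (of_nat k), Num (alpha I)]"
      unfolding fun_upd_same ev2 by (simp add: encode_instance_def sz)
    show "?s2 v_G = Num (of_nat G)" by (subst fun_upd_other, simp, subst fun_upd_same, rule ev1)
  qed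
  then obtain t s' ch where t: "exec (oracles I) (main_prog k) ?s2 t s'" "t \<le> time_bound ?Z (main_prog k)"
    and ch: "ch \<in> chains (length ?cs)"
      "\<And>ch'. ch' \<in> chains (length ?cs) \<Longrightarrow> value_of (key_of ch) \<le> value_of (key_of ch')"
    and out: "s' v_io = encode_vectors (output_of ch)"
    using small unfolding wp_def by blast
  let ?B = "vec_of ` set (output_of ch)"
  have feas: "feasible I ?B"
    using output_feasible[OF ch(1)] unfolding feasible_def pm sz dim_def by simp
  let ?c = "ennreal (1 + of_rat \<gamma>)"
  have c: "?c \<noteq> 0" "?c \<noteq> \<top>" "0 < ?c" using \<gamma> by (auto simp: add_pos_pos)
  have "expected_cost I ?B / ?c \<le> optimum I"
    unfolding optimum_def
  proof (rule INF_greatest)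
    fix B assume "B \<in> {B. feasible I B}"
    then have B: "pareto_cover (length ?cs) (PiM {..<length ?cs} \<nu>) B" "card B = k"
      by (auto simp: feasible_def pm sz dim_def)
    have "expected_cost I ?B \<le> ennreal (1 + 1 / of_nat G) * expected_cost I B"
      unfolding cost_eq by (rule output_near_optimal[OF ch B])
    also have "\<dots> \<le> ?c * expected_cost I B"
      using G\<gamma> by (intro mult_right_mono ennreal_leI) auto
    finally show "expected_cost I ?B / ?c \<le> expected_cost I B"
      using c by (intro divide_le_posI_ennreal) (auto simp: mult.commute)
  qed
  then have "?c * (expected_cost I ?B / ?c) \<le> ?c * optimum I" by (rule mult_left_mono) simp
  moreover have "?c * (expected_cost I ?B / ?c) = expected_cost I ?B"
    unfolding ennreal_times_divide mult.commute[of ?c] using c(1,2) by (rule ennreal_mult_divide_eq)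
  ultimately have "approx_solution \<gamma> I ?B" using feas by (simp add: approx_solution_def)
  moreover have "runs (oracles I) (pareto_prog k) ?in
      ((1 + eval_cost ?e1 ?s0) + (1 + eval_cost ?e2 ?s1) + t) (encode_vectors (output_of ch))"
    unfolding runs_def pareto_prog_def using exec_Seq[OF exec1 t(1)] out by blast
  ultimately show ?thesis using add_mono[OF time1 t(2)] by blast
qed

theorem theorem3:
  fixes k :: nat
  assumes "k \<ge> 1"
  shows "\<exists>A. pareto_fptas k A"
proof (intro exI[of _ "pareto_prog k"], unfold pareto_fptas_def, intro allI)
  fix p :: "real poly"
  obtain a m where p: "\<And>y. 1 \<le> y \<Longrightarrow> poly p (real y) \<le> real (a * y ^ m)"
    using poly_le_monomial[of p] by blast
  obtain c where c: "\<And>y. time_bound y reduce_prog = 2 + c * y"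
    by (rule that[of "cost_growth precision_expr + cost_growth (nth_expr 0 (Var v_io))"])
      (simp add: reduce_prog_def add_mult_distrib)
  obtain a2 m2 where tb: "\<And>Z. 1 \<le> Z \<Longrightarrow> time_bound Z (main_prog k) \<le> a2 * Z ^ m2"
    using poly_bounded_time_bound[of "main_prog k"] unfolding poly_bounded_def by blast
  have "poly_bounded (\<lambda>x. 2 + c * (2 + x) + a2 * size_bound k a m x ^ m2)"
    by (intro poly_bounded_intros poly_bounded_size_bound)
  then obtain a3 m3 where fin: "\<And>x. 1 \<le> x \<Longrightarrow> 2 + c * (2 + x) + a2 * size_bound k a m x ^ m2 \<le> a3 * x ^ m3"
    unfolding poly_bounded_def by blast
  show "\<exists>q C. \<forall>I \<gamma>. valid_instance p I \<and> cover_size I = k \<and> 0 < \<gamma> \<and> \<gamma> < 1 \<longrightarrow>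
        (\<exists>t bss. runs (oracles I) (pareto_prog k) (List [encode_instance I, Num \<gamma>]) t (encode_vectors bss) \<and>
           approx_solution \<gamma> I (vec_of ` set bss) \<and>
           real t \<le> poly q (1 / of_rat \<gamma> + real (val_len (encode_instance I))) + C * real (rat_len \<gamma>))"
  proof (intro exI[of _ "monom (real a3 * 2 ^ m3) m3"] exI[of _ "real c"] allI impI, elim conjE)
    fix I and \<gamma> :: rat assume I: "valid_instance p I" "cover_size I = k" "0 < \<gamma>" "\<gamma> < 1"
    let ?v = "val_len (encode_instance I)"
    let ?x = "?v + nat (\<lfloor>1 / \<gamma>\<rfloor> + 1)"
    from pareto_prog_correct[OF I p] obtain t bss
      where run: "runs (oracles I) (pareto_prog k) (List [encode_instance I, Num \<gamma>]) t (encode_vectors bss)"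
        "approx_solution \<gamma> I (vec_of ` set bss)"
        and t: "t \<le> time_bound (2 + ?v + rat_len \<gamma>) reduce_prog + time_bound (size_bound k a m ?x) (main_prog k)"
      by blast
    have x1: "1 \<le> ?x" using val_len_pos[of "encode_instance I"] by simp
    have "1 \<le> size_bound k a m ?x" unfolding size_bound_def by simp
    from tb[OF this] t have "t \<le> (2 + c * (2 + ?v + rat_len \<gamma>)) + a2 * size_bound k a m ?x ^ m2"
      unfolding c by linarith
    also have "\<dots> \<le> (2 + c * (2 + ?x) + a2 * size_bound k a m ?x ^ m2) + c * rat_len \<gamma>"
      by (simp add: algebra_simps)
    also have "\<dots> \<le> a3 * ?x ^ m3 + c * rat_len \<gamma>" using fin[OF x1] by (rule add_right_mono)
    finally have "real t \<le> real a3 * real ?x ^ m3 + real c * real (rat_len \<gamma>)"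
      by (metis of_nat_add of_nat_le_iff of_nat_mult of_nat_power)
    moreover have "real ?x ^ m3 \<le> (2 * (1 / of_rat \<gamma> + real ?v)) ^ m3"
    proof (intro power_mono)
      have g1: "1 \<le> 1 / \<gamma>" using I by (simp add: le_divide_eq)
      have "(of_nat (nat (\<lfloor>r\<rfloor> + 1)) :: rat) \<le> 2 * r" if "1 \<le> r" for r :: rat
      proof -
        have "0 \<le> \<lfloor>r\<rfloor>" using that by simp
        then have "(of_nat (nat (\<lfloor>r\<rfloor> + 1)) :: rat) = of_int \<lfloor>r\<rfloor> + 1" by simp
        then show ?thesis using that of_int_floor_le[of r] by linarith
      qed
      from this[OF g1] have "(of_nat (nat (\<lfloor>1 / \<gamma>\<rfloor> + 1)) :: rat) \<le> 2 * (1 / \<gamma>)" .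
      then have "(of_rat (of_nat (nat (\<lfloor>1 / \<gamma>\<rfloor> + 1))) :: real) \<le> of_rat (2 * (1 / \<gamma>))"
        by (simp only: of_rat_less_eq)
      then have "real (nat (\<lfloor>1 / \<gamma>\<rfloor> + 1)) \<le> 2 * (1 / of_rat \<gamma>)"
        by (simp only: of_rat_of_nat_eq of_rat_mult of_rat_divide of_rat_1 of_rat_numeral_eq)
      from add_mono[OF _ this, of "real ?v" "2 * real ?v"]
      show "real ?x \<le> 2 * (1 / of_rat \<gamma> + real ?v)"
        by (simp add: distrib_left add.commute)
    qed simp
    then have "real a3 * real ?x ^ m3 \<le> real a3 * (2 * (1 / of_rat \<gamma> + real ?v)) ^ m3"
      by (rule mult_left_mono) simp
    ultimately have "real t \<le> real a3 * (2 * (1 / of_rat \<gamma> + real ?v)) ^ m3 + real c * real (rat_len \<gamma>)"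
      by linarith
    then have "real t \<le> poly (monom (real a3 * 2 ^ m3) m3) (1 / of_rat \<gamma> + real ?v) + real c * real (rat_len \<gamma>)"
      unfolding poly_monom power_mult_distrib by (simp only: mult.assoc)
    then show "\<exists>t bss. runs (oracles I) (pareto_prog k) (List [encode_instance I, Num \<gamma>]) t (encode_vectors bss) \<and>
           approx_solution \<gamma> I (vec_of ` set bss) \<and>
           real t \<le> poly (monom (real a3 * 2 ^ m3) m3) (1 / of_rat \<gamma> + real ?v) + real c * real (rat_len \<gamma>)"
      using run by blast
  qed
qed

end
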